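(* Let $1<p<\infty$ and let $\omega\in\mathrm{Rat}$, $\omega\not\equiv0$. Let $T_\omega$ be the Toeplitz-like operator on $H^p$ with symbol $\omega$. Then $T_\omega$ is injective if and only if \[ \sharp\{\text{poles of }\omega\text{ in }\overline{\mathbb{D}}\}\ \le\ \sharp\{\text{zeroes of }\omega\text{ in }\overline{\mathbb{D}}\}, \] with multiplicities taken into account. Moreover, $T_\omega$ has dense range if and only if \[ \sharp\{\text{poles of }\omega\text{ in }\overline{\mathbb{D}}\}\ \ge\ \sharp\{\text{zeroes of }\omega\text{ in }\mathbb{D}\}, \] with multiplicities taken into account. In particular, $T_\omega$ is injective or has dense range.
   Context: $\mathbb{D}$ is the open unit disc in $\mathbb{C}$, $\overline{\mathbb{D}}$ its closure, $\mathbb{T}$ the unit circle. $\mathrm{Rat}$ is the space of rational functions with complex coefficients; $\mathrm{Rat}_0(\mathbb{T})$ is the subspace of strictly proper rational functions all of whose poles lie on $\mathbb{T}$ (including $0$). $L^p=L^p(\mathbb{T})$, $H^p$ is the Hardy space of the disc (identified via boundary values with a closed subspace of $L^p$), and $\mathbb{P}$ is the Riesz projection of $L^p$ onto $H^p$. For $\omega\in\mathrm{Rat}$, possibly with poles on $\mathbb{T}$, the (in general unbounded) operator $T_\omega$ on $H^p$ is defined by \[ \mathrm{Dom}(T_\omega)=\{g\in H^p \mid \omega g=f+\rho \text{ with } f\in L^p,\ \rho\in\mathrm{Rat}_0(\mathbb{T})\},\qquad T_\omega g=\mathbb{P}f . \] *)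

theory Defs
  imports "HOL-Analysis.Analysis" "HOL-Computational_Algebra.Computational_Algebra"
    "HOL-Computational_Algebra.Field_as_Ring"
begin

section \<open>Rational functions\<close>

text \<open>
  The space Rat is the fraction field \<^typ>\<open>complex poly fract\<close>; \<^const>\<open>quot_of_fract\<close> yields the
  representation in lowest terms (coprime numerator and denominator, the denominator normalised),
  so that zeroes and poles are the roots of numerator and denominator.
\<close>

definition rat_num :: "complex poly fract \<Rightarrow> complex poly" where
  "rat_num \<omega> = fst (quot_of_fract \<omega>)"

definition rat_denom :: "complex poly fract \<Rightarrow> complex poly" where
  "rat_denom \<omega> = snd (quot_of_fract \<omega>)"

text \<open>The value at a pole is the junk value \<open>0\<close>; only finitely many points are affected.\<close>

definition rat_eval :: "complex poly fract \<Rightarrow> complex \<Rightarrow> complex" where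
  "rat_eval \<omega> z = poly (rat_num \<omega>) z / poly (rat_denom \<omega>) z"

definition zeroes_count :: "complex poly fract \<Rightarrow> complex set \<Rightarrow> nat" where
  "zeroes_count \<omega> S = (\<Sum>z\<in>{z\<in>S. poly (rat_num \<omega>) z = 0}. order z (rat_num \<omega>))"

definition poles_count :: "complex poly fract \<Rightarrow> complex set \<Rightarrow> nat" where
  "poles_count \<omega> S = (\<Sum>z\<in>{z\<in>S. poly (rat_denom \<omega>) z = 0}. order z (rat_denom \<omega>))"

text \<open>
  The zero function is listed separately, since \<^const>\<open>degree\<close> gives the zero polynomial the degree
  of a constant.
\<close>

definition Rat0 :: "complex poly fract set" where
  "Rat0 = {\<rho>. \<rho> = 0 \<or> (degree (rat_num \<rho>) < degree (rat_denom \<rho>) \<and>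
                       (\<forall>z. poly (rat_denom \<rho>) z = 0 \<longrightarrow> z \<in> sphere 0 1))}"

section \<open>Lebesgue and Hardy spaces\<close>

text \<open>Normalised arc length; its underlying space is the unit circle.\<close>

definition circle_measure :: "complex measure" where
  "circle_measure =
     distr (uniform_measure lborel {0..<2 * pi}) (restrict_space borel (sphere 0 1)) cis"

text \<open>Elements of \<open>L\<^sup>p\<close> are representatives; equality in \<open>L\<^sup>p\<close> is equality almost everywhere.\<close>

definition Lp :: "real \<Rightarrow> (complex \<Rightarrow> complex) set" where
  "Lp p = {f \<in> borel_measurable circle_measure.
             integrable circle_measure (\<lambda>\<zeta>. norm (f \<zeta>) powr p)}"

definition integral_mean :: "real \<Rightarrow> (complex \<Rightarrow> complex) \<Rightarrow> real \<Rightarrow> real" where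
  "integral_mean p g r =
     (LINT \<zeta>|circle_measure. norm (g (of_real r * \<zeta>)) powr p) powr (1 / p)"

text \<open>
  Elements of the Hardy space are holomorphic functions on the disc, extended by \<open>0\<close> to a total
  function on the plane, so that equality in the Hardy space is equality of functions.
\<close>

definition Hp :: "real \<Rightarrow> (complex \<Rightarrow> complex) set" where
  "Hp p = {g. g holomorphic_on ball 0 1 \<and> (\<forall>z. z \<notin> ball 0 1 \<longrightarrow> g z = 0) \<and>
              bdd_above (integral_mean p g ` {0..<1})}"

definition Hp_norm :: "real \<Rightarrow> (complex \<Rightarrow> complex) \<Rightarrow> real" where
  "Hp_norm p g = (SUP r\<in>{0..<1}. integral_mean p g r)"

text \<open>The identification with a subspace of \<open>L\<^sup>p\<close>: \<open>b\<close> is the radial boundary function of \<open>g\<close>.\<close>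

definition boundary_function :: "(complex \<Rightarrow> complex) \<Rightarrow> (complex \<Rightarrow> complex) \<Rightarrow> bool" where
  "boundary_function g b \<longleftrightarrow>
     (AE \<zeta> in circle_measure. ((\<lambda>r. g (of_real r * \<zeta>)) \<longlongrightarrow> b \<zeta>) (at_left (1::real)))"

text \<open>
  The Riesz projection keeps the Fourier coefficients of nonnegative index and deletes the others;
  its value is given here as a function on the disc. For \<open>1 < p < \<infinity>\<close> it maps \<open>L\<^sup>p\<close> onto \<open>H\<^sup>p\<close> by
  the theorem of M. Riesz.
\<close>

definition fourier_coeff :: "(complex \<Rightarrow> complex) \<Rightarrow> int \<Rightarrow> complex" where
  "fourier_coeff f n = (LINT \<zeta>|circle_measure. f \<zeta> * \<zeta> powi (- n))"

definition riesz_projection :: "(complex \<Rightarrow> complex) \<Rightarrow> complex \<Rightarrow> complex" where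
  "riesz_projection f z =
     (if z \<in> ball 0 1 then (\<Sum>n. fourier_coeff f (int n) * z ^ n) else 0)"

section \<open>Toeplitz-like operators\<close>

definition toeplitz_decomp ::
  "real \<Rightarrow> complex poly fract \<Rightarrow> (complex \<Rightarrow> complex) \<Rightarrow> (complex \<Rightarrow> complex) \<Rightarrow> bool" where
  "toeplitz_decomp p \<omega> g f \<longleftrightarrow>
     f \<in> Lp p \<and>
     (\<exists>\<rho>\<in>Rat0. \<exists>b. boundary_function g b \<and>
        (AE \<zeta> in circle_measure. rat_eval \<omega> \<zeta> * b \<zeta> = f \<zeta> + rat_eval \<rho> \<zeta>))"

definition toeplitz_dom :: "real \<Rightarrow> complex poly fract \<Rightarrow> (complex \<Rightarrow> complex) set" where
  "toeplitz_dom p \<omega> = {g \<in> Hp p. \<exists>f. toeplitz_decomp p \<omega> g f}"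

text \<open>
  The description is proper on the domain: the zero function is the only element of \<^const>\<open>Rat0\<close> in
  \<open>L\<^sup>p\<close>, so \<open>f\<close> is unique up to a null set.
\<close>

definition toeplitz ::
  "real \<Rightarrow> complex poly fract \<Rightarrow> (complex \<Rightarrow> complex) \<Rightarrow> (complex \<Rightarrow> complex)" where
  "toeplitz p \<omega> g = (THE h. \<exists>f. toeplitz_decomp p \<omega> g f \<and> h = riesz_projection f)"

text \<open>
  Norm density in the Hardy space. The intersection with \<^term>\<open>Hp p\<close> changes nothing for sets of
  elements of the Hardy space; for other functions \<^const>\<open>Hp_norm\<close> has no meaning.
\<close>

definition dense_in_Hp :: "real \<Rightarrow> (complex \<Rightarrow> complex) set \<Rightarrow> bool" where
  "dense_in_Hp p A \<longleftrightarrow>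
     (\<forall>h\<in>Hp p. \<forall>\<epsilon>>0. \<exists>k\<in>A \<inter> Hp p. Hp_norm p (\<lambda>z. h z - k z) < \<epsilon>)"

end

theory Submission
  imports Defs "HOL-Complex_Analysis.Complex_Analysis" "HOL-Probability.Probability_Measure"
    "HOL-Real_Asymp.Real_Asymp"
begin

text \<open>
  Write \<open>\<omega> = n / d\<close> in lowest terms, \<open>n = nout nc\<close> and \<open>d = dout dc\<close>, where \<open>nc\<close>, \<open>dc\<close> collect the
  roots in the closed disc. Comparing Fourier coefficients, and using that neither \<open>g\<close> nor the
  projection \<open>h\<close> of an \<open>L\<^sup>p\<close> function can have a pole on the circle, one finds: \<open>T g = h\<close> forces
  \<open>n g = dout (u + dc h)\<close> on the disc for a polynomial \<open>u\<close> of degree less than \<open>degree dc\<close>, and for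
  polynomials \<open>h\<close> this equation is also sufficient. Hence two elements with the same image differ by
  a \<open>g\<close> with \<open>nc nout g = dout u\<close>, so that \<open>nc\<close> divides \<open>u\<close>, which gives the criterion for
  injectivity. A polynomial \<open>h\<close> lies in the range if \<open>nc\<close> divides \<open>u + dc h\<close> for some such \<open>u\<close>.
  Roots of \<open>nc\<close> on the circle impose no restriction on the closure, because multiples of \<open>z - a\<close> with
  \<open>|a| = 1\<close> are dense; the roots in the open disc can be handled by \<open>u\<close> if and only if there are at
  most \<open>degree dc\<close> of them. Density of polynomials in \<open>H\<^sup>p\<close> comes from uniform convexity and the
  monotonicity of the means.
\<close>

section \<open>The circle measure\<close>

text \<open>The degree bound on \<open>u\<close> comes from a commutator: multiplication by a
  polynomial \<open>c\<close> commutes with the Riesz projection up to a polynomial of degree less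
  than \<open>degree c\<close>, because only finitely many coefficients of negative index are pushed
  across zero. The obstacle is the fraction \<rho>, whose denominator \<open>q\<close> is unrelated
  to \<omega>. Clearing it raises the bound to \<open>degree q + degree dc\<close>, and
  \<open>q\<close> has to be divided out again, although the identity is known only on the open disc
  and the roots of \<open>q\<close> lie on its boundary. Growth towards the circle decides this: for
  integrable \<open>f\<close>, the projection times \<open>1 - r\<close> tends to 0 along radii, so
  the quotient cannot have a pole there. The same holds for \<open>g\<close>, which is the
  projection of its own boundary function; here \<open>p > 1\<close> enters. Divisibility on the
  disc combined with too small a degree also shows that the value of \<open>toeplitz\<close> is
  unique.\<close>

lemma measurable_cis_uniform:
  "cis \<in> measurable (uniform_measure lborel {0..<2 * pi}) (restrict_space borel (sphere 0 1))"
proof (rule measurable_restrict_space2)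
  have "cis \<in> borel_measurable borel"
    by (intro borel_measurable_continuous_onI continuous_intros)
  then show "cis \<in> borel_measurable (uniform_measure lborel {0..<2 * pi})"
    by (simp add: measurable_cong_sets[OF sets_uniform_measure refl])
qed auto

lemma space_circle [simp]: "space circle_measure = sphere 0 1"
  by (simp add: circle_measure_def space_restrict_space)

lemma sets_circle [measurable_cong]: "sets circle_measure = sets (restrict_space borel (sphere 0 1))"
  by (simp add: circle_measure_def)

lemma prob_space_circle: "prob_space circle_measure"
proof -
  have "prob_space (uniform_measure lborel {0..<2 * pi})"
    by (rule prob_space_uniform_measure) auto
  then show ?thesis
    unfolding circle_measure_def by (rule prob_space.prob_space_distr) (rule measurable_cis_uniform)
qed

interpretation circle: prob_space circle_measure
  by (rule prob_space_circle)

lemma measurable_circle_continuous: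
  fixes f :: "complex \<Rightarrow> 'b::topological_space"
  assumes "continuous_on (sphere 0 1) f"
  shows "f \<in> borel_measurable circle_measure"
  using borel_measurable_continuous_on_restrict[OF assms] measurable_cong_sets[OF sets_circle refl] by blast

lemma integrable_circle_bounded:
  fixes f :: "complex \<Rightarrow> 'b::{banach, second_countable_topology}"
  assumes "f \<in> borel_measurable circle_measure" "\<And>z. norm z = 1 \<Longrightarrow> norm (f z) \<le> B"
  shows "integrable circle_measure f"
  by (rule circle.integrable_const_bound[where B=B]) (use assms in auto)

lemma integrable_circle_continuous:
  fixes f :: "complex \<Rightarrow> 'b::{banach, second_countable_topology}"
  assumes "continuous_on (sphere 0 1) f"
  shows "integrable circle_measure f"
proof -
  have "compact (f ` sphere 0 1)"
    using assms by (rule compact_continuous_image) simp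
  then obtain B where "\<forall>y\<in>f ` sphere 0 1. norm y \<le> B"
    using compact_imp_bounded bounded_iff by blast
  then have "norm (f z) \<le> B" if "norm z = 1" for z
    using that by simp
  then show ?thesis
    by (rule integrable_circle_bounded[OF measurable_circle_continuous[OF assms]])
qed

text \<open>For continuous integrands the measure integral becomes a gauge integral over a closed
  interval, the endpoint \<open>2 * pi\<close> being a null set. The rules for shifting and
  splitting intervals then give rotation invariance.\<close>

lemma circle_integral_eq:
  fixes f :: "complex \<Rightarrow> 'b::euclidean_space"
  assumes "continuous_on (sphere 0 1) f"
  shows "(LINT \<zeta>|circle_measure. f \<zeta>) = integral {0..2 * pi} (\<lambda>t. f (cis t)) /\<^sub>R (2 * pi)"
proof -
  have cont: "continuous_on UNIV (\<lambda>t. f (cis t))"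
    by (rule continuous_on_compose2[OF assms]) (auto intro!: continuous_intros)
  then have meas: "(\<lambda>t. f (cis t)) \<in> borel_measurable borel"
    by (rule borel_measurable_continuous_onI)
  have fm: "f \<in> borel_measurable (restrict_space borel (sphere 0 1))"
    by (rule borel_measurable_continuous_on_restrict[OF assms])
  have dens: "uniform_measure lborel {0..<2 * pi} =
      density lborel (\<lambda>t. ennreal (indicator {0..<2 * pi} t / (2 * pi)))"
    unfolding uniform_measure_def
  proof (intro arg_cong[where f="density lborel"] ext)
    fix t
    have "1 / ennreal (2 * pi) = ennreal (1 / (2 * pi))"
      using divide_ennreal[of 1 "2 * pi"] by simp
    then show "indicator {0..<2 * pi} t / emeasure lborel {0..<2 * pi} =
        ennreal (indicator {0..<2 * pi} t / (2 * pi))"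
      by (cases "t \<in> {0..<2 * pi}") simp_all
  qed
  define I where "I = (LINT t|lborel. indicator {0..<2 * pi} t *\<^sub>R f (cis t))"
  have "(LINT \<zeta>|circle_measure. f \<zeta>) = (LINT t|uniform_measure lborel {0..<2 * pi}. f (cis t))"
    unfolding circle_measure_def by (rule integral_distr[OF measurable_cis_uniform fm])
  also have "\<dots> = (LINT t|lborel. (indicator {0..<2 * pi} t / (2 * pi)) *\<^sub>R f (cis t))"
    unfolding dens by (rule integral_density) (use meas in auto)
  also have "\<dots> = (LINT t|lborel. (1 / (2 * pi)) *\<^sub>R (indicator {0..<2 * pi} t *\<^sub>R f (cis t)))"
    by (rule Bochner_Integration.integral_cong) simp_all
  also have "\<dots> = (1 / (2 * pi)) *\<^sub>R I"
    unfolding I_def by (subst Bochner_Integration.integral_scaleR_right) (rule refl)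
  finally have 1: "(LINT \<zeta>|circle_measure. f \<zeta>) = (1 / (2 * pi)) *\<^sub>R I" .
  have 2: "I = (LINT t|lborel. indicator {0..2 * pi} t *\<^sub>R f (cis t))"
    unfolding I_def
  proof (rule integral_cong_AE)
    show "AE t in lborel. indicator {0..<2 * pi} t *\<^sub>R f (cis t) = indicator {0..2 * pi} t *\<^sub>R f (cis t)"
      using AE_lborel_singleton[of "2 * pi"] by eventually_elim (auto split: split_indicator)
  qed (use meas in auto)
  have "set_integrable lborel {0..2 * pi} (\<lambda>t. f (cis t))"
    by (rule borel_integrable_atLeastAtMost') (auto intro: continuous_on_subset[OF cont])
  from set_borel_integral_eq_integral(2)[OF this]
  have 3: "(LINT t|lborel. indicator {0..2 * pi} t *\<^sub>R f (cis t)) = integral {0..2 * pi} (\<lambda>t. f (cis t))"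
    by (simp add: set_lebesgue_integral_def)
  show ?thesis
    unfolding 1 2 3 inverse_eq_divide ..
qed

text \<open>Rotation shifts the angle by \<alpha>; the piece of the shifted interval beyond
  \<open>2 * pi\<close> is moved back to \<open>{0..\<alpha>}\<close> by periodicity.\<close>

lemma circle_integral_rotate:
  fixes f :: "complex \<Rightarrow> 'b::euclidean_space"
  assumes "continuous_on (sphere 0 1) f" and "norm \<eta> = 1"
  shows "(LINT \<zeta>|circle_measure. f (\<eta> * \<zeta>)) = (LINT \<zeta>|circle_measure. f \<zeta>)"
proof -
  obtain \<alpha> where \<alpha>: "0 \<le> \<alpha>" "\<alpha> < 2 * pi" "\<eta> = cis \<alpha>"
  proof -
    have "\<eta> = cis (Arg2pi \<eta>)" using assms(2) Arg2pi_eq[of \<eta>] by (simp add: cis_conv_exp)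
    then show thesis using that[of "Arg2pi \<eta>"] Arg2pi by auto
  qed
  define F where "F t = f (cis t)" for t
  have contF: "continuous_on S F" for S
    unfolding F_def by (rule continuous_on_compose2[OF assms(1)]) (auto intro!: continuous_intros)
  have int: "F integrable_on {a..b}" for a b
    by (rule integrable_continuous_real[OF contF])
  have per: "F (t + 2 * pi) = F t" for t
    by (simp add: F_def flip: cis_mult)
  have "integral {0..2 * pi} (\<lambda>t. F (t + \<alpha>)) = integral {\<alpha>..2 * pi + \<alpha>} F"
    using integral_shift_Icc_real[of 0 "2 * pi" F \<alpha>] by (simp add: o_def add.commute[of \<alpha>])
  also have "\<dots> = integral {\<alpha>..2 * pi} F + integral {2 * pi..2 * pi + \<alpha>} F"
    by (rule Henstock_Kurzweil_Integration.integral_combine[symmetric]) (use \<alpha> int in auto)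
  also have "integral {2 * pi..2 * pi + \<alpha>} F = integral {0..\<alpha>} (\<lambda>t. F (t + 2 * pi))"
    using integral_shift_Icc_real[of 0 \<alpha> F "2 * pi"] by (simp add: o_def add.commute[of "2 * pi"])
  also have "\<dots> = integral {0..\<alpha>} F"
    by (simp add: per)
  also have "integral {\<alpha>..2 * pi} F + integral {0..\<alpha>} F = integral {0..2 * pi} F"
    using Henstock_Kurzweil_Integration.integral_combine[of 0 \<alpha> "2 * pi" F] \<alpha> int by (simp add: add.commute)
  finally have *: "integral {0..2 * pi} (\<lambda>t. F (t + \<alpha>)) = integral {0..2 * pi} F" .
  have "continuous_on (sphere 0 1) (\<lambda>\<zeta>. f (\<eta> * \<zeta>))"
    by (rule continuous_on_compose2[OF assms(1)]) (auto intro!: continuous_intros simp: norm_mult assms)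
  then show ?thesis
    using *[unfolded F_def] by (simp add: circle_integral_eq assms(1) \<alpha>(3) cis_mult add.commute[of _ \<alpha>])
qed

lemma inj_on_cis: "inj_on cis {0..<2 * pi}"
proof (rule inj_on_inverseI)
  fix t assume "t \<in> {0..<2 * pi}"
  then show "Arg2pi (cis t) = t"
    by (intro Arg2pi_unique[of 1]) (auto simp: cis_conv_exp)
qed

text \<open>For \<open>k \<noteq> 0\<close> a rotation by the angle \<open>1 / k\<close> multiplies
  the integral by \<open>cis 1\<close>, and \<open>cis 1 \<noteq> 1\<close> since
  \<open>0 < 1 < 2 * pi\<close>; so the integral is zero.\<close>

lemma circle_integral_powi: "(LINT \<zeta>|circle_measure. \<zeta> powi k) = (if k = 0 then 1 else 0)"
proof (cases "k = 0")
  case False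
  define \<eta> where "\<eta> = cis (1 / of_int k)"
  have "\<eta> powi k = cis 1"
    using False by (simp add: \<eta>_def cis_power_int)
  moreover have "cis 1 \<noteq> cis 0"
    using inj_onD[OF inj_on_cis, of 1 0] pi_gt3 by auto
  ultimately have ne: "\<eta> powi k \<noteq> 1" by simp
  have cont: "continuous_on (sphere 0 1) (\<lambda>\<zeta>::complex. \<zeta> powi k)"
    by (intro continuous_intros) auto
  have "(LINT \<zeta>|circle_measure. \<zeta> powi k) = (LINT \<zeta>|circle_measure. (\<eta> * \<zeta>) powi k)"
    by (rule circle_integral_rotate[OF cont, symmetric]) (simp add: \<eta>_def)
  also have "\<dots> = \<eta> powi k * (LINT \<zeta>|circle_measure. \<zeta> powi k)"
    by (simp add: power_int_mult_distrib)
  finally show ?thesis using ne False by simp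
qed (simp add: circle.prob_space[simplified])

text \<open>\<open>cis\<close> is injective on the half-open interval, so a finite set has a finite
  preimage. This discards roots of denominators on the circle, where division gives the default
  value 0.\<close>

lemma AE_circle_finite:
  assumes "finite A"
  shows "AE \<zeta> in circle_measure. \<zeta> \<notin> A"
proof -
  have "finite {t\<in>{0..<2 * pi}. cis t \<in> A}"
    using finite_vimage_IntI[OF assms inj_on_cis] by (simp add: vimage_def Int_def conj_commute)
  then have "AE t in lborel. t \<notin> {t\<in>{0..<2 * pi}. cis t \<in> A}"
    by (intro AE_not_in) (auto intro: finite_imp_null_set_lborel)
  then have "AE t in uniform_measure lborel {0..<2 * pi}. cis t \<notin> A"
    by (subst AE_uniform_measure) auto
  moreover have "{x \<in> space (restrict_space borel (sphere 0 1)). x \<notin> A} \<in> sets (restrict_space borel (sphere 0 1))"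
  proof -
    have "{x \<in> space (restrict_space borel (sphere 0 1)). x \<notin> A} = sphere 0 1 \<inter> (- A)"
      by (auto simp: space_restrict_space)
    moreover have "- A \<in> sets borel" using assms by (auto intro: borel_open finite_imp_closed)
    ultimately show ?thesis by (simp add: sets_restrict_space)
  qed
  ultimately show ?thesis
    unfolding circle_measure_def by (subst AE_distr_iff[OF measurable_cis_uniform]) auto
qed

section \<open>Fourier coefficients and the Riesz projection\<close>

lemma AE_circleI: "(\<And>\<zeta>. norm \<zeta> = 1 \<Longrightarrow> P \<zeta>) \<Longrightarrow> AE \<zeta> in circle_measure. P \<zeta>"
  by (rule AE_I2) simp

lemma circle_integral_cong:
  "(\<And>\<zeta>. norm \<zeta> = 1 \<Longrightarrow> f \<zeta> = g \<zeta>) \<Longrightarrow> (LINT \<zeta>|circle_measure. f \<zeta>) = (LINT \<zeta>|circle_measure. g \<zeta>)"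
  by (rule Bochner_Integration.integral_cong) auto

lemma integrable_circle_cmult:
  fixes f \<phi> :: "complex \<Rightarrow> complex"
  assumes "integrable circle_measure f" and "continuous_on (sphere 0 1) \<phi>"
  shows "integrable circle_measure (\<lambda>\<zeta>. \<phi> \<zeta> * f \<zeta>)"
proof -
  have "compact (\<phi> ` sphere 0 1)"
    using assms(2) by (rule compact_continuous_image) simp
  then obtain B where "\<forall>y\<in>\<phi> ` sphere 0 1. norm y \<le> B"
    using compact_imp_bounded bounded_iff by blast
  then have B: "norm (\<phi> z) \<le> B" if "norm z = 1" for z
    using that by simp
  have B0: "0 \<le> B"
    by (rule order_trans[OF norm_ge_zero B[of 1]]) simp
  show ?thesis
  proof (rule Bochner_Integration.integrable_bound)
    show "integrable circle_measure (\<lambda>\<zeta>. B * norm (f \<zeta>))"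
      using assms(1) by simp
    show "(\<lambda>\<zeta>. \<phi> \<zeta> * f \<zeta>) \<in> borel_measurable circle_measure"
      using measurable_circle_continuous[OF assms(2)] borel_measurable_integrable[OF assms(1)]
      by (rule borel_measurable_times)
    show "AE \<zeta> in circle_measure. norm (\<phi> \<zeta> * f \<zeta>) \<le> norm (B * norm (f \<zeta>))"
      by (rule AE_circleI) (use B B0 in \<open>auto simp: norm_mult abs_mult intro!: mult_right_mono\<close>)
  qed
qed

lemma integrable_fourier:
  assumes "integrable circle_measure f"
  shows "integrable circle_measure (\<lambda>\<zeta>. f \<zeta> * \<zeta> powi k)"
proof -
  have "continuous_on (sphere 0 1) (\<lambda>\<zeta>::complex. \<zeta> powi k)"
    by (intro continuous_intros) auto
  from integrable_circle_cmult[OF assms this] show ?thesis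
    by (simp add: mult.commute)
qed

lemma norm_fourier_coeff_le:
  assumes "integrable circle_measure f"
  shows "norm (fourier_coeff f k) \<le> (LINT \<zeta>|circle_measure. norm (f \<zeta>))"
proof -
  have "norm (fourier_coeff f k) \<le> (LINT \<zeta>|circle_measure. norm (f \<zeta> * \<zeta> powi (- k)))"
    unfolding fourier_coeff_def by (rule integral_norm_bound)
  also have "\<dots> = (LINT \<zeta>|circle_measure. norm (f \<zeta>))"
    by (rule circle_integral_cong) (simp add: norm_mult norm_power_int)
  finally show ?thesis .
qed

lemma fourier_coeff_add:
  assumes "integrable circle_measure f" "integrable circle_measure g"
  shows "fourier_coeff (\<lambda>\<zeta>. f \<zeta> + g \<zeta>) k = fourier_coeff f k + fourier_coeff g k"
  unfolding fourier_coeff_def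
  by (simp add: distrib_right Bochner_Integration.integral_add integrable_fourier assms)

lemma fourier_coeff_diff:
  assumes "integrable circle_measure f" "integrable circle_measure g"
  shows "fourier_coeff (\<lambda>\<zeta>. f \<zeta> - g \<zeta>) k = fourier_coeff f k - fourier_coeff g k"
  unfolding fourier_coeff_def
  by (simp add: left_diff_distrib Bochner_Integration.integral_diff integrable_fourier assms)

lemma fourier_coeff_cmult: "fourier_coeff (\<lambda>\<zeta>. c * f \<zeta>) k = c * fourier_coeff f k"
  unfolding fourier_coeff_def by (simp add: mult.assoc)

lemma fourier_coeff_shift: "fourier_coeff (\<lambda>\<zeta>. \<zeta> * f \<zeta>) k = fourier_coeff f (k - 1)"
  unfolding fourier_coeff_def
proof (rule circle_integral_cong)
  fix \<zeta> :: complex assume "norm \<zeta> = 1"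
  then have "\<zeta> \<noteq> 0" by auto
  then have "\<zeta> powi (- (k - 1)) = \<zeta> * \<zeta> powi (- k)"
    using power_int_add_1'[of \<zeta> "- k"] by (simp add: algebra_simps)
  then show "\<zeta> * f \<zeta> * \<zeta> powi (- k) = f \<zeta> * \<zeta> powi (- (k - 1))"
    by simp
qed

lemma fourier_coeff_cong:
  "(\<And>\<zeta>. norm \<zeta> = 1 \<Longrightarrow> f \<zeta> = g \<zeta>) \<Longrightarrow> fourier_coeff f k = fourier_coeff g k"
  unfolding fourier_coeff_def by (rule circle_integral_cong) simp

lemma fourier_coeff_poly:
  "fourier_coeff (poly e) k = (if k \<ge> 0 then coeff e (nat k) else 0)"
proof (induction e arbitrary: k)
  case 0
  then show ?case by (simp add: fourier_coeff_def)
next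
  case (pCons a e)
  have 1: "fourier_coeff (\<lambda>_. 1) k = (if k = 0 then 1 else 0)"
    unfolding fourier_coeff_def by (simp add: circle_integral_powi)
  have "fourier_coeff (poly (pCons a e)) k = fourier_coeff (\<lambda>\<zeta>. a * 1 + \<zeta> * poly e \<zeta>) k"
    by (rule fourier_coeff_cong) simp
  also have "\<dots> = fourier_coeff (\<lambda>\<zeta>. a * 1) k + fourier_coeff (\<lambda>\<zeta>. \<zeta> * poly e \<zeta>) k"
    by (rule fourier_coeff_add) (auto intro!: integrable_circle_continuous continuous_intros)
  also have "\<dots> = a * (if k = 0 then 1 else 0) + (if k - 1 \<ge> 0 then coeff e (nat (k - 1)) else 0)"
    by (simp only: fourier_coeff_cmult 1 fourier_coeff_shift pCons.IH)
  also have "\<dots> = (if k \<ge> 0 then coeff (pCons a e) (nat k) else 0)"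
  proof -
    have "nat k = Suc (nat (k - 1))" if "k \<ge> 1" using that by simp
    then show ?thesis by (cases "k \<ge> 1"; cases "k = 0") auto
  qed
  finally show ?case .
qed

text \<open>Absolute summability on the circle itself allows termwise integration, after which
  orthogonality of the powers picks a single term.\<close>

lemma fourier_coeff_power_series:
  fixes a :: "nat \<Rightarrow> complex"
  assumes "summable (\<lambda>n. norm (a n))"
  shows "fourier_coeff (\<lambda>\<zeta>. \<Sum>n. a n * \<zeta> ^ n) k = (if k \<ge> 0 then a (nat k) else 0)"
proof -
  define F where "F n \<zeta> = a n * \<zeta> powi (int n - k)" for n and \<zeta> :: complex
  have nF: "norm (F n \<zeta>) = norm (a n)" if "norm \<zeta> = 1" for n \<zeta>
    using that by (simp add: F_def norm_mult norm_power_int)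
  have int: "integrable circle_measure (F n)" for n
    unfolding F_def by (auto intro!: integrable_circle_continuous continuous_intros)
  have "fourier_coeff (\<lambda>\<zeta>. \<Sum>n. a n * \<zeta> ^ n) k = (LINT \<zeta>|circle_measure. (\<Sum>n. F n \<zeta>))"
    unfolding fourier_coeff_def
  proof (rule circle_integral_cong)
    fix \<zeta> :: complex assume z: "norm \<zeta> = 1"
    then have "summable (\<lambda>n. a n * \<zeta> ^ n)"
      by (intro summable_norm_cancel[OF summable_cong[THEN iffD1, OF _ assms]])
        (auto simp: norm_mult norm_power)
    moreover have "F n \<zeta> = a n * \<zeta> ^ n * \<zeta> powi (- k)" for n
    proof -
      have "\<zeta> \<noteq> 0" using z by auto
      then show ?thesis using power_int_add[of \<zeta> "int n" "- k"] by (simp add: F_def)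
    qed
    ultimately show "(\<Sum>n. a n * \<zeta> ^ n) * \<zeta> powi (- k) = (\<Sum>n. F n \<zeta>)"
      by (simp add: suminf_mult2)
  qed
  also have "\<dots> = (\<Sum>n. LINT \<zeta>|circle_measure. F n \<zeta>)"
  proof (rule integral_suminf[OF int])
    show "AE \<zeta> in circle_measure. summable (\<lambda>n. norm (F n \<zeta>))"
      by (rule AE_circleI) (simp add: nF assms)
    have "(LINT \<zeta>|circle_measure. norm (F n \<zeta>)) = norm (a n)" for n
      using circle_integral_cong[of "\<lambda>\<zeta>. norm (F n \<zeta>)" "\<lambda>_. norm (a n)"] nF
      by (simp add: circle.prob_space[simplified])
    then show "summable (\<lambda>n. LINT \<zeta>|circle_measure. norm (F n \<zeta>))"
      using assms by simp
  qed
  also have "\<dots> = (\<Sum>n. if int n = k then a n else 0)"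
    by (rule suminf_cong) (simp add: F_def circle_integral_powi)
  also have "\<dots> = (if k \<ge> 0 then a (nat k) else 0)"
  proof (cases "k \<ge> 0")
    case True
    then have "(\<lambda>n. if int n = k then a n else 0) = (\<lambda>n. if n = nat k then a n else 0)"
      by (auto simp: fun_eq_iff)
    then show ?thesis using True sums_unique[OF sums_single[of "nat k" a]] by simp
  next
    case False
    then have "(\<lambda>n. if int n = k then a n else 0) = (\<lambda>n. 0)" by auto
    then show ?thesis using False by simp
  qed
  finally show ?thesis .
qed

section \<open>The Riesz projection as a power series and as a Cauchy integral\<close>

lemma riesz_projection_sums:
  assumes "integrable circle_measure f" "norm z < 1"
  shows "(\<lambda>n. fourier_coeff f (int n) * z ^ n) sums riesz_projection f z"
proof -
  have "summable (\<lambda>n. fourier_coeff f (int n) * z ^ n)"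
  proof (rule summable_comparison_test')
    show "summable (\<lambda>n. (LINT \<zeta>|circle_measure. norm (f \<zeta>)) * norm z ^ n)"
      using assms(2) by (intro summable_mult summable_geometric) simp
    show "norm (fourier_coeff f (int n) * z ^ n) \<le> (LINT \<zeta>|circle_measure. norm (f \<zeta>)) * norm z ^ n" for n
      using norm_fourier_coeff_le[OF assms(1)] by (auto simp: norm_mult norm_power intro!: mult_right_mono)
  qed
  then show ?thesis
    using assms(2) by (simp add: riesz_projection_def summable_sums)
qed

lemma riesz_projection_cong:
  "(\<And>n. fourier_coeff f (int n) = fourier_coeff g (int n)) \<Longrightarrow> riesz_projection f = riesz_projection g"
  by (simp add: riesz_projection_def fun_eq_iff)

lemma riesz_projection_outside: "norm z \<ge> 1 \<Longrightarrow> riesz_projection f z = 0"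
  by (simp add: riesz_projection_def)

lemma riesz_projection_holomorphic:
  assumes "integrable circle_measure f"
  shows "riesz_projection f holomorphic_on ball 0 1"
  by (rule power_series_holomorphic[where a="\<lambda>n. fourier_coeff f (int n)"])
    (use riesz_projection_sums[OF assms] in simp)

lemma riesz_projection_add:
  assumes "integrable circle_measure f" "integrable circle_measure g"
  shows "riesz_projection (\<lambda>\<zeta>. f \<zeta> + g \<zeta>) z = riesz_projection f z + riesz_projection g z"
proof (cases "norm z < 1")
  case True
  have "(\<lambda>n. fourier_coeff (\<lambda>\<zeta>. f \<zeta> + g \<zeta>) (int n) * z ^ n) sums (riesz_projection f z + riesz_projection g z)"
    using sums_add[OF riesz_projection_sums[OF assms(1) True] riesz_projection_sums[OF assms(2) True]]
    by (simp add: fourier_coeff_add assms distrib_right)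
  then show ?thesis
    using riesz_projection_sums[OF Bochner_Integration.integrable_add[OF assms] True] sums_unique2 by blast
qed (simp add: riesz_projection_def)

lemma riesz_projection_cmult:
  assumes "integrable circle_measure f"
  shows "riesz_projection (\<lambda>\<zeta>. c * f \<zeta>) z = c * riesz_projection f z"
proof (cases "norm z < 1")
  case True
  have "(\<lambda>n. fourier_coeff (\<lambda>\<zeta>. c * f \<zeta>) (int n) * z ^ n) sums (c * riesz_projection f z)"
    using sums_mult[OF riesz_projection_sums[OF assms(1) True]]
    by (simp add: fourier_coeff_cmult mult.assoc)
  then show ?thesis
    using True by (simp add: riesz_projection_def sums_iff)
qed (simp add: riesz_projection_def)

text \<open>Multiplication by the variable moves the coefficient of index -1 to index 0. That
  coefficient is the whole defect of commutation with the projection.\<close>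

lemma riesz_projection_shift:
  assumes "integrable circle_measure f" "norm z < 1"
  shows "riesz_projection (\<lambda>\<zeta>. \<zeta> * f \<zeta>) z = z * riesz_projection f z + fourier_coeff f (-1)"
proof -
  have "(\<lambda>n. fourier_coeff (\<lambda>\<zeta>. \<zeta> * f \<zeta>) (int (Suc n)) * z ^ Suc n) sums (z * riesz_projection f z)"
    using sums_mult[OF riesz_projection_sums[OF assms], of z]
    by (simp add: fourier_coeff_shift mult.left_commute)
  then have "(\<lambda>n. fourier_coeff (\<lambda>\<zeta>. \<zeta> * f \<zeta>) (int n) * z ^ n) sums
      (z * riesz_projection f z + fourier_coeff f (-1))"
    using sums_Suc_iff[of "\<lambda>n. fourier_coeff (\<lambda>\<zeta>. \<zeta> * f \<zeta>) (int n) * z ^ n"]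
    by (simp add: fourier_coeff_shift)
  then show ?thesis
    using assms(2) by (simp add: riesz_projection_def sums_iff)
qed

lemma riesz_projection_poly:
  assumes "norm z < 1"
  shows "riesz_projection (poly e) z = poly e z"
proof -
  have "(\<lambda>n. coeff e n * z ^ n) sums poly e z"
    using sums_finite[of "{..degree e}" "\<lambda>n. coeff e n * z ^ n"]
    by (auto simp: poly_altdef coeff_eq_0)
  then show ?thesis
    using assms by (simp add: riesz_projection_def fourier_coeff_poly sums_iff)
qed

lemma integrable_poly_mult:
  assumes "integrable circle_measure f"
  shows "integrable circle_measure (\<lambda>\<zeta>. poly c \<zeta> * f \<zeta>)"
  by (rule integrable_circle_cmult[OF assms]) (intro continuous_intros)

text \<open>Horner's scheme: each multiplication by the variable adds one constant, so the defect
  \<open>u\<close> has at most \<open>degree c\<close> coefficients. The bound is put on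
  coefficients so that \<open>u = 0\<close> is forced for constant \<open>c\<close>.\<close>

lemma riesz_projection_poly_mult:
  assumes "integrable circle_measure f"
  obtains u where "\<And>i. i \<ge> degree c \<Longrightarrow> coeff u i = 0"
    and "\<And>z. norm z < 1 \<Longrightarrow> riesz_projection (\<lambda>\<zeta>. poly c \<zeta> * f \<zeta>) z = poly c z * riesz_projection f z + poly u z"
proof -
  have "\<exists>u. (\<forall>i\<ge>degree c. coeff u i = 0) \<and> (\<forall>z. norm z < 1 \<longrightarrow>
      riesz_projection (\<lambda>\<zeta>. poly c \<zeta> * f \<zeta>) z = poly c z * riesz_projection f z + poly u z)"
  proof (induction c)
    case 0
    have "riesz_projection (\<lambda>\<zeta>. 0) z = 0" for z
      by (simp add: riesz_projection_def fourier_coeff_def)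
    then show ?case by (intro exI[of _ 0]) simp
  next
    case (pCons a c)
    show ?case
    proof (cases "c = 0")
      case True
      then show ?thesis
        by (intro exI[of _ 0]) (simp add: riesz_projection_cmult[OF assms])
    next
      case False
      obtain u where u: "\<And>i. i \<ge> degree c \<Longrightarrow> coeff u i = 0"
        "\<And>z. norm z < 1 \<Longrightarrow> riesz_projection (\<lambda>\<zeta>. poly c \<zeta> * f \<zeta>) z = poly c z * riesz_projection f z + poly u z"
        using pCons.IH by blast
      define b where "b = fourier_coeff (\<lambda>\<zeta>. poly c \<zeta> * f \<zeta>) (-1)"
      note int = integrable_poly_mult[OF assms]
      have int_z: "integrable circle_measure (\<lambda>\<zeta>. \<zeta> * (poly c \<zeta> * f \<zeta>))"
        using integrable_circle_cmult[OF int, of "\<lambda>\<zeta>. \<zeta>"] by simp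
      have "riesz_projection (\<lambda>\<zeta>. poly (pCons a c) \<zeta> * f \<zeta>) z =
          poly (pCons a c) z * riesz_projection f z + poly (pCons b u) z" if z: "norm z < 1" for z
      proof -
        have "riesz_projection (\<lambda>\<zeta>. poly (pCons a c) \<zeta> * f \<zeta>) z =
            riesz_projection (\<lambda>\<zeta>. a * f \<zeta> + \<zeta> * (poly c \<zeta> * f \<zeta>)) z"
          by (simp add: algebra_simps)
        also have "\<dots> = a * riesz_projection f z + (z * riesz_projection (\<lambda>\<zeta>. poly c \<zeta> * f \<zeta>) z + b)"
          using assms int_z riesz_projection_shift[OF int z, of c]
          by (simp add: riesz_projection_add riesz_projection_cmult b_def)
        finally show ?thesis using u(2)[OF z] by (simp add: algebra_simps)
      qed
      moreover have "coeff (pCons b u) i = 0" if "i \<ge> degree (pCons a c)" for i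
        using that False u(1) by (cases i) auto
      ultimately show ?thesis by blast
    qed
  qed
  then show thesis using that by blast
qed

text \<open>The geometric series in \<open>z / \<zeta>\<close> sums the kernel to
  \<open>\<zeta> / (\<zeta> - z)\<close>. The closed form makes the growth at the boundary
  visible.\<close>

lemma riesz_projection_cauchy:
  assumes "integrable circle_measure f" "norm z < 1"
  shows "riesz_projection f z = (LINT \<zeta>|circle_measure. f \<zeta> * (\<zeta> / (\<zeta> - z)))"
proof -
  define F where "F n \<zeta> = f \<zeta> * \<zeta> powi (- int n) * z ^ n" for n \<zeta>
  have int: "integrable circle_measure (F n)" for n
    unfolding F_def by (intro integrable_mult_left integrable_fourier assms)
  have nF: "norm (F n \<zeta>) = norm (f \<zeta>) * norm z ^ n" if "norm \<zeta> = 1" for n \<zeta>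
    using that by (simp add: F_def norm_mult norm_power norm_power_int)
  have "riesz_projection f z = (\<Sum>n. LINT \<zeta>|circle_measure. F n \<zeta>)"
    using assms(2) by (simp add: riesz_projection_def fourier_coeff_def F_def)
  also have "\<dots> = (LINT \<zeta>|circle_measure. (\<Sum>n. F n \<zeta>))"
  proof (rule integral_suminf[OF int, symmetric])
    show "AE \<zeta> in circle_measure. summable (\<lambda>n. norm (F n \<zeta>))"
      by (rule AE_circleI) (use assms(2) in \<open>simp add: nF summable_mult summable_geometric\<close>)
    have "(LINT \<zeta>|circle_measure. norm (F n \<zeta>)) = (LINT \<zeta>|circle_measure. norm (f \<zeta>)) * norm z ^ n" for n
      using circle_integral_cong[of "\<lambda>\<zeta>. norm (F n \<zeta>)" "\<lambda>\<zeta>. norm (f \<zeta>) * norm z ^ n"] nF by simp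
    then show "summable (\<lambda>n. LINT \<zeta>|circle_measure. norm (F n \<zeta>))"
      using assms(2) by (simp add: summable_mult summable_geometric)
  qed
  also have "\<dots> = (LINT \<zeta>|circle_measure. f \<zeta> * (\<zeta> / (\<zeta> - z)))"
  proof (rule circle_integral_cong)
    fix \<zeta> :: complex assume z: "norm \<zeta> = 1"
    then have nz: "\<zeta> \<noteq> 0" "\<zeta> \<noteq> z" using assms(2) by auto
    have "norm (z / \<zeta>) < 1" using z assms(2) by (simp add: norm_divide)
    from sums_mult[OF geometric_sums[OF this], of "f \<zeta>"]
    have "(\<lambda>n. F n \<zeta>) sums (f \<zeta> * (1 / (1 - z / \<zeta>)))"
      by (simp add: F_def power_int_minus divide_inverse power_mult_distrib power_inverse mult_ac)
    then have "(\<Sum>n. F n \<zeta>) = f \<zeta> * (1 / (1 - z / \<zeta>))"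
      by (rule sums_unique[symmetric])
    also have "1 / (1 - z / \<zeta>) = \<zeta> / (\<zeta> - z)"
      using nz by (simp add: field_simps)
    finally show "(\<Sum>n. F n \<zeta>) = f \<zeta> * (\<zeta> / (\<zeta> - z))" .
  qed
  finally show ?thesis .
qed

section \<open>Growth along radii and divisibility on the disc\<close>

definition radius_seq :: "nat \<Rightarrow> real" where
  "radius_seq n = 1 - 1 / (real n + 2)"

text \<open>A sequence of radii, as dominated convergence works along sequences. The 2 in the
  denominator makes even the first radius positive.\<close>

lemma radius_seq_bounds: "0 < radius_seq n" "radius_seq n < 1"
  by (auto simp: radius_seq_def field_simps)

lemma radius_seq_tendsto: "radius_seq \<longlonglongrightarrow> 1"
  unfolding radius_seq_def by real_asymp

lemma radius_seq_filterlim: "filterlim radius_seq (at_left 1) sequentially"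
  unfolding filterlim_at using radius_seq_tendsto radius_seq_bounds(2)
  by (auto intro!: always_eventually simp: less_imp_neq)

lemma norm_radius_seq [simp]: "norm (complex_of_real (radius_seq n)) = radius_seq n"
  using radius_seq_bounds[of n] by simp

lemma radius_seq_in_ball: "norm a = 1 \<Longrightarrow> norm (complex_of_real (radius_seq n) * a) < 1"
  using radius_seq_bounds[of n] by (simp add: norm_mult)

lemma radius_seq_mult_tendsto: "(\<lambda>n. complex_of_real (radius_seq n) * a) \<longlonglongrightarrow> a"
  using tendsto_mult[OF tendsto_of_real[OF radius_seq_tendsto] tendsto_const[of a]] by simp

text \<open>Functions in this class cannot have a pole on the unit circle.\<close>

definition radially_small :: "(complex \<Rightarrow> complex) \<Rightarrow> bool" where
  "radially_small G \<longleftrightarrow>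
     (\<forall>a. norm a = 1 \<longrightarrow> (\<lambda>n. of_real (1 - radius_seq n) * G (of_real (radius_seq n) * a)) \<longlonglongrightarrow> 0)"

lemma radially_small_cong:
  assumes "radially_small F" "\<And>z. norm z < 1 \<Longrightarrow> F z = G z"
  shows "radially_small G"
  using assms by (simp add: radially_small_def radius_seq_in_ball)

lemma radially_small_diff:
  assumes "radially_small F" "radially_small G"
  shows "radially_small (\<lambda>z. F z - G z)"
  unfolding radially_small_def
proof (intro allI impI)
  fix a :: complex assume "norm a = 1"
  then have "(\<lambda>n. of_real (1 - radius_seq n) * F (of_real (radius_seq n) * a)
      - of_real (1 - radius_seq n) * G (of_real (radius_seq n) * a)) \<longlonglongrightarrow> 0 - 0"
    using assms by (intro tendsto_diff) (auto simp: radially_small_def)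
  then show "(\<lambda>n. of_real (1 - radius_seq n) * (F (of_real (radius_seq n) * a) - G (of_real (radius_seq n) * a))) \<longlonglongrightarrow> 0"
    by (simp add: right_diff_distrib)
qed

lemma radially_small_mult:
  assumes "radially_small F" "continuous_on (cball 0 1) \<phi>"
  shows "radially_small (\<lambda>z. \<phi> z * F z)"
  unfolding radially_small_def
proof (intro allI impI)
  fix a :: complex assume a: "norm a = 1"
  have "(\<lambda>n. \<phi> (of_real (radius_seq n) * a)) \<longlonglongrightarrow> \<phi> a"
    by (rule continuous_on_tendsto_compose[OF assms(2) radius_seq_mult_tendsto])
      (use a radius_seq_in_ball[OF a] in \<open>auto simp: less_imp_le\<close>)
  then have "(\<lambda>n. \<phi> (of_real (radius_seq n) * a) * (of_real (1 - radius_seq n) * F (of_real (radius_seq n) * a))) \<longlonglongrightarrow> \<phi> a * 0"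
    using assms(1) a by (intro tendsto_mult) (auto simp: radially_small_def)
  then show "(\<lambda>n. of_real (1 - radius_seq n) * (\<phi> (of_real (radius_seq n) * a) * F (of_real (radius_seq n) * a))) \<longlonglongrightarrow> 0"
    by (simp add: mult.left_commute)
qed

text \<open>The distance from \<open>\<zeta>\<close> to \<open>r * a\<close> is at least
  \<open>1 - r\<close>, so the Cauchy kernel times \<open>1 - r\<close> is bounded by 1; it tends to
  0 at every \<open>\<zeta> \<noteq> a\<close>. Dominated convergence with majorant
  \<open>norm (f \<zeta>)\<close> concludes.\<close>

lemma radially_small_riesz_projection:
  assumes "integrable circle_measure f"
  shows "radially_small (riesz_projection f)"
  unfolding radially_small_def
proof (intro allI impI)
  fix a :: complex assume a: "norm a = 1"
  define s where "s n \<zeta> = f \<zeta> * (of_real (1 - radius_seq n) * (\<zeta> / (\<zeta> - of_real (radius_seq n) * a)))" for n \<zeta>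
  have kernel: "norm (of_real (1 - radius_seq n) * (\<zeta> / (\<zeta> - of_real (radius_seq n) * a))) \<le> 1"
    if "norm \<zeta> = 1" for n \<zeta>
  proof -
    have "1 - radius_seq n \<le> norm (\<zeta> - of_real (radius_seq n) * a)"
      using norm_triangle_ineq2[of \<zeta> "of_real (radius_seq n) * a"] that a
      by (simp only: norm_mult norm_radius_seq mult_1_right)
    moreover have "\<bar>1 - radius_seq n\<bar> = 1 - radius_seq n"
      using radius_seq_bounds(2)[of n] by linarith
    ultimately have "norm (complex_of_real (1 - radius_seq n)) / norm (\<zeta> - of_real (radius_seq n) * a) \<le> 1"
      unfolding norm_of_real by (intro divide_le_eq_1[THEN iffD2]) (use radius_seq_bounds(2)[of n] in linarith)
    then show ?thesis
      unfolding norm_mult norm_divide that by simp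
  qed
  have "of_real (1 - radius_seq n) * riesz_projection f (of_real (radius_seq n) * a) =
      (LINT \<zeta>|circle_measure. s n \<zeta>)" for n
  proof -
    have "(LINT \<zeta>|circle_measure. s n \<zeta>) = (LINT \<zeta>|circle_measure. of_real (1 - radius_seq n) * (f \<zeta> * (\<zeta> / (\<zeta> - of_real (radius_seq n) * a))))"
      by (rule circle_integral_cong) (simp add: s_def)
    also have "\<dots> = of_real (1 - radius_seq n) * riesz_projection f (of_real (radius_seq n) * a)"
      using riesz_projection_cauchy[OF assms radius_seq_in_ball[OF a]] by (simp only: integral_mult_right_zero)
    finally show ?thesis ..
  qed
  moreover have "(\<lambda>n. LINT \<zeta>|circle_measure. s n \<zeta>) \<longlonglongrightarrow> (LINT \<zeta>|circle_measure. (0::complex))"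
  proof (rule integral_dominated_convergence[where w="\<lambda>\<zeta>. norm (f \<zeta>)"])
    show "s n \<in> borel_measurable circle_measure" for n
      unfolding s_def
    proof (rule borel_measurable_times[OF borel_measurable_integrable[OF assms] measurable_circle_continuous])
      have "\<zeta> - of_real (radius_seq n) * a \<noteq> 0" if "norm \<zeta> = 1" for \<zeta>
        using radius_seq_in_ball[OF a, of n] that by auto
      then show "continuous_on (sphere 0 1) (\<lambda>\<zeta>. of_real (1 - radius_seq n) * (\<zeta> / (\<zeta> - of_real (radius_seq n) * a)))"
        by (intro continuous_intros) auto
    qed
    show "AE \<zeta> in circle_measure. norm (s n \<zeta>) \<le> norm (f \<zeta>)" for n
    proof (rule AE_circleI)
      fix \<zeta> :: complex assume "norm \<zeta> = 1"
      from mult_left_mono[OF kernel[OF this, of n], of "norm (f \<zeta>)"]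
      show "norm (s n \<zeta>) \<le> norm (f \<zeta>)" unfolding s_def by (subst norm_mult) simp
    qed
    have "AE \<zeta> in circle_measure. \<zeta> \<notin> {a}" by (rule AE_circle_finite) simp
    then show "AE \<zeta> in circle_measure. (\<lambda>n. s n \<zeta>) \<longlonglongrightarrow> 0"
    proof eventually_elim
      case (elim \<zeta>)
      have "(\<lambda>n. s n \<zeta>) \<longlonglongrightarrow> f \<zeta> * (of_real (1 - 1) * (\<zeta> / (\<zeta> - a)))"
        unfolding s_def using elim by (intro tendsto_intros radius_seq_mult_tendsto radius_seq_tendsto) auto
      then show ?case by simp
    qed
  qed (use assms in auto)
  ultimately show "(\<lambda>n. of_real (1 - radius_seq n) * riesz_projection f (of_real (radius_seq n) * a)) \<longlonglongrightarrow> 0"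
    by simp
qed

text \<open>
  A root inside the disc is cancelled by continuity, a root on the circle by radial smallness.
\<close>

lemma poly_dvd_of_disc:
  assumes "m \<noteq> 0" and "\<And>a. poly m a = 0 \<Longrightarrow> norm a \<le> 1"
    and "continuous_on (ball 0 1) G" and "radially_small G"
    and "\<And>z. norm z < 1 \<Longrightarrow> poly u z = poly m z * G z"
  shows "m dvd u"
  using assms(1,2,5)
proof (induction "degree m" arbitrary: m u)
  case 0
  then show ?case by (simp add: is_unit_iff_degree unit_imp_dvd)
next
  case (Suc k)
  have "\<not> constant (poly m)" using Suc.hyps(2) by (simp add: constant_degree)
  then obtain a where a: "poly m a = 0" using Fundamental_Theorem_Algebra.fundamental_theorem_of_algebra[OF \<open>\<not> constant (poly m)\<close>] by auto
  then obtain m' where m': "m = [:- a, 1:] * m'" by (auto simp: poly_eq_0_iff_dvd)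
  have na: "norm a \<le> 1" using Suc.prems(2) a .
  have "poly u a = 0"
  proof (cases "norm a < 1")
    case True
    then show ?thesis using Suc.prems(3) a by simp
  next
    case False
    then have na1: "norm a = 1" using na by simp
    have "(\<lambda>n. poly u (of_real (radius_seq n) * a)) \<longlonglongrightarrow> poly u a"
      by (intro tendsto_intros radius_seq_mult_tendsto)
    \<comment> \<open>On the radius through \<open>a\<close> the factor \<open>z - a\<close> equals
      \<open>- a * (1 - r)\<close>, the weight that radial smallness absorbs.\<close>
    moreover have "poly u (of_real (radius_seq n) * a) =
        - a * poly m' (of_real (radius_seq n) * a) * (of_real (1 - radius_seq n) * G (of_real (radius_seq n) * a))" for n
      using Suc.prems(3)[OF radius_seq_in_ball[OF na1]] by (simp add: m' algebra_simps)
    moreover have "(\<lambda>n. - a * poly m' (of_real (radius_seq n) * a) * (of_real (1 - radius_seq n) * G (of_real (radius_seq n) * a)))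
        \<longlonglongrightarrow> - a * poly m' a * 0"
      using assms(4) na1 by (intro tendsto_intros radius_seq_mult_tendsto) (auto simp: radially_small_def)
    ultimately show ?thesis using LIMSEQ_unique by fastforce
  qed
  then obtain u' where u': "u = [:- a, 1:] * u'" by (auto simp: poly_eq_0_iff_dvd)
  have ne: "poly u' z = poly m' z * G z" if "norm z < 1" "z \<noteq> a" for z
  proof -
    have "(z - a) * poly u' z = (z - a) * (poly m' z * G z)"
      using Suc.prems(3)[OF that(1)] by (simp add: m' u' algebra_simps)
    then show ?thesis using that(2) mult_cancel_left[of "z - a"] by (simp del: mult_cancel_left)
  qed
  \<comment> \<open>Dividing by \<open>z - a\<close> loses the point \<open>a\<close>; if it lies in
    the disc, continuity of \<open>G\<close> restores it, so that the induction hypothesis applies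
    on the whole disc.\<close>
  have eq: "poly u' z = poly m' z * G z" if z: "norm z < 1" for z
  proof (cases "z = a")
    case True
    have "isCont G a"
      using assms(3) z True by (simp add: continuous_on_eq_continuous_at)
    then have 1: "((\<lambda>w. poly m' w * G w) \<longlongrightarrow> poly m' a * G a) (at a)"
      by (intro tendsto_intros) (simp add: isCont_def)
    have "eventually (\<lambda>w. poly m' w * G w = poly u' w) (at a)"
      unfolding eventually_at_topological
      by (rule exI[of _ "ball 0 1"]) (use ne z True in auto)
    from tendsto_cong[OF this] 1 have "(poly u' \<longlongrightarrow> poly m' a * G a) (at a)" by simp
    moreover have "(poly u' \<longlongrightarrow> poly u' a) (at a)"
      by (intro tendsto_intros)
    ultimately show ?thesis using True tendsto_unique[OF trivial_limit_at] by metis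
  qed (use ne z in auto)
  have "m' \<noteq> 0" using Suc.prems(1) m' by auto
  moreover have "degree m = degree m' + 1" using \<open>m' \<noteq> 0\<close> unfolding m' by (subst degree_mult_eq) auto
  ultimately have "m' dvd u'"
    using Suc.hyps Suc.prems(2) eq by (intro Suc.hyps(1)) (auto simp: m')
  then show ?case unfolding m' u' by (rule mult_dvd_mono[OF dvd_refl])
qed

section \<open>Hardy functions and their boundary values\<close>

text \<open>The \<open>integral_mean\<close> without its outer root: integral estimates apply to it
  directly, and the root is restored only on passing to \<open>Hp\<close> or
  \<open>Hp_norm\<close>.\<close>

definition circle_mean :: "real \<Rightarrow> (complex \<Rightarrow> complex) \<Rightarrow> real \<Rightarrow> real" where
  "circle_mean p F r = (LINT \<zeta>|circle_measure. norm (F (of_real r * \<zeta>)) powr p)"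

lemma circle_mean_nonneg: "0 \<le> circle_mean p F r"
  unfolding circle_mean_def by (rule integral_nonneg_AE) simp

lemma of_real_mult_in_ball:
  assumes "0 \<le> r" "r < 1" "norm \<zeta> = 1"
  shows "norm (complex_of_real r * \<zeta>) < 1"
  using assms by (simp add: norm_mult)

lemma continuous_on_dilate:
  assumes "continuous_on (ball 0 1) F" "0 \<le> r" "r < 1"
  shows "continuous_on (sphere 0 1) (\<lambda>\<zeta>. F (complex_of_real r * \<zeta>))"
  by (rule continuous_on_compose2[OF assms(1)])
    (use of_real_mult_in_ball[OF assms(2,3)] in \<open>auto intro!: continuous_intros\<close>)

lemma continuous_on_norm_powr:
  fixes F :: "complex \<Rightarrow> complex"
  assumes "continuous_on S F" "0 < p"
  shows "continuous_on S (\<lambda>z. norm (F z) powr p)"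
  by (rule continuous_on_powr') (use assms in \<open>auto intro!: continuous_intros\<close>)

lemma integrable_circle_mean:
  fixes F :: "complex \<Rightarrow> complex"
  assumes "continuous_on (ball 0 1) F" "0 \<le> r" "r < 1" "0 < p"
  shows "integrable circle_measure (\<lambda>\<zeta>. norm (F (complex_of_real r * \<zeta>)) powr p)"
  by (rule integrable_circle_continuous[OF continuous_on_norm_powr[OF continuous_on_dilate[OF assms(1-3)] assms(4)]])

lemma circle_mean_le_bound:
  assumes "continuous_on (ball 0 1) F" "0 \<le> r" "r < 1" "0 < p"
    and "\<And>z. norm z < 1 \<Longrightarrow> norm (F z) \<le> b"
  shows "circle_mean p F r \<le> b powr p"
proof -
  have "circle_mean p F r \<le> (LINT \<zeta>|circle_measure. b powr p)"
    unfolding circle_mean_def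
  proof (rule integral_mono_AE[OF integrable_circle_mean[OF assms(1-4)]])
    show "AE \<zeta> in circle_measure. norm (F (complex_of_real r * \<zeta>)) powr p \<le> b powr p"
      by (rule AE_circleI) (use assms in \<open>auto intro!: powr_mono2 simp: of_real_mult_in_ball\<close>)
  qed simp
  then show ?thesis by (simp add: circle.prob_space[simplified])
qed

text \<open>The sum has at most twice the larger modulus. The resulting quasi-triangle inequality is
  the source of every factor \<open>2 powr p\<close> below.\<close>

lemma norm_add_powr_le:
  fixes a b :: complex
  assumes "0 < p"
  shows "norm (a + b) powr p \<le> 2 powr p * (norm a powr p + norm b powr p)"
proof -
  have "norm (a + b) powr p \<le> (2 * max (norm a) (norm b)) powr p"
    using norm_triangle_ineq[of a b] assms by (intro powr_mono2) auto
  also have "\<dots> = 2 powr p * max (norm a) (norm b) powr p"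
    by (simp add: powr_mult)
  also have "\<dots> \<le> 2 powr p * (norm a powr p + norm b powr p)"
    by (intro mult_left_mono) (auto simp: max_def)
  finally show ?thesis .
qed

lemma circle_mean_add_le:
  assumes "continuous_on (ball 0 1) F" "continuous_on (ball 0 1) G" "0 \<le> r" "r < 1" "0 < p"
  shows "circle_mean p (\<lambda>z. F z + G z) r \<le> 2 powr p * (circle_mean p F r + circle_mean p G r)"
proof -
  note int = integrable_circle_mean[OF assms(1,3,4,5)] integrable_circle_mean[OF assms(2,3,4,5)]
  have "circle_mean p (\<lambda>z. F z + G z) r \<le> (LINT \<zeta>|circle_measure.
      2 powr p * (norm (F (of_real r * \<zeta>)) powr p + norm (G (of_real r * \<zeta>)) powr p))"
    unfolding circle_mean_def
  proof (rule integral_mono_AE)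
    show "integrable circle_measure (\<lambda>\<zeta>. norm (F (of_real r * \<zeta>) + G (of_real r * \<zeta>)) powr p)"
      by (rule integrable_circle_mean[where F="\<lambda>z. F z + G z"]) (intro continuous_intros assms)+
    show "AE \<zeta> in circle_measure. norm (F (of_real r * \<zeta>) + G (of_real r * \<zeta>)) powr p \<le>
        2 powr p * (norm (F (of_real r * \<zeta>)) powr p + norm (G (of_real r * \<zeta>)) powr p)"
      by (rule AE_circleI) (rule norm_add_powr_le[OF assms(5)])
  qed (intro integrable_mult_right Bochner_Integration.integrable_add int)
  also have "\<dots> = 2 powr p * (circle_mean p F r + circle_mean p G r)"
    using int by (simp add: circle_mean_def Bochner_Integration.integral_add)
  finally show ?thesis .
qed

lemma circle_mean_diff_le:
  assumes "continuous_on (ball 0 1) F" "continuous_on (ball 0 1) G" "0 \<le> r" "r < 1" "0 < p"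
  shows "circle_mean p (\<lambda>z. F z - G z) r \<le> 2 powr p * (circle_mean p F r + circle_mean p G r)"
  using circle_mean_add_le[OF assms(1) continuous_on_minus[OF assms(2)] assms(3-5)]
  by (simp add: circle_mean_def)

lemma circle_mean_mult_le:
  assumes "continuous_on (ball 0 1) F" "continuous_on (ball 0 1) \<phi>" "0 \<le> r" "r < 1" "0 < p"
    and "\<And>z. norm z < 1 \<Longrightarrow> norm (\<phi> z) \<le> b"
  shows "circle_mean p (\<lambda>z. \<phi> z * F z) r \<le> b powr p * circle_mean p F r"
proof -
  have "circle_mean p (\<lambda>z. \<phi> z * F z) r \<le> (LINT \<zeta>|circle_measure. b powr p * norm (F (of_real r * \<zeta>)) powr p)"
    unfolding circle_mean_def
  proof (rule integral_mono_AE)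
    show "integrable circle_measure (\<lambda>\<zeta>. norm (\<phi> (of_real r * \<zeta>) * F (of_real r * \<zeta>)) powr p)"
      by (rule integrable_circle_mean[where F="\<lambda>z. \<phi> z * F z"]) (intro continuous_intros assms)+
    show "integrable circle_measure (\<lambda>\<zeta>. b powr p * norm (F (of_real r * \<zeta>)) powr p)"
      by (intro integrable_mult_right integrable_circle_mean assms)
    show "AE \<zeta> in circle_measure. norm (\<phi> (of_real r * \<zeta>) * F (of_real r * \<zeta>)) powr p \<le>
        b powr p * norm (F (of_real r * \<zeta>)) powr p"
    proof (rule AE_circleI)
      fix \<zeta> :: complex assume "norm \<zeta> = 1"
      then have "norm (\<phi> (of_real r * \<zeta>)) \<le> b"
        by (intro assms of_real_mult_in_ball)
      then have "norm (\<phi> (of_real r * \<zeta>)) powr p \<le> b powr p"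
        using assms(5) by (intro powr_mono2) auto
      then show "norm (\<phi> (of_real r * \<zeta>) * F (of_real r * \<zeta>)) powr p \<le> b powr p * norm (F (of_real r * \<zeta>)) powr p"
        by (simp add: norm_mult powr_mult mult_right_mono)
    qed
  qed
  then show ?thesis by (simp add: circle_mean_def)
qed

lemma HpD:
  assumes "g \<in> Hp p"
  shows "g holomorphic_on ball 0 1" "continuous_on (ball 0 1) g" "norm z \<ge> 1 \<Longrightarrow> g z = 0"
  using assms by (auto simp: Hp_def intro: holomorphic_on_imp_continuous_on)

lemma HpI:
  assumes "0 < p" "g holomorphic_on ball 0 1" "\<And>z. norm z \<ge> 1 \<Longrightarrow> g z = 0"
    and "\<And>r. 0 \<le> r \<Longrightarrow> r < 1 \<Longrightarrow> circle_mean p g r \<le> C"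
  shows "g \<in> Hp p"
proof -
  have "integral_mean p g r \<le> C powr (1 / p)" if "r \<in> {0..<1}" for r
    unfolding integral_mean_def circle_mean_def[symmetric]
    by (rule powr_mono2) (use assms(1,4) that circle_mean_nonneg in auto)
  then show ?thesis
    unfolding Hp_def using assms(2,3) by (auto intro!: bdd_aboveI2[where M="C powr (1 / p)"])
qed

lemma circle_mean_eq_powr: "0 < p \<Longrightarrow> circle_mean p g r = integral_mean p g r powr p"
  unfolding integral_mean_def circle_mean_def[symmetric]
  by (simp add: powr_powr circle_mean_nonneg)

lemma circle_mean_le_Hp_norm:
  assumes "g \<in> Hp p" "0 < p" "0 \<le> r" "r < 1"
  shows "circle_mean p g r \<le> Hp_norm p g powr p"
proof -
  have "integral_mean p g r \<le> Hp_norm p g"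
    unfolding Hp_norm_def using assms by (intro cSUP_upper) (auto simp: Hp_def)
  then have "integral_mean p g r powr p \<le> Hp_norm p g powr p"
    using assms(2) by (intro powr_mono2) (auto simp: integral_mean_def)
  then show ?thesis using assms(2) by (simp add: circle_mean_eq_powr)
qed

lemma Hp_norm_le:
  assumes "0 < p" and "\<And>r. 0 \<le> r \<Longrightarrow> r < 1 \<Longrightarrow> circle_mean p g r \<le> C"
  shows "Hp_norm p g \<le> C powr (1 / p)"
  unfolding Hp_norm_def
proof (rule cSUP_least)
  show "integral_mean p g r \<le> C powr (1 / p)" if "r \<in> {0..<1}" for r
    unfolding integral_mean_def circle_mean_def[symmetric]
    by (rule powr_mono2) (use assms that circle_mean_nonneg in auto)
qed simp

text \<open>The supremum of the means yields a weak inequality only; the half makes it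
  strict.\<close>

lemma Hp_norm_lessI:
  assumes "0 < p" "0 < \<epsilon>" and "\<And>r. 0 \<le> r \<Longrightarrow> r < 1 \<Longrightarrow> circle_mean p g r \<le> (\<epsilon> / 2) powr p"
  shows "Hp_norm p g < \<epsilon>"
proof -
  have "Hp_norm p g \<le> ((\<epsilon> / 2) powr p) powr (1 / p)"
    by (rule Hp_norm_le) (use assms in auto)
  also have "\<dots> = \<epsilon> / 2" using assms by (simp add: powr_powr)
  finally show ?thesis using assms(2) by simp
qed

lemma Hp_diff:
  assumes "f \<in> Hp p" "g \<in> Hp p" "0 < p"
  shows "(\<lambda>z. f z - g z) \<in> Hp p"
proof (rule HpI[OF assms(3)])
  show "(\<lambda>z. f z - g z) holomorphic_on ball 0 1"
    using assms by (intro holomorphic_intros HpD)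
  show "f z - g z = 0" if "norm z \<ge> 1" for z
    using HpD(3)[OF assms(1) that] HpD(3)[OF assms(2) that] by simp
  show "circle_mean p (\<lambda>z. f z - g z) r \<le> 2 powr p * (Hp_norm p f powr p + Hp_norm p g powr p)"
    if "0 \<le> r" "r < 1" for r
    by (rule order_trans[OF circle_mean_diff_le])
      (use assms that in \<open>auto intro!: mult_left_mono add_mono circle_mean_le_Hp_norm dest: HpD(2)\<close>)
qed

lemma Hp_mult:
  assumes "g \<in> Hp p" "0 < p" "\<phi> holomorphic_on ball 0 1" "\<And>z. norm z < 1 \<Longrightarrow> norm (\<phi> z) \<le> b"
  shows "(\<lambda>z. \<phi> z * g z) \<in> Hp p"
proof (rule HpI[OF assms(2)])
  show "(\<lambda>z. \<phi> z * g z) holomorphic_on ball 0 1"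
    by (intro holomorphic_on_mult assms(3) HpD(1)[OF assms(1)])
  show "\<phi> z * g z = 0" if "norm z \<ge> 1" for z
    using HpD(3)[OF assms(1) that] by simp
  show "circle_mean p (\<lambda>z. \<phi> z * g z) r \<le> b powr p * Hp_norm p g powr p"
    if "0 \<le> r" "r < 1" for r
    by (rule order_trans[OF circle_mean_mult_le[OF HpD(2)[OF assms(1)] _ that assms(2,4)]])
      (use assms that in \<open>auto intro!: mult_left_mono circle_mean_le_Hp_norm holomorphic_on_imp_continuous_on\<close>)
qed

text \<open>Elements of \<open>Hp p\<close> vanish off the open disc, so a formula valid on the
  plane has to be cut off before it can be one of them.\<close>

definition restrict_disc :: "(complex \<Rightarrow> complex) \<Rightarrow> complex \<Rightarrow> complex" where
  "restrict_disc F z = (if norm z < 1 then F z else 0)"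

lemma restrict_disc_Hp:
  assumes "0 < p" "F holomorphic_on ball 0 1" "\<And>z. norm z < 1 \<Longrightarrow> norm (F z) \<le> b"
  shows "restrict_disc F \<in> Hp p"
proof -
  have hol: "restrict_disc F holomorphic_on ball 0 1"
    by (rule holomorphic_transform[OF assms(2)]) (simp add: restrict_disc_def)
  show ?thesis
  proof (rule HpI[OF assms(1) hol])
    show "circle_mean p (restrict_disc F) r \<le> b powr p" if "0 \<le> r" "r < 1" for r
      by (rule circle_mean_le_bound[OF holomorphic_on_imp_continuous_on[OF hol] that assms(1)])
        (use assms(3) in \<open>simp add: restrict_disc_def\<close>)
  qed (simp add: restrict_disc_def)
qed

section \<open>Boundary values through truncation and mean convergence\<close>

lemma truncation_bound:
  fixes x p M :: real
  assumes "0 \<le> x" "0 < M" "1 \<le> p"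
  shows "x \<le> min x M + M powr (1 - p) * x powr p"
proof (cases "x \<le> M")
  case False
  \<comment> \<open>The exponent \<open>1 - p\<close> is not positive, so replacing \<open>M\<close>
    by the larger \<open>x\<close> cannot increase the power.\<close>
  then have "M powr (1 - p) * x powr p \<ge> x powr (1 - p) * x powr p"
    using assms by (intro mult_right_mono powr_mono2') auto
  moreover have "x powr (1 - p) * x powr p = x"
    using False assms by (simp flip: powr_add)
  ultimately show ?thesis using assms by simp
qed (use assms in simp)

text \<open>Truncation at level \<epsilon>: the capped part contributes at most \<epsilon>, the tail
  at most \<open>\<epsilon> powr (1 - p) * \<epsilon> powr p = \<epsilon>\<close>.\<close>

lemma circle_mean_1_le:
  assumes "continuous_on (ball 0 1) F" "0 \<le> r" "r < 1" "1 \<le> p" "0 < \<epsilon>" "circle_mean p F r \<le> \<epsilon> powr p"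
  shows "(LINT \<zeta>|circle_measure. norm (F (of_real r * \<zeta>))) \<le> 2 * \<epsilon>"
proof -
  have ip: "integrable circle_measure (\<lambda>\<zeta>. norm (F (of_real r * \<zeta>)) powr p)"
    using assms by (intro integrable_circle_mean) auto
  have i1: "integrable circle_measure (\<lambda>\<zeta>. norm (F (of_real r * \<zeta>)))"
    by (intro integrable_norm integrable_circle_continuous continuous_on_dilate assms)
  have "(LINT \<zeta>|circle_measure. norm (F (of_real r * \<zeta>))) \<le>
      (LINT \<zeta>|circle_measure. \<epsilon> + \<epsilon> powr (1 - p) * norm (F (of_real r * \<zeta>)) powr p)"
  proof (rule integral_mono[OF i1])
    show "integrable circle_measure (\<lambda>\<zeta>. \<epsilon> + \<epsilon> powr (1 - p) * norm (F (of_real r * \<zeta>)) powr p)"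
      by (intro Bochner_Integration.integrable_add integrable_mult_right ip) simp
    show "norm (F (of_real r * \<zeta>)) \<le> \<epsilon> + \<epsilon> powr (1 - p) * norm (F (of_real r * \<zeta>)) powr p" for \<zeta>
      using truncation_bound[of "norm (F (of_real r * \<zeta>))" \<epsilon> p] assms(4,5) by simp
  qed
  also have "\<dots> = \<epsilon> + \<epsilon> powr (1 - p) * circle_mean p F r"
    using ip by (simp add: circle_mean_def Bochner_Integration.integral_add circle.prob_space[simplified])
  also have "\<dots> \<le> \<epsilon> + \<epsilon> powr (1 - p) * \<epsilon> powr p"
    by (intro add_left_mono mult_left_mono assms(6)) simp
  also have "\<dots> = 2 * \<epsilon>" using assms(5) by (simp flip: powr_add)
  finally show ?thesis .
qed

text \<open>At radius \<open>r\<close> the Taylor series converges absolutely, because it still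
  converges at the larger radius \<open>s\<close>. The vanishing at index -1 is used in the proof
  that the range is not dense.\<close>

lemma fourier_coeff_dilate:
  assumes "F holomorphic_on ball 0 1" "0 \<le> r" "r < 1"
  shows "fourier_coeff (\<lambda>\<zeta>. F (of_real r * \<zeta>)) k =
    (if k \<ge> 0 then (deriv ^^ nat k) F 0 / fact (nat k) * of_real r ^ nat k else 0)"
proof -
  define a where "a j = (deriv ^^ j) F 0 / fact j" for j
  have sums: "(\<lambda>j. a j * z ^ j) sums F z" if "norm z < 1" for z
    using holomorphic_power_series[OF assms(1), of z] that by (simp add: a_def)
  define s where "s = (1 + r) / 2"
  have s: "r < s" "s < 1" using assms(3) by (auto simp: s_def)
  have "summable (\<lambda>j. a j * complex_of_real s ^ j)"
    using sums[of "of_real s"] s assms(2) by (simp add: sums_iff)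
  then have "summable (\<lambda>j. norm (a j * complex_of_real r ^ j))"
    by (rule powser_insidea) (use s assms(2) in simp)
  from fourier_coeff_power_series[OF this, of k]
  have "fourier_coeff (\<lambda>\<zeta>. \<Sum>j. a j * of_real r ^ j * \<zeta> ^ j) k = (if k \<ge> 0 then a (nat k) * of_real r ^ nat k else 0)" .
  moreover have "fourier_coeff (\<lambda>\<zeta>. F (of_real r * \<zeta>)) k = fourier_coeff (\<lambda>\<zeta>. \<Sum>j. a j * of_real r ^ j * \<zeta> ^ j) k"
  proof (rule fourier_coeff_cong)
    fix \<zeta> :: complex assume "norm \<zeta> = 1"
    from sums_unique[OF sums[OF of_real_mult_in_ball[OF assms(2,3) this]]]
    show "F (of_real r * \<zeta>) = (\<Sum>j. a j * of_real r ^ j * \<zeta> ^ j)"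
      by (simp add: power_mult_distrib mult.assoc)
  qed
  ultimately show ?thesis by (simp add: a_def)
qed

text \<open>
  Boundedness in \<open>L\<^sup>p\<close> with \<open>p > 1\<close> upgrades the pointwise convergence of the dilates
  to convergence in \<open>L\<^sup>1\<close>.
\<close>

lemma Hp_boundary:
  assumes "1 < p" "g \<in> Hp p" "B \<in> borel_measurable circle_measure"
    and lim: "AE \<zeta> in circle_measure. (\<lambda>n. g (of_real (radius_seq n) * \<zeta>)) \<longlonglongrightarrow> B \<zeta>"
  shows "integrable circle_measure B" and "norm z < 1 \<Longrightarrow> riesz_projection B z = g z"
proof -
  define gn where "gn n \<zeta> = g (of_real (radius_seq n) * \<zeta>)" for n \<zeta>
  define C where "C = Hp_norm p g powr p"
  have p: "0 < p" using assms(1) by simp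
  have cont: "continuous_on (sphere 0 1) (gn n)" for n
    unfolding gn_def using HpD(2)[OF assms(2)] radius_seq_bounds[of n] by (intro continuous_on_dilate) auto
  have gn_meas: "gn n \<in> borel_measurable circle_measure" for n
    by (rule measurable_circle_continuous[OF cont])
  have gn_int: "integrable circle_measure (\<lambda>\<zeta>. norm (gn n \<zeta>) powr p)" for n
    by (intro integrable_circle_continuous continuous_on_norm_powr cont p)
  have gn_le: "(LINT \<zeta>|circle_measure. norm (gn n \<zeta>) powr p) \<le> C" for n
    using circle_mean_le_Hp_norm[OF assms(2) p, of "radius_seq n"] radius_seq_bounds[of n]
    by (simp add: circle_mean_def gn_def C_def)
  \<comment> \<open>Fatou's lemma: the means along the radii stay below \<open>C\<close>, and the
    limit function inherits the bound.\<close>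
  have Bp_int: "integrable circle_measure (\<lambda>\<zeta>. norm (B \<zeta>) powr p)"
  proof (rule integrableI_bounded)
    show "(\<lambda>\<zeta>. norm (B \<zeta>) powr p) \<in> borel_measurable circle_measure"
      using assms(3) by measurable
    have "(\<integral>\<^sup>+ \<zeta>. ennreal (norm (norm (B \<zeta>) powr p)) \<partial>circle_measure) =
        (\<integral>\<^sup>+ \<zeta>. liminf (\<lambda>n. ennreal (norm (gn n \<zeta>) powr p)) \<partial>circle_measure)"
    proof (rule nn_integral_cong_AE)
      show "AE \<zeta> in circle_measure. ennreal (norm (norm (B \<zeta>) powr p)) = liminf (\<lambda>n. ennreal (norm (gn n \<zeta>) powr p))"
        using lim
      proof eventually_elim
        case (elim \<zeta>)
        have "(\<lambda>n. norm (gn n \<zeta>) powr p) \<longlonglongrightarrow> norm (B \<zeta>) powr p"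
          by (rule tendsto_powr'[OF tendsto_norm[OF elim[folded gn_def]] tendsto_const]) (use p in auto)
        then have "(\<lambda>n. ennreal (norm (gn n \<zeta>) powr p)) \<longlonglongrightarrow> ennreal (norm (B \<zeta>) powr p)"
          by (rule tendsto_ennrealI)
        from lim_imp_Liminf[OF trivial_limit_sequentially this] show ?case by simp
      qed
    qed
    also have "\<dots> \<le> liminf (\<lambda>n. \<integral>\<^sup>+ \<zeta>. ennreal (norm (gn n \<zeta>) powr p) \<partial>circle_measure)"
      by (rule nn_integral_liminf) (use gn_meas in measurable)
    also have "\<dots> \<le> limsup (\<lambda>n. \<integral>\<^sup>+ \<zeta>. ennreal (norm (gn n \<zeta>) powr p) \<partial>circle_measure)"
      by (rule Liminf_le_Limsup) simp
    also have "\<dots> \<le> ennreal C"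
    proof (rule Limsup_bounded, rule always_eventually, rule allI)
      fix n
      have "(\<integral>\<^sup>+ \<zeta>. ennreal (norm (gn n \<zeta>) powr p) \<partial>circle_measure) = ennreal (LINT \<zeta>|circle_measure. norm (gn n \<zeta>) powr p)"
        by (rule nn_integral_eq_integral[OF gn_int]) simp
      also have "\<dots> \<le> ennreal C" using gn_le by (rule ennreal_leI)
      finally show "(\<integral>\<^sup>+ \<zeta>. ennreal (norm (gn n \<zeta>) powr p) \<partial>circle_measure) \<le> ennreal C" .
    qed
    finally show "(\<integral>\<^sup>+ \<zeta>. ennreal (norm (norm (B \<zeta>) powr p)) \<partial>circle_measure) < \<infinity>"
      using ennreal_less_top le_less_trans infinity_ennreal_def by metis
  qed
  show B_int: "integrable circle_measure B"
  proof (rule Bochner_Integration.integrable_bound[OF _ assms(3)])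
    show "integrable circle_measure (\<lambda>\<zeta>. 1 + norm (B \<zeta>) powr p)"
      using Bp_int by (intro Bochner_Integration.integrable_add) auto
    show "AE \<zeta> in circle_measure. norm (B \<zeta>) \<le> norm (1 + norm (B \<zeta>) powr p)"
    proof (rule AE_circleI)
      fix \<zeta>
      have "norm (B \<zeta>) \<le> 1 + norm (B \<zeta>) powr p"
        using truncation_bound[of "norm (B \<zeta>)" 1 p] assms(1) by simp
      then show "norm (B \<zeta>) \<le> norm (1 + norm (B \<zeta>) powr p)" by simp
    qed
  qed
  define w where "w n \<zeta> = norm (gn n \<zeta> - B \<zeta>)" for n \<zeta>
  have w_meas: "w n \<in> borel_measurable circle_measure" for n
    unfolding w_def using gn_meas assms(3) by measurable
  have gn_int1: "integrable circle_measure (gn n)" for n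
    by (rule integrable_circle_continuous[OF cont])
  have w_int: "integrable circle_measure (w n)" for n
    unfolding w_def using gn_int1 B_int by (intro integrable_norm Bochner_Integration.integrable_diff)
  define K where "K = 2 powr p * (C + (LINT \<zeta>|circle_measure. norm (B \<zeta>) powr p))"
  have w_powr: "w n \<zeta> powr p \<le> 2 powr p * (norm (gn n \<zeta>) powr p + norm (B \<zeta>) powr p)" for n \<zeta>
    using norm_add_powr_le[OF p, of "gn n \<zeta>" "- B \<zeta>"] by (simp add: w_def)
  have dom_int: "integrable circle_measure (\<lambda>\<zeta>. 2 powr p * (norm (gn n \<zeta>) powr p + norm (B \<zeta>) powr p))" for n
    by (intro integrable_mult_right Bochner_Integration.integrable_add gn_int Bp_int)
  have wp_int: "integrable circle_measure (\<lambda>\<zeta>. w n \<zeta> powr p)" for n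
    by (rule Bochner_Integration.integrable_bound[OF dom_int[of n]])
      (use w_meas[of n] w_powr in \<open>auto intro!: AE_circleI\<close>)
  have wp_le: "(LINT \<zeta>|circle_measure. w n \<zeta> powr p) \<le> K" for n
  proof -
    have "(LINT \<zeta>|circle_measure. w n \<zeta> powr p) \<le> (LINT \<zeta>|circle_measure. 2 powr p * (norm (gn n \<zeta>) powr p + norm (B \<zeta>) powr p))"
      by (rule integral_mono[OF wp_int dom_int w_powr])
    also have "\<dots> \<le> K"
      unfolding K_def using gn_int Bp_int gn_le[of n] by (simp add: Bochner_Integration.integral_add)
    finally show ?thesis .
  qed
  have L1: "(\<lambda>n. LINT \<zeta>|circle_measure. w n \<zeta>) \<longlonglongrightarrow> 0"
  proof (rule LIMSEQ_I)
    fix \<epsilon> :: real assume \<epsilon>: "0 < \<epsilon>"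
    \<comment> \<open>The level \<open>M\<close> is chosen before \<open>n\<close>: the uniform
      bound \<open>K\<close> makes the tail small for all \<open>n\<close> at once, and dominated
      convergence handles the capped part.\<close>
    have "((\<lambda>M. M powr (1 - p) * K) \<longlongrightarrow> 0 * K) at_top"
      using assms(1) by (intro tendsto_mult tendsto_const tendsto_neg_powr filterlim_ident) auto
    then have "eventually (\<lambda>M. M powr (1 - p) * K < \<epsilon> / 2) at_top"
      using \<epsilon> by (intro order_tendstoD(2)) auto
    moreover have "eventually (\<lambda>M::real. 0 < M) at_top" by (rule eventually_gt_at_top)
    ultimately have "eventually (\<lambda>M. M powr (1 - p) * K < \<epsilon> / 2 \<and> 0 < M) at_top"
      by (rule eventually_conj)
    then obtain M where M: "M powr (1 - p) * K < \<epsilon> / 2" "0 < M"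
      using eventually_happens trivial_limit_at_top_linorder by blast
    have min_int: "integrable circle_measure (\<lambda>\<zeta>. min (w n \<zeta>) M)" for n
    proof (rule integrable_circle_bounded[where B=M])
      show "(\<lambda>\<zeta>. min (w n \<zeta>) M) \<in> borel_measurable circle_measure"
        using w_meas[of n] by measurable
    qed (use M(2) in \<open>auto simp: w_def\<close>)
    have "(\<lambda>n. LINT \<zeta>|circle_measure. min (w n \<zeta>) M) \<longlonglongrightarrow> (LINT \<zeta>|circle_measure. (0::real))"
    proof (rule integral_dominated_convergence[where w="\<lambda>_. M"])
      show "AE \<zeta> in circle_measure. (\<lambda>n. min (w n \<zeta>) M) \<longlonglongrightarrow> 0"
        using lim
      proof eventually_elim
        case (elim \<zeta>)
        have "(\<lambda>n. w n \<zeta>) \<longlonglongrightarrow> 0"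
          unfolding w_def using tendsto_norm[OF tendsto_diff[OF elim[folded gn_def] tendsto_const[of "B \<zeta>"]]] by simp
        from tendsto_min[OF this tendsto_const[of M]] show ?case using M(2) by simp
      qed
      show "AE \<zeta> in circle_measure. norm (min (w n \<zeta>) M) \<le> M" for n
        using M(2) by (auto simp: w_def)
    qed (use min_int in auto)
    then obtain N where N: "\<And>n. n \<ge> N \<Longrightarrow> norm (LINT \<zeta>|circle_measure. min (w n \<zeta>) M) < \<epsilon> / 2"
      using LIMSEQ_D[of _ 0 "\<epsilon> / 2"] \<epsilon> by (auto simp del: real_norm_def)
    have "norm ((LINT \<zeta>|circle_measure. w n \<zeta>) - 0) < \<epsilon>" if n: "n \<ge> N" for n
    proof -
      have "(LINT \<zeta>|circle_measure. w n \<zeta>) \<le> (LINT \<zeta>|circle_measure. min (w n \<zeta>) M + M powr (1 - p) * w n \<zeta> powr p)"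
      proof (rule integral_mono[OF w_int])
        show "integrable circle_measure (\<lambda>\<zeta>. min (w n \<zeta>) M + M powr (1 - p) * w n \<zeta> powr p)"
          by (intro Bochner_Integration.integrable_add min_int integrable_mult_right wp_int)
        show "w n \<zeta> \<le> min (w n \<zeta>) M + M powr (1 - p) * w n \<zeta> powr p" for \<zeta>
          by (rule truncation_bound) (use M(2) assms(1) in \<open>auto simp: w_def\<close>)
      qed
      also have "\<dots> = (LINT \<zeta>|circle_measure. min (w n \<zeta>) M) + M powr (1 - p) * (LINT \<zeta>|circle_measure. w n \<zeta> powr p)"
        using min_int wp_int by (simp add: Bochner_Integration.integral_add)
      also have "\<dots> \<le> (LINT \<zeta>|circle_measure. min (w n \<zeta>) M) + M powr (1 - p) * K"
        by (intro add_left_mono mult_left_mono wp_le) simp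
      also have "\<dots> < \<epsilon>" using N[OF n] M(1) by simp
      finally have "(LINT \<zeta>|circle_measure. w n \<zeta>) < \<epsilon>" .
      moreover have "0 \<le> (LINT \<zeta>|circle_measure. w n \<zeta>)"
        by (rule integral_nonneg_AE) (simp add: w_def)
      ultimately show ?thesis by simp
    qed
    then show "\<exists>N. \<forall>n\<ge>N. norm ((LINT \<zeta>|circle_measure. w n \<zeta>) - 0) < \<epsilon>" by blast
  qed
  define a where "a k = (deriv ^^ k) g 0 / fact k" for k
  have sums: "(\<lambda>k. a k * z ^ k) sums g z" if "norm z < 1" for z
    using holomorphic_power_series[OF HpD(1)[OF assms(2)], of z] that by (simp add: a_def)
  have coeff_gn: "fourier_coeff (gn n) (int k) = a k * of_real (radius_seq n) ^ k" for n k
    using fourier_coeff_dilate[OF HpD(1)[OF assms(2)], of "radius_seq n" "int k"] radius_seq_bounds[of n]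
    by (simp add: gn_def[abs_def] a_def)
  \<comment> \<open>Fourier coefficients are continuous for the distance in mean, so those of
    \<open>B\<close> are the limits of \<open>a k * r ^ k\<close>.\<close>
  have coeff_B: "fourier_coeff B (int k) = a k" for k
  proof -
    have "(\<lambda>n. fourier_coeff (gn n) (int k) - fourier_coeff B (int k)) \<longlonglongrightarrow> 0"
    proof (rule Lim_null_comparison[OF _ L1], rule always_eventually, rule allI)
      fix n
      show "norm (fourier_coeff (gn n) (int k) - fourier_coeff B (int k)) \<le> (LINT \<zeta>|circle_measure. w n \<zeta>)"
        using norm_fourier_coeff_le[OF Bochner_Integration.integrable_diff[OF gn_int1[of n] B_int]]
        by (simp add: fourier_coeff_diff[OF gn_int1 B_int] w_def)
    qed
    then have "(\<lambda>n. fourier_coeff (gn n) (int k)) \<longlonglongrightarrow> fourier_coeff B (int k)"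
      by (simp add: LIM_zero_iff)
    moreover have "(\<lambda>n. fourier_coeff (gn n) (int k)) \<longlonglongrightarrow> a k * of_real 1 ^ k"
      unfolding coeff_gn by (intro tendsto_intros radius_seq_tendsto)
    ultimately show ?thesis using LIMSEQ_unique by fastforce
  qed
  show "riesz_projection B z = g z" if "norm z < 1"
    using riesz_projection_sums[OF B_int that] sums[OF that] by (simp add: coeff_B sums_unique2)
qed

lemma boundary_function_radius_seq:
  assumes "boundary_function g b"
  shows "AE \<zeta> in circle_measure. (\<lambda>n. g (of_real (radius_seq n) * \<zeta>)) \<longlonglongrightarrow> b \<zeta>"
  using assms unfolding boundary_function_def
  by eventually_elim (rule filterlim_compose[OF _ radius_seq_filterlim])

text \<open>The boundary function \<open>b\<close> is determined only almost everywhere and need not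
  be measurable. Its replacement \<open>B\<close> is \<open>lim\<close> along
  \<open>radius_seq\<close>, which is measurable.\<close>

lemma Hp_boundary_exists:
  assumes "1 < p" "g \<in> Hp p" "boundary_function g b"
  obtains B where "integrable circle_measure B" "AE \<zeta> in circle_measure. B \<zeta> = b \<zeta>"
    "\<And>z. norm z < 1 \<Longrightarrow> riesz_projection B z = g z"
proof -
  define B where "B \<zeta> = lim (\<lambda>n. g (of_real (radius_seq n) * \<zeta>))" for \<zeta>
  have "(\<lambda>\<zeta>. g (of_real (radius_seq n) * \<zeta>)) \<in> borel_measurable circle_measure" for n
    using HpD(2)[OF assms(2)] radius_seq_bounds[of n]
    by (intro measurable_circle_continuous continuous_on_dilate) auto
  then have meas: "B \<in> borel_measurable circle_measure"
    unfolding B_def by (rule borel_measurable_lim_metric)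
  have lim: "AE \<zeta> in circle_measure. (\<lambda>n. g (of_real (radius_seq n) * \<zeta>)) \<longlonglongrightarrow> b \<zeta>"
    by (rule boundary_function_radius_seq[OF assms(3)])
  then have eq: "AE \<zeta> in circle_measure. B \<zeta> = b \<zeta>"
    unfolding B_def by eventually_elim (rule limI)
  from lim eq have "AE \<zeta> in circle_measure. (\<lambda>n. g (of_real (radius_seq n) * \<zeta>)) \<longlonglongrightarrow> B \<zeta>"
    by eventually_elim simp
  from Hp_boundary[OF assms(1,2) meas this] show thesis
    using eq that by blast
qed

section \<open>Polynomials and strictly proper fractions\<close>

definition root_part :: "complex poly \<Rightarrow> complex set \<Rightarrow> complex poly" where
  "root_part q S = (\<Prod>a\<in>{a\<in>S. poly q a = 0}. [:- a, 1:] ^ order a q)"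

lemma finite_roots_in:
  fixes q :: "complex poly"
  shows "q \<noteq> 0 \<Longrightarrow> finite {a\<in>S. poly q a = 0}"
  using poly_roots_finite[of q] by (rule rev_finite_subset) auto

lemma monic_root_part: "lead_coeff (root_part q S) = 1"
  by (simp add: root_part_def lead_coeff_prod lead_coeff_power)

lemma poly_root_part_eq_0_iff:
  assumes "q \<noteq> 0"
  shows "poly (root_part q S) z = 0 \<longleftrightarrow> z \<in> S \<and> poly q z = 0"
  using finite_roots_in[OF assms, of S] order_root[of q z] assms
  by (auto simp: root_part_def poly_prod)

lemma degree_root_part: "degree (root_part q S) = (\<Sum>a\<in>{a\<in>S. poly q a = 0}. order a q)"
  unfolding root_part_def by (subst degree_prod_eq_sum_degree) (auto simp: degree_power_eq)

lemma root_part_Un: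
  assumes "q \<noteq> 0" "S \<inter> T = {}"
  shows "root_part q (S \<union> T) = root_part q S * root_part q T"
proof -
  have "{a\<in>S \<union> T. poly q a = 0} = {a\<in>S. poly q a = 0} \<union> {a\<in>T. poly q a = 0}" by auto
  then show ?thesis
    unfolding root_part_def using assms
    by (subst prod.union_disjoint[symmetric]) (auto simp: finite_roots_in)
qed

lemma root_part_decompose:
  "q = smult (lead_coeff q) (root_part q S * root_part q (- S))" if "q \<noteq> 0"
  using complex_poly_decompose[of q] root_part_Un[OF that, of S "- S"]
  by (simp add: root_part_def)

lemma coprime_no_common_root:
  fixes p q :: "complex poly"
  assumes "p \<noteq> 0" "\<And>z. poly p z = 0 \<Longrightarrow> poly q z \<noteq> 0"
  shows "coprime p q"
proof -
  have "degree (gcd p q) = 0"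
  proof (rule ccontr)
    assume "degree (gcd p q) \<noteq> 0"
    then have "\<not> constant (poly (gcd p q))" by (simp add: constant_degree)
    then obtain z where z: "poly (gcd p q) z = 0"
      using Fundamental_Theorem_Algebra.fundamental_theorem_of_algebra by auto
    have "poly p z = 0" "poly q z = 0"
      using z dvd_trans[OF _ gcd_dvd1] dvd_trans[OF _ gcd_dvd2] by (auto simp: poly_eq_0_iff_dvd)
    then show False using assms(2) by blast
  qed
  then have "is_unit (gcd p q)"
    using assms(1) by (intro is_unit_iff_degree[THEN iffD2]) auto
  then show ?thesis by (simp only: is_unit_gcd)
qed

lemma bezout_complex_poly:
  fixes p q :: "complex poly"
  assumes "coprime p q"
  obtains x y where "x * p + y * q = 1"
  using bezout_coefficients_fst_snd[of p q] assms by (auto simp: coprime_iff_gcd_eq_1)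

text \<open>A strict degree bound that admits the zero polynomial for every \<open>N\<close> and
  nothing else for \<open>N = 0\<close>, which the inequality \<open>degree u < N\<close> cannot
  express.\<close>

definition poly_below :: "nat \<Rightarrow> complex poly \<Rightarrow> bool" where
  "poly_below N u \<longleftrightarrow> (\<forall>i\<ge>N. coeff u i = 0)"

lemma poly_below_iff: "poly_below N u \<longleftrightarrow> u = 0 \<or> degree u < N"
proof -
  have "degree u < N" if "poly_below N u" "u \<noteq> 0"
    using that leading_coeff_neq_0[of u] by (force simp: poly_below_def not_less[symmetric])
  then show ?thesis by (auto simp: poly_below_def coeff_eq_0)
qed

lemma poly_below_add: "poly_below N u \<Longrightarrow> poly_below N v \<Longrightarrow> poly_below N (u + v)"
  by (simp add: poly_below_def)

lemma poly_below_diff: "poly_below N u \<Longrightarrow> poly_below N v \<Longrightarrow> poly_below N (u - v)"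
  by (simp add: poly_below_def)

lemma poly_below_mono: "poly_below M u \<Longrightarrow> M \<le> N \<Longrightarrow> poly_below N u"
  by (simp add: poly_below_def)

lemma poly_below_mult_iff:
  assumes "q \<noteq> 0"
  shows "poly_below (degree q + N) (q * u) \<longleftrightarrow> poly_below N u"
  using assms by (cases "u = 0") (auto simp: poly_below_iff degree_mult_eq)

lemma poly_below_mod: "q \<noteq> 0 \<Longrightarrow> poly_below (degree q) (u mod q)"
  using degree_mod_less[of q u] by (auto simp: poly_below_iff)

lemma poly_below_dvd_imp_zero:
  assumes "poly_below N u" "q dvd u" "N \<le> degree q"
  shows "u = 0"
  using assms dvd_imp_degree_le[OF assms(2)] by (cases "u = 0") (auto simp: poly_below_iff)

text \<open>Bezout gives some splitting \<open>u = (u * y) * d2 + (u * x) * d1\<close>. Reducing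
  \<open>u * y\<close> modulo \<open>d1\<close> and moving the quotient to the other summand bounds
  \<open>u1\<close>; comparing degrees in the identity then bounds \<open>u2\<close>.\<close>

lemma proper_partial_fractions:
  fixes d1 d2 u :: "complex poly"
  assumes "coprime d1 d2" "d1 \<noteq> 0" "d2 \<noteq> 0" "poly_below (degree d1 + degree d2) u"
  obtains u1 u2 where "u = u1 * d2 + u2 * d1" "poly_below (degree d1) u1" "poly_below (degree d2) u2"
proof -
  obtain x y where xy: "x * d1 + y * d2 = 1" using bezout_complex_poly[OF assms(1)] .
  define u1 where "u1 = (u * y) mod d1"
  define u2 where "u2 = u * x + ((u * y) div d1) * d2"
  have eq: "u = u1 * d2 + u2 * d1"
  proof -
    define Q where "Q = (u * y) div d1"
    have "u1 = u * y - Q * d1"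
      unfolding u1_def Q_def by (rule minus_div_mult_eq_mod[symmetric])
    then have "u1 * d2 + u2 * d1 = (u * y - Q * d1) * d2 + (u * x + Q * d2) * d1"
      by (simp only: u2_def Q_def)
    also have "\<dots> = u * (x * d1 + y * d2)"
      by (simp add: algebra_simps)
    finally have "u1 * d2 + u2 * d1 = u * (x * d1 + y * d2)" .
    then show ?thesis using xy by simp
  qed
  have u1: "poly_below (degree d1) u1"
    unfolding u1_def by (rule poly_below_mod[OF assms(2)])
  then have "poly_below (degree d1 + degree d2) (u1 * d2)"
    using poly_below_mult_iff[OF assms(3), of "degree d1" u1] by (simp add: mult.commute add.commute)
  then have "poly_below (degree d1 + degree d2) (d1 * u2)"
  proof -
    assume "poly_below (degree d1 + degree d2) (u1 * d2)"
    from poly_below_diff[OF assms(4) this] show ?thesis unfolding eq by (simp add: mult.commute)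
  qed
  then have "poly_below (degree d2) u2"
    using poly_below_mult_iff[OF assms(2)] by blast
  with eq u1 show thesis using that by blast
qed

text \<open>
  A strictly proper fraction whose poles lie inside the circle of radius \<open>R\<close> has only negative
  frequencies on that circle; the first one reads off the leading coefficient.
\<close>

lemma fourier_coeff_proper_fraction:
  assumes "0 < R" "lead_coeff d = 1" "\<And>a. poly d a = 0 \<Longrightarrow> norm a < R" "poly_below (degree d) u"
  shows "(\<forall>k\<ge>0. fourier_coeff (\<lambda>\<zeta>. poly u (of_real R * \<zeta>) / poly d (of_real R * \<zeta>)) k = 0) \<and>
    (degree d > 0 \<longrightarrow> fourier_coeff (\<lambda>\<zeta>. poly u (of_real R * \<zeta>) / poly d (of_real R * \<zeta>)) (-1)
      = coeff u (degree d - 1) / of_real R)"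
  using assms(2-4)
proof (induction "degree d" arbitrary: d u)
  case 0
  then have "u = 0" by (simp add: poly_below_iff)
  then show ?case using 0 by (simp add: fourier_coeff_def)
next
  case (Suc N)
  have "\<not> constant (poly d)" using Suc.hyps(2) by (simp add: constant_degree)
  then obtain a where a: "poly d a = 0"
    using Fundamental_Theorem_Algebra.fundamental_theorem_of_algebra by auto
  then obtain d' where d': "d = [:- a, 1:] * d'" by (auto simp: poly_eq_0_iff_dvd)
  have d0: "d' \<noteq> 0" using Suc.prems(1) d' by auto
  have lead': "lead_coeff d' = 1"
    using Suc.prems(1) unfolding d' lead_coeff_mult by simp
  have degd: "degree d = Suc (degree d')"
    using d0 unfolding d' by (subst degree_mult_eq) auto
  then have N: "N = degree d'" using Suc.hyps(2) by simp
  \<comment> \<open>Splitting off the root \<open>a\<close>: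
    \<open>(v - a) * u / d = c + u' / d'\<close>. Since \<open>d'\<close> is monic, subtracting
    \<open>c\<close> times \<open>d'\<close> removes the coefficient of index \<open>N\<close>, and
    \<open>u'\<close> again lies below \<open>degree d'\<close>.\<close>
  define c where "c = coeff u N"
  define u' where "u' = u - smult c d'"
  have u'_below: "poly_below (degree d') u'"
    unfolding poly_below_def
  proof (intro allI impI)
    fix i assume i: "degree d' \<le> i"
    show "coeff u' i = 0"
    proof (cases "i = degree d'")
      case True
      then show ?thesis using lead' by (simp add: u'_def c_def N)
    next
      case False
      then show ?thesis
        using i Suc.prems(3) by (simp add: u'_def coeff_eq_0 poly_below_def degd)
    qed
  qed
  define f where "f \<zeta> = poly u (of_real R * \<zeta>) / poly d (of_real R * \<zeta>)" for \<zeta>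
  define f' where "f' \<zeta> = poly u' (of_real R * \<zeta>) / poly d' (of_real R * \<zeta>)" for \<zeta>
  have nz: "poly d (of_real R * \<zeta>) \<noteq> 0" if "norm \<zeta> = 1" for \<zeta>
    using Suc.prems(2)[of "of_real R * \<zeta>"] that assms(1) by (auto simp: norm_mult)
  have nz': "poly d' (of_real R * \<zeta>) \<noteq> 0" if "norm \<zeta> = 1" for \<zeta>
    using nz[OF that] by (auto simp: d')
  have int: "integrable circle_measure f" "integrable circle_measure f'"
    unfolding f_def f'_def using nz nz' by (auto intro!: integrable_circle_continuous continuous_intros)
  have IH: "fourier_coeff f' k = 0" if "k \<ge> 0" for k
  proof -
    have "\<And>b. poly d' b = 0 \<Longrightarrow> norm b < R" using Suc.prems(2) by (simp add: d')
    from Suc.hyps(1)[OF N lead' this u'_below] show ?thesis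
      using that by (simp add: f'_def[abs_def])
  qed
  have rec: "of_real R * fourier_coeff f (k - 1) = a * fourier_coeff f k + (if k = 0 then c else 0) + fourier_coeff f' k" for k
  proof -
    have intz: "integrable circle_measure (\<lambda>\<zeta>. of_real R * (\<zeta> * f \<zeta>))" "integrable circle_measure (\<lambda>\<zeta>. a * f \<zeta>)"
      using integrable_circle_cmult[OF int(1), of "\<lambda>\<zeta>. of_real R * \<zeta>"] int(1)
      by (auto simp: mult.assoc intro!: continuous_intros)
    have "of_real R * fourier_coeff f (k - 1) - a * fourier_coeff f k = fourier_coeff (\<lambda>\<zeta>. of_real R * (\<zeta> * f \<zeta>) - a * f \<zeta>) k"
      using intz by (simp add: fourier_coeff_diff fourier_coeff_cmult fourier_coeff_shift)
    also have "\<dots> = fourier_coeff (\<lambda>\<zeta>. poly [:c:] \<zeta> + f' \<zeta>) k"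
    proof (rule fourier_coeff_cong)
      fix \<zeta> :: complex assume z: "norm \<zeta> = 1"
      define v where "v = of_real R * \<zeta>"
      have 1: "poly d v = (v - a) * poly d' v" by (simp add: d' algebra_simps)
      have 2: "poly u v = poly u' v + c * poly d' v" by (simp add: u'_def)
      have "poly d v \<noteq> 0" using nz[OF z] by (simp add: v_def)
      then have "v - a \<noteq> 0" "poly d' v \<noteq> 0" using 1 by auto
      then have "(v - a) * (poly u v / poly d v) = c + poly u' v / poly d' v"
        unfolding 1 2 by (simp add: add_divide_distrib distrib_left)
      then show "of_real R * (\<zeta> * f \<zeta>) - a * f \<zeta> = poly [:c:] \<zeta> + f' \<zeta>"
        by (simp add: f_def f'_def v_def left_diff_distrib diff_divide_distrib mult.assoc)
    qed
    also have "\<dots> = (if k = 0 then c else 0) + fourier_coeff f' k"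
      by (subst fourier_coeff_add)
        (use int in \<open>auto simp: fourier_coeff_poly coeff_pCons split: nat.split intro!: integrable_circle_continuous continuous_intros\<close>)
    finally show ?thesis by (simp add: algebra_simps)
  qed
  have aR: "norm (a / of_real R) < 1"
    using Suc.prems(2)[OF a] assms(1) by (simp add: norm_divide)
  have iter: "fourier_coeff f k = (a / of_real R) ^ m * fourier_coeff f (k + int m)" if "k \<ge> 0" for k m
  proof (induction m)
    case (Suc m)
    have "of_real R * fourier_coeff f (k + int m) = a * fourier_coeff f (k + int (Suc m))"
      using rec[of "k + int (Suc m)"] IH[of "k + int (Suc m)"] that by simp
    then have "fourier_coeff f (k + int m) = (a / of_real R) * fourier_coeff f (k + int (Suc m))"
      using assms(1) by (simp add: field_simps)
    then show ?case unfolding Suc.IH power_Suc2 by (simp only: mult.assoc)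
  qed simp
  \<comment> \<open>By \<open>iter\<close> the coefficient at \<open>k\<close> is a power of
    \<open>a / R\<close> times a later, uniformly bounded coefficient; as
    \<open>norm (a / R) < 1\<close>, it is 0.\<close>
  have zero: "fourier_coeff f k = 0" if "k \<ge> 0" for k
  proof -
    define L where "L = (LINT \<zeta>|circle_measure. norm (f \<zeta>))"
    have "(\<lambda>m. norm (a / of_real R) ^ m * L) \<longlonglongrightarrow> 0 * L"
      using aR by (intro tendsto_mult LIMSEQ_power_zero tendsto_const) simp
    moreover have "norm (fourier_coeff f k) \<le> norm (a / of_real R) ^ m * L" for m
    proof -
      have "norm (fourier_coeff f k) = norm (a / of_real R) ^ m * norm (fourier_coeff f (k + int m))"
        using arg_cong[OF iter[OF that, of m], of norm] by (simp only: norm_mult norm_power)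
      also have "\<dots> \<le> norm (a / of_real R) ^ m * L"
        unfolding L_def by (intro mult_left_mono norm_fourier_coeff_le int(1)) simp
      finally show ?thesis .
    qed
    ultimately have "norm (fourier_coeff f k) \<le> 0 * L"
      by (intro LIMSEQ_le_const) auto
    then show ?thesis by simp
  qed
  \<comment> \<open>At index 0 the recurrence keeps only the constant \<open>c\<close>.\<close>
  have "fourier_coeff f (-1) = c / of_real R"
    using rec[of 0] zero[of 0] IH[of 0] assms(1) by (simp add: field_simps)
  then show ?case
    using zero by (simp add: f_def[abs_def] degd c_def N)
qed

text \<open>The pair need not be in lowest terms. Passing to \<open>rat_num\<close> and
  \<open>rat_denom\<close> lowers both degrees by the same amount and can only remove poles, so
  membership survives.\<close>

lemma Rat0_Fract:
  assumes "q \<noteq> 0" "poly_below (degree q) u" "\<And>z. poly q z = 0 \<Longrightarrow> norm z = 1"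
  shows "Fract u q \<in> Rat0" and "poly q z \<noteq> 0 \<Longrightarrow> rat_eval (Fract u q) z = poly u z / poly q z"
proof -
  define \<rho> where "\<rho> = Fract u q"
  define a where "a = rat_num \<rho>"
  define b where "b = rat_denom \<rho>"
  have b0: "b \<noteq> 0" by (simp add: b_def rat_denom_def)
  have "Fract a b = Fract u q"
    unfolding a_def b_def rat_num_def rat_denom_def \<rho>_def by (rule Fract_quot_of_fract)
  then have ab: "a * q = u * b"
    using eq_fract(1)[OF b0 assms(1)] by simp
  have "coprime b a"
    unfolding a_def b_def rat_num_def rat_denom_def by (metis coprime_commute coprime_quot_of_fract)
  moreover have "b dvd a * q" unfolding ab by simp
  ultimately have "b dvd q" by (rule coprime_dvd_mult_right_iff[THEN iffD1])
  then have roots: "poly b z = 0 \<Longrightarrow> poly q z = 0" for z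
    by (auto simp: dvd_def)
  have "\<rho> \<in> Rat0"
  proof (cases "a = 0")
    case True
    then have "\<rho> = 0" by (simp add: a_def rat_num_def)
    then show ?thesis by (simp add: Rat0_def)
  next
    case False
    then have "u \<noteq> 0" using ab assms(1) by auto
    then have "degree a + degree q = degree u + degree b"
      using arg_cong[OF ab, of degree] False b0 assms(1) by (simp add: degree_mult_eq)
    moreover have "degree u < degree q" using assms(2) \<open>u \<noteq> 0\<close> by (simp add: poly_below_iff)
    ultimately have "degree a < degree b" by simp
    then show ?thesis
      using roots assms(3) by (auto simp: Rat0_def a_def b_def)
  qed
  then show "Fract u q \<in> Rat0" by (simp add: \<rho>_def)
  show "rat_eval (Fract u q) z = poly u z / poly q z" if "poly q z \<noteq> 0"
  proof -
    have "poly b z \<noteq> 0" using that roots by blast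
    then show ?thesis
      using arg_cong[OF ab, of "\<lambda>p. poly p z"] that
      by (simp add: rat_eval_def a_def b_def \<rho>_def field_simps)
  qed
qed

lemma Rat0D:
  assumes "\<rho> \<in> Rat0"
  shows "rat_denom \<rho> \<noteq> 0" "poly_below (degree (rat_denom \<rho>)) (rat_num \<rho>)"
    "poly (rat_denom \<rho>) z = 0 \<Longrightarrow> norm z = 1"
  using assms by (auto simp: Rat0_def rat_denom_def rat_num_def poly_below_iff)

section \<open>The domain of a Toeplitz-like operator\<close>

lemma holomorphic_on_poly: "poly q holomorphic_on S"
  unfolding holomorphic_on_def field_differentiable_def
  using DERIV_subset[OF poly_DERIV] by blast

lemma poly_quotient_regular:
  assumes "\<And>a. poly b a = 0 \<Longrightarrow> norm a > 1"
  shows "continuous_on (cball 0 1) (\<lambda>z. poly a z / poly b z)"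
    and "(\<lambda>z. poly a z / poly b z) holomorphic_on ball 0 1"
    and "\<exists>B. \<forall>z. norm z < 1 \<longrightarrow> norm (poly a z / poly b z) \<le> B"
proof -
  have nz: "poly b z \<noteq> 0" if "norm z \<le> 1" for z
    using assms[of z] that by auto
  show cont: "continuous_on (cball 0 1) (\<lambda>z. poly a z / poly b z)"
    using nz by (intro continuous_intros) auto
  show "(\<lambda>z. poly a z / poly b z) holomorphic_on ball 0 1"
    using nz by (intro holomorphic_on_divide holomorphic_on_poly) auto
  have "compact ((\<lambda>z. poly a z / poly b z) ` cball 0 1)"
    by (rule compact_continuous_image[OF cont]) simp
  then obtain B where B: "\<forall>y\<in>(\<lambda>z. poly a z / poly b z) ` cball 0 1. norm y \<le> B"
    using compact_imp_bounded bounded_iff by blast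
  have "norm (poly a z / poly b z) \<le> B" if "norm z < 1" for z
    using B that by (auto simp: less_imp_le)
  then show "\<exists>B. \<forall>z. norm z < 1 \<longrightarrow> norm (poly a z / poly b z) \<le> B" by blast
qed

lemma Lp_imp_integrable:
  assumes "f \<in> Lp p" "1 \<le> p"
  shows "integrable circle_measure f"
proof (rule Bochner_Integration.integrable_bound)
  show "integrable circle_measure (\<lambda>\<zeta>. 1 + norm (f \<zeta>) powr p)"
    using assms(1) by (intro Bochner_Integration.integrable_add) (auto simp: Lp_def)
  show "AE \<zeta> in circle_measure. norm (f \<zeta>) \<le> norm (1 + norm (f \<zeta>) powr p)"
  proof (rule AE_circleI)
    fix \<zeta>
    have "norm (f \<zeta>) \<le> 1 + norm (f \<zeta>) powr p"
      using truncation_bound[of "norm (f \<zeta>)" 1 p] assms(2) by simp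
    then show "norm (f \<zeta>) \<le> norm (1 + norm (f \<zeta>) powr p)" by simp
  qed
qed (use assms(1) in \<open>simp add: Lp_def\<close>)

text \<open>On the circle \<open>\<omega> * a / b = k + u / (din * dT)\<close>. Partial fractions
  split off the part with poles on the circle, which serves as \<rho>; the part with poles inside
  has only negative frequencies and stays in \<open>f\<close>, where the projection removes it. The
  domain element may have a denominator \<open>b\<close> without roots in the closed disc.\<close>

lemma toeplitz_decompI:
  assumes "0 < p"
    and d: "rat_denom \<omega> = dout * (din * dT)"
    and din: "lead_coeff din = 1" "\<And>a. poly din a = 0 \<Longrightarrow> norm a < 1"
    and dT: "dT \<noteq> 0" "\<And>a. poly dT a = 0 \<Longrightarrow> norm a = 1"
    and dout: "\<And>a. poly dout a = 0 \<Longrightarrow> norm a > 1"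
    and b: "\<And>a. poly b a = 0 \<Longrightarrow> norm a > 1"
    and u: "poly_below (degree din + degree dT) u"
    and eq: "rat_num \<omega> * a = b * (dout * (u + din * dT * k))"
  defines "g \<equiv> restrict_disc (\<lambda>z. poly a z / poly b z)"
  shows "g \<in> Hp p" and "\<exists>f. toeplitz_decomp p \<omega> g f \<and> riesz_projection f = restrict_disc (poly k)"
proof -
  note quot = poly_quotient_regular[where b=b and a=a, OF b]
  from quot(3) obtain B where "\<And>z. norm z < 1 \<Longrightarrow> norm (poly a z / poly b z) \<le> B" by blast
  from restrict_disc_Hp[OF assms(1) quot(2) this] show "g \<in> Hp p" unfolding g_def .
  have din0: "din \<noteq> 0" using din(1) by auto
  have "coprime din dT"
    using din(2) dT(2) by (intro coprime_no_common_root[OF din0]) fastforce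
  then obtain u1 u2 where u12: "u = u1 * dT + u2 * din" "poly_below (degree din) u1" "poly_below (degree dT) u2"
    using proper_partial_fractions[OF _ din0 dT(1) u] by blast
  define v where "v \<zeta> = poly u1 \<zeta> / poly din \<zeta>" for \<zeta>
  define f where "f \<zeta> = poly k \<zeta> + v \<zeta>" for \<zeta>
  have din_nz: "poly din \<zeta> \<noteq> 0" if "norm \<zeta> = 1" for \<zeta> using din(2)[of \<zeta>] that by auto
  have cont_v: "continuous_on (sphere 0 1) v"
    unfolding v_def using din_nz by (intro continuous_intros) auto
  then have cont: "continuous_on (sphere 0 1) f"
    unfolding f_def by (intro continuous_intros)
  have f_Lp: "f \<in> Lp p"
    using measurable_circle_continuous[OF cont] integrable_circle_continuous[OF continuous_on_norm_powr[OF cont assms(1)]]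
    by (simp add: Lp_def)
  have "boundary_function g (\<lambda>\<zeta>. poly a \<zeta> / poly b \<zeta>)"
    unfolding boundary_function_def
  proof (rule AE_circleI)
    fix \<zeta> :: complex assume z: "norm \<zeta> = 1"
    have "((\<lambda>r. complex_of_real r * \<zeta>) \<longlongrightarrow> of_real 1 * \<zeta>) (at_left 1)"
      by (intro tendsto_intros)
    moreover have "poly b \<zeta> \<noteq> 0" using b[of \<zeta>] z by auto
    ultimately have "((\<lambda>r. poly a (complex_of_real r * \<zeta>) / poly b (complex_of_real r * \<zeta>)) \<longlongrightarrow> poly a \<zeta> / poly b \<zeta>) (at_left 1)"
      by (intro tendsto_intros) auto
    moreover have "eventually (\<lambda>r. r \<in> {0<..<1::real}) (at_left 1)"
      by (rule eventually_at_left_field[THEN iffD2]) (auto intro: exI[of _ 0])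
    then have "eventually (\<lambda>r. poly a (complex_of_real r * \<zeta>) / poly b (complex_of_real r * \<zeta>) = g (of_real r * \<zeta>)) (at_left 1)"
      by eventually_elim (use z in \<open>simp add: g_def restrict_disc_def norm_mult\<close>)
    ultimately show "((\<lambda>r. g (complex_of_real r * \<zeta>)) \<longlongrightarrow> poly a \<zeta> / poly b \<zeta>) (at_left 1)"
      by (rule Lim_transform_eventually)
  qed
  moreover have "AE \<zeta> in circle_measure. rat_eval \<omega> \<zeta> * (poly a \<zeta> / poly b \<zeta>) = f \<zeta> + rat_eval (Fract u2 dT) \<zeta>"
    using AE_circle_finite[OF finite_roots_in[OF dT(1), of UNIV]] AE_space
  proof eventually_elim
    case (elim \<zeta>)
    have nz: "poly dT \<zeta> \<noteq> 0" "poly din \<zeta> \<noteq> 0" "poly dout \<zeta> \<noteq> 0" "poly b \<zeta> \<noteq> 0"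
      using elim din_nz dout[of \<zeta>] b[of \<zeta>] by auto
    have 1: "poly (rat_num \<omega>) \<zeta> * poly a \<zeta> = poly b \<zeta> * (poly dout \<zeta> * (poly u1 \<zeta> * poly dT \<zeta> + poly u2 \<zeta> * poly din \<zeta> + poly din \<zeta> * poly dT \<zeta> * poly k \<zeta>))"
      using arg_cong[OF eq, of "\<lambda>q. poly q \<zeta>"] by (simp add: u12(1))
    have "rat_eval \<omega> \<zeta> * (poly a \<zeta> / poly b \<zeta>) = (poly (rat_num \<omega>) \<zeta> * poly a \<zeta>) / (poly dout \<zeta> * (poly din \<zeta> * poly dT \<zeta>) * poly b \<zeta>)"
      by (simp add: rat_eval_def d)
    also have "\<dots> = poly k \<zeta> + poly u1 \<zeta> / poly din \<zeta> + poly u2 \<zeta> / poly dT \<zeta>"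
    proof -
      have "B * (D * (u * T + v * I + I * T * K)) / (D * (I * T) * B) = K + u / I + v / T"
        if "T \<noteq> 0" "I \<noteq> 0" "D \<noteq> 0" "B \<noteq> 0" for B D u T v I K :: complex
      proof -
        have "B * (D * X) / (D * Y * B) = X / Y" for X Y
          using that by simp
        moreover have "(u * T + v * I + I * T * K) / (I * T) = K + u / I + v / T"
          using that by (simp add: add_divide_distrib)
        ultimately show ?thesis by simp
      qed
      from this[OF nz] show ?thesis unfolding 1 .
    qed
    also have "\<dots> = f \<zeta> + rat_eval (Fract u2 dT) \<zeta>"
      using Rat0_Fract(2)[OF dT(1) u12(3) dT(2) nz(1)] by (simp add: f_def v_def)
    finally show ?case .
  qed
  ultimately have "toeplitz_decomp p \<omega> g f"
    unfolding toeplitz_decomp_def using f_Lp Rat0_Fract(1)[OF dT(1) u12(3) dT(2)] by blast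
  moreover have "riesz_projection f = restrict_disc (poly k)"
  proof
    fix z
    have v0: "fourier_coeff v (int n) = 0" for n
      using fourier_coeff_proper_fraction[OF zero_less_one din(1) din(2) u12(2)] by (simp add: v_def[abs_def])
    have "fourier_coeff f (int n) = fourier_coeff (poly k) (int n)" for n
      unfolding f_def using v0
      by (subst fourier_coeff_add) (auto intro!: integrable_circle_continuous continuous_intros cont_v)
    then have "riesz_projection f z = riesz_projection (poly k) z"
      using riesz_projection_cong[of f "poly k"] by metis
    then show "riesz_projection f z = restrict_disc (poly k) z"
      using riesz_projection_poly[of z k] by (cases "norm z < 1") (auto simp: restrict_disc_def riesz_projection_outside)
  qed
  ultimately show "\<exists>f. toeplitz_decomp p \<omega> g f \<and> riesz_projection f = restrict_disc (poly k)" by blast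
qed

text \<open>\<open>g\<close> is the projection of a version of its own boundary function, so the
  estimate for projections applies.\<close>

lemma toeplitz_decomp_radially_small:
  assumes "1 < p" "g \<in> Hp p" "toeplitz_decomp p \<omega> g f"
  shows "radially_small g"
proof -
  obtain b where "boundary_function g b" using assms(3) by (auto simp: toeplitz_decomp_def)
  from Hp_boundary_exists[OF assms(1,2) this] obtain B where
    "integrable circle_measure B" "\<And>z. norm z < 1 \<Longrightarrow> riesz_projection B z = g z" by metis
  then show ?thesis
    using radially_small_cong[OF radially_small_riesz_projection] by blast
qed

text \<open>Multiplying the decomposition by \<open>dc * q\<close> leaves no pole in the closed
  disc: \<open>G\<close> is a Hardy function with integrable boundary values \<open>B\<close> and is
  recovered from them by projection. Commuting \<open>dc * q\<close> with the projection costs the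
  polynomial \<open>u0\<close>, and \<open>q\<close> is divided out at the end.\<close>

lemma toeplitz_decompD:
  assumes "1 < p" "g \<in> Hp p" "toeplitz_decomp p \<omega> g f"
    and d: "rat_denom \<omega> = dout * dc"
    and dout: "\<And>a. poly dout a = 0 \<Longrightarrow> norm a > 1"
    and dc: "\<And>a. poly dc a = 0 \<Longrightarrow> norm a \<le> 1"
  obtains u where "poly_below (degree dc) u"
    and "\<And>z. norm z < 1 \<Longrightarrow> poly (rat_num \<omega>) z * g z = poly dout z * (poly u z + poly dc z * riesz_projection f z)"
proof -
  have f_Lp: "f \<in> Lp p" using assms(3) by (simp add: toeplitz_decomp_def)
  then have f_int: "integrable circle_measure f" using assms(1) by (simp add: Lp_imp_integrable)
  obtain \<rho> b where \<rho>: "\<rho> \<in> Rat0" and b: "boundary_function g b"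
    and ae: "AE \<zeta> in circle_measure. rat_eval \<omega> \<zeta> * b \<zeta> = f \<zeta> + rat_eval \<rho> \<zeta>"
    using assms(3) by (auto simp: toeplitz_decomp_def)
  define n where "n = rat_num \<omega>"
  define r where "r = rat_num \<rho>"
  define q where "q = rat_denom \<rho>"
  have d0: "rat_denom \<omega> \<noteq> 0" by (simp add: rat_denom_def)
  then have dc0: "dc \<noteq> 0" using d by auto
  have q0: "q \<noteq> 0" and r: "poly_below (degree q) r" and q: "\<And>a. poly q a = 0 \<Longrightarrow> norm a = 1"
    using Rat0D[OF \<rho>] by (auto simp: q_def r_def)
  note quot = poly_quotient_regular[where b=dout, OF dout]
  define G where "G z = poly (n * q) z / poly dout z * g z" for z
  define B where "B \<zeta> = poly (dc * q) \<zeta> * f \<zeta> + poly (dc * r) \<zeta>" for \<zeta>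
  from quot(3)[of "n * q"] obtain b' where "\<And>z. norm z < 1 \<Longrightarrow> norm (poly (n * q) z / poly dout z) \<le> b'" by blast
  then have G_Hp: "G \<in> Hp p"
    unfolding G_def using assms(1) by (intro Hp_mult[OF assms(2)] quot(2)) auto
  have int1: "integrable circle_measure (\<lambda>\<zeta>. poly (dc * q) \<zeta> * f \<zeta>)"
    by (rule integrable_poly_mult[OF f_int])
  have int2: "integrable circle_measure (poly (dc * r))"
    by (intro integrable_circle_continuous continuous_intros)
  have B_meas: "B \<in> borel_measurable circle_measure"
    unfolding B_def using Bochner_Integration.integrable_add[OF int1 int2] by (rule borel_measurable_integrable)
  have "AE \<zeta> in circle_measure. (\<lambda>k. G (of_real (radius_seq k) * \<zeta>)) \<longlonglongrightarrow> B \<zeta>"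
    using ae boundary_function_radius_seq[OF b] AE_circle_finite[OF finite_roots_in[OF d0, of UNIV]]
      AE_circle_finite[OF finite_roots_in[OF q0, of UNIV]] AE_space
  proof eventually_elim
    case (elim \<zeta>)
    have nz: "poly dc \<zeta> \<noteq> 0" "poly q \<zeta> \<noteq> 0" "poly dout \<zeta> \<noteq> 0"
      using elim(3,4) by (auto simp: d)
    have "(\<lambda>k. G (of_real (radius_seq k) * \<zeta>)) \<longlonglongrightarrow> poly (n * q) \<zeta> / poly dout \<zeta> * b \<zeta>"
      unfolding G_def using nz by (intro tendsto_intros radius_seq_mult_tendsto elim(2)) auto
    moreover have "poly (n * q) \<zeta> / poly dout \<zeta> * b \<zeta> = B \<zeta>"
    proof -
      have "poly n \<zeta> / (poly dout \<zeta> * poly dc \<zeta>) * b \<zeta> = f \<zeta> + poly r \<zeta> / poly q \<zeta>"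
        using elim(1) by (simp add: rat_eval_def n_def d r_def q_def)
      then have "poly dc \<zeta> * poly q \<zeta> * (poly n \<zeta> / (poly dout \<zeta> * poly dc \<zeta>) * b \<zeta>) = poly dc \<zeta> * poly q \<zeta> * (f \<zeta> + poly r \<zeta> / poly q \<zeta>)"
        by simp
      then show ?thesis using nz by (simp add: B_def distrib_left mult_ac)
    qed
    ultimately show ?case by simp
  qed
  then have RB: "riesz_projection B z = G z" if "norm z < 1" for z
    using Hp_boundary(2)[OF assms(1) G_Hp B_meas _ that] by blast
  define h where "h = riesz_projection f"
  obtain u0 where u0: "\<And>i. i \<ge> degree (dc * q) \<Longrightarrow> coeff u0 i = 0"
    and u0_eq: "\<And>z. norm z < 1 \<Longrightarrow> riesz_projection (\<lambda>\<zeta>. poly (dc * q) \<zeta> * f \<zeta>) z = poly (dc * q) z * h z + poly u0 z"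
    using riesz_projection_poly_mult[OF f_int, of "dc * q"] unfolding h_def by blast
  define u1 where "u1 = u0 + dc * r"
  have "poly_below (degree dc + degree q) (dc * r)"
    using r dc0 by (simp add: poly_below_mult_iff)
  moreover have "poly_below (degree dc + degree q) u0"
    using u0 dc0 q0 by (simp add: poly_below_def degree_mult_eq)
  ultimately have u1: "poly_below (degree q + degree dc) u1"
    by (simp add: u1_def poly_below_add add.commute)
  have main: "G z = poly (dc * q) z * h z + poly u1 z" if "norm z < 1" for z
    using RB[OF that] riesz_projection_add[OF int1 int2, of z] riesz_projection_poly[OF that, of "dc * r"] u0_eq[OF that]
    by (simp add: B_def[abs_def] u1_def)
  \<comment> \<open>The candidate for \<open>u1 / q\<close> on the disc. It is built from
    \<open>g\<close> and \<open>h\<close> with coefficients continuous up to the circle, so it is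
    radially small and the roots of \<open>q\<close> on the circle cancel.\<close>
  define G' where "G' z = poly n z / poly dout z * g z - poly dc z * h z" for z
  have h_cont: "continuous_on (ball 0 1) h"
    unfolding h_def by (intro holomorphic_on_imp_continuous_on riesz_projection_holomorphic f_int)
  have G'_eq: "poly u1 z = poly q z * G' z" if "norm z < 1" for z
    using main[OF that] by (simp add: G_def G'_def algebra_simps)
  have "q dvd u1"
  proof (rule poly_dvd_of_disc[OF q0 _ _ _ G'_eq])
    show "continuous_on (ball 0 1) G'"
      unfolding G'_def
      by (intro continuous_intros h_cont HpD(2)[OF assms(2)]) (use dout in fastforce)
    show "radially_small G'"
      unfolding G'_def
    proof (rule radially_small_diff)
      show "radially_small (\<lambda>z. poly n z / poly dout z * g z)"
        by (rule radially_small_mult[OF toeplitz_decomp_radially_small[OF assms(1-3)] quot(1)])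
      show "radially_small (\<lambda>z. poly dc z * h z)"
        unfolding h_def by (rule radially_small_mult[OF radially_small_riesz_projection[OF f_int]]) (intro continuous_intros)
    qed
  qed (use q in auto)
  then obtain u where u: "u1 = q * u" by (auto simp: dvd_def)
  have below: "poly_below (degree dc) u"
    using u1 q0 unfolding u by (simp add: poly_below_mult_iff)
  have "poly n z * g z = poly dout z * (poly u z + poly dc z * h z)" if z: "norm z < 1" for z
  proof -
    have "poly q z \<noteq> 0" "poly dout z \<noteq> 0" using q[of z] dout[of z] z by auto
    then have "poly u z = G' z" using G'_eq[OF z] by (simp add: u)
    then show ?thesis using \<open>poly dout z \<noteq> 0\<close> by (simp add: G'_def)
  qed
  then show thesis
    unfolding n_def h_def by (rule that[OF below])
qed

section \<open>Density of polynomials\<close>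

lemma powr_tangent_less:
  fixes s t p :: real
  assumes "1 < p" "0 \<le> s" "0 \<le> t" "s \<noteq> t"
  shows "s powr p + p * s powr (p - 1) * (t - s) < t powr p"
proof -
  \<comment> \<open>Points at 0 are separate because the mean value theorem is used with the
    derivative of \<open>powr\<close> at a positive base.\<close>
  consider "s = 0" | "t = 0" "s > 0" | "0 < s" "s < t" | "0 < t" "t < s"
    using assms by linarith
  then show ?thesis
  proof cases
    case 1
    then show ?thesis using assms by simp
  next
    case 2
    have "s * s powr (p - 1) = s powr p"
      using 2 by (simp add: powr_mult_base)
    then have "s powr p + p * s powr (p - 1) * (0 - s) = (1 - p) * s powr p"
      by (simp add: algebra_simps)
    also have "\<dots> < 0" using assms 2 by (intro mult_neg_pos) auto
    finally show ?thesis using 2 by simp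
  next
    case 3
    have "\<exists>z>s. z < t \<and> t powr p - s powr p = (t - s) * (p * z powr (p - 1))"
      by (rule MVT2[OF 3(2)]) (use 3 in \<open>auto intro!: has_real_derivative_powr\<close>)
    then obtain z where z: "s < z" "t powr p - s powr p = (t - s) * (p * z powr (p - 1))" by blast
    have "s powr (p - 1) < z powr (p - 1)"
      using z(1) 3 assms(1) by (intro powr_less_mono2) auto
    then have "(t - s) * (p * s powr (p - 1)) < (t - s) * (p * z powr (p - 1))"
      using 3 assms(1) by (intro mult_strict_left_mono) auto
    then show ?thesis using z(2) by (simp add: algebra_simps)
  next
    case 4
    have "\<exists>z>t. z < s \<and> s powr p - t powr p = (s - t) * (p * z powr (p - 1))"
      by (rule MVT2[OF 4(2)]) (use 4 in \<open>auto intro!: has_real_derivative_powr\<close>)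
    then obtain z where z: "t < z" "z < s" "s powr p - t powr p = (s - t) * (p * z powr (p - 1))" by blast
    have "z powr (p - 1) < s powr (p - 1)"
      using z(1,2) 4 assms(1) by (intro powr_less_mono2) auto
    then have "(s - t) * (p * z powr (p - 1)) < (s - t) * (p * s powr (p - 1))"
      using 4 assms(1) by (intro mult_strict_left_mono) auto
    then show ?thesis using z(3) by (simp add: algebra_simps)
  qed
qed

lemma powr_tangent_le:
  fixes s t p :: real
  assumes "1 < p" "0 \<le> s" "0 \<le> t"
  shows "s powr p + p * s powr (p - 1) * (t - s) \<le> t powr p"
  using powr_tangent_less[OF assms] by (cases "s = t") auto

text \<open>The linear term is the real derivative of \<open>norm w powr p\<close> at
  \<open>a\<close> in direction \<open>w - a\<close>. The bound
  \<open>Re (cnj a * w) \<le> norm a * norm w\<close> reduces the claim to the tangent inequality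
  for moduli.\<close>

lemma norm_powr_tangent:
  fixes a w :: complex
  assumes "1 < p"
  shows "norm a powr p + p * Re (cnj a * of_real (norm a powr (p - 2)) * (w - a)) \<le> norm w powr p"
proof (cases "a = 0")
  case False
  have sq: "cnj a * a = of_real ((norm a)\<^sup>2)" by (simp only: complex_norm_square mult.commute)
  have pw: "norm a powr (p - 2) * norm a = norm a powr (p - 1)"
    using False by (simp add: powr_mult_base mult.commute)
  have "Re (cnj a * w) \<le> norm a * norm w"
    using complex_Re_le_cmod[of "cnj a * w"] by (simp add: norm_mult)
  then have "Re (cnj a * (w - a)) \<le> norm a * (norm w - norm a)"
    using sq by (simp add: right_diff_distrib power2_eq_square)
  then have "norm a powr (p - 2) * Re (cnj a * (w - a)) \<le> norm a powr (p - 2) * (norm a * (norm w - norm a))"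
    by (intro mult_left_mono) auto
  also have "\<dots> = norm a powr (p - 1) * (norm w - norm a)"
    by (simp add: pw flip: mult.assoc)
  finally have "p * (norm a powr (p - 2) * Re (cnj a * (w - a))) \<le> p * (norm a powr (p - 1) * (norm w - norm a))"
    using assms by (intro mult_left_mono) auto
  moreover have "Re (cnj a * of_real (norm a powr (p - 2)) * (w - a)) = norm a powr (p - 2) * Re (cnj a * (w - a))"
  proof -
    have "cnj a * of_real (norm a powr (p - 2)) * (w - a) = of_real (norm a powr (p - 2)) * (cnj a * (w - a))"
      by (simp only: mult_ac)
    then show ?thesis by (simp add: algebra_simps)
  qed
  ultimately show ?thesis
    using powr_tangent_le[OF assms, of "norm a" "norm w"] by (simp add: mult.assoc)
qed simp

text \<open>Tangents at the mean modulus \<open>m\<close>, whose linear terms cancel. Strictness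
  comes from the strict tangent inequality if the moduli differ and from the parallelogram law if
  they agree.\<close>

lemma power_mean_midpoint:
  fixes a b :: complex
  assumes "1 < p"
  shows "norm ((a + b) / 2) powr p \<le> (norm a powr p + norm b powr p) / 2"
    and "a \<noteq> b \<Longrightarrow> norm ((a + b) / 2) powr p < (norm a powr p + norm b powr p) / 2"
proof -
  define m where "m = (norm a + norm b) / 2"
  have m0: "0 \<le> m" by (simp add: m_def)
  have le: "norm ((a + b) / 2) \<le> m"
    using norm_triangle_ineq[of a b] by (simp add: m_def norm_divide)
  then have le': "norm ((a + b) / 2) powr p \<le> m powr p"
    using assms by (intro powr_mono2) auto
  have tangents: "p * m powr (p - 1) * (norm a - m) + p * m powr (p - 1) * (norm b - m) = 0"
    by (simp add: m_def field_simps)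
  show "norm ((a + b) / 2) powr p \<le> (norm a powr p + norm b powr p) / 2"
    using powr_tangent_le[OF assms m0, of "norm a"] powr_tangent_le[OF assms m0, of "norm b"] le' tangents by simp
  assume ab: "a \<noteq> b"
  show "norm ((a + b) / 2) powr p < (norm a powr p + norm b powr p) / 2"
  proof (cases "norm a = norm b")
    case False
    then have "m \<noteq> norm a" "m \<noteq> norm b" by (auto simp: m_def field_simps)
    then show ?thesis
      using powr_tangent_less[OF assms m0, of "norm a"] powr_tangent_less[OF assms m0, of "norm b"] le' tangents by simp
  next
    case True
    have "(norm (a + b))\<^sup>2 + (norm (a - b))\<^sup>2 = 2 * (norm a)\<^sup>2 + 2 * (norm b)\<^sup>2"
      unfolding cmod_power2 by (simp add: power2_eq_square algebra_simps)
    moreover have "(norm (a - b))\<^sup>2 > 0" using ab by simp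
    ultimately have "(norm (a + b))\<^sup>2 < (2 * norm a)\<^sup>2"
      using True by (simp add: power2_eq_square)
    then have "norm (a + b) < 2 * norm a"
      by (rule power2_less_imp_less) simp
    then have "norm ((a + b) / 2) < norm a" by (simp add: norm_divide)
    then have "norm ((a + b) / 2) powr p < norm a powr p"
      using assms by (intro powr_less_mono2) auto
    then show ?thesis using True by simp
  qed
qed

text \<open>
  Uniform convexity in pointwise form: by homogeneity it suffices to bound a continuous function
  on a compact set, away from the diagonal, where the convexity gap is positive.
\<close>

lemma uniform_convexity_pointwise:
  fixes p \<eta> :: real
  assumes "1 < p" "0 < \<eta>"
  obtains C where "0 \<le> C" "\<And>a b :: complex. norm (a - b) powr p \<le> \<eta> * (norm a powr p + norm b powr p)
      + C * ((norm a powr p + norm b powr p) / 2 - norm ((a + b) / 2) powr p)"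
proof -
  define N where "N x = norm (fst x) powr p + norm (snd x) powr p" for x :: "complex \<times> complex"
  define gap where "gap x = N x / 2 - norm ((fst x + snd x) / 2) powr p" for x :: "complex \<times> complex"
  define D where "D x = norm (fst x - snd x) powr p" for x :: "complex \<times> complex"
  have p0: "0 < p" using assms(1) by simp
  have contN: "continuous_on S N" for S
    unfolding N_def by (intro continuous_intros continuous_on_powr') (use p0 in auto)
  have contD: "continuous_on S D" for S
    unfolding D_def by (intro continuous_on_powr' continuous_intros) (use p0 in auto)
  have contg: "continuous_on S gap" for S
    unfolding gap_def by (intro continuous_on_diff continuous_on_divide contN continuous_on_powr' continuous_intros) (use p0 in auto)
  have gap0: "0 \<le> gap x" for x
    using power_mean_midpoint(1)[OF assms(1), of "fst x" "snd x"] by (simp add: gap_def N_def)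
  define K where "K = {x. N x = 1} \<inter> {x. \<eta> \<le> D x}"
  have "closed K"
    unfolding K_def by (intro closed_Int closed_Collect_eq closed_Collect_le contN contD continuous_on_const)
  moreover have "bounded K"
  proof (rule boundedI)
    fix x assume "x \<in> K"
    then have "norm (fst x) powr p \<le> 1" "norm (snd x) powr p \<le> 1"
      by (auto simp: K_def N_def) (smt (verit) powr_ge_zero)+
    then have "norm (fst x) \<le> 1" "norm (snd x) \<le> 1"
      using p0 powr_less_mono2[of p 1 "norm (fst x)"] powr_less_mono2[of p 1 "norm (snd x)"]
      by (simp_all add: not_less[symmetric]) (auto simp: not_less[symmetric])
    then show "norm x \<le> 2"
      using norm_Pair_le[of "fst x" "snd x"] by simp
  qed
  ultimately have K: "compact K" by (simp add: compact_eq_bounded_closed)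
  obtain \<delta> where \<delta>: "0 < \<delta>" "\<And>x. x \<in> K \<Longrightarrow> \<delta> \<le> gap x"
  proof (cases "K = {}")
    case False
    obtain x0 where x0: "x0 \<in> K" "\<And>x. x \<in> K \<Longrightarrow> gap x0 \<le> gap x"
      using continuous_attains_inf[OF K False contg] by blast
    have "fst x0 \<noteq> snd x0"
      using x0(1) assms p0 by (auto simp: K_def D_def)
    then have "0 < gap x0"
      using power_mean_midpoint(2)[OF assms(1)] by (simp add: gap_def N_def)
    then show thesis using that x0(2) by blast
  qed (use that[of 1] in auto)
  \<comment> \<open>On \<open>K\<close> the distance term is at most \<open>2 powr p\<close> and the
    gap at least \<open>\<delta>\<close>, so \<open>C\<close> times the gap dominates it.\<close>
  define C where "C = 2 powr p / \<delta>"
  have C0: "0 \<le> C" using \<delta> by (simp add: C_def)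
  have unit: "D x \<le> \<eta> + C * gap x" if "N x = 1" for x
  proof (cases "\<eta> \<le> D x")
    case True
    then have "\<delta> \<le> gap x" using \<delta>(2) that by (simp add: K_def)
    then have "C * \<delta> \<le> C * gap x" using C0 by (rule mult_left_mono)
    moreover have "C * \<delta> = 2 powr p" using \<delta>(1) by (simp add: C_def)
    moreover have "D x \<le> 2 powr p * N x"
      using norm_add_powr_le[OF p0, of "fst x" "- snd x"] by (simp add: D_def N_def)
    ultimately show ?thesis using that assms(2) by simp
  next
    case False
    then show ?thesis using mult_nonneg_nonneg[OF C0 gap0[of x]] by simp
  qed
  have "D x \<le> \<eta> * N x + C * gap x" for x
  proof (cases "x = 0")
    case True
    then show ?thesis using p0 by (simp add: D_def N_def gap_def)
  next
    case False
    have Npos: "0 < N x"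
    proof -
      have "fst x \<noteq> 0 \<or> snd x \<noteq> 0" using False by (simp add: prod_eq_iff)
      then show ?thesis by (auto simp: N_def add_pos_nonneg add_nonneg_pos)
    qed
    \<comment> \<open>All three expressions are homogeneous of degree \<open>p\<close>; scaling by
      \<open>t\<close> makes \<open>N\<close> equal to 1.\<close>
    define t where "t = N x powr (- 1 / p)"
    have t: "0 < t" using Npos by (simp add: t_def)
    have tp: "t powr p = 1 / N x"
      unfolding t_def powr_powr using Npos p0 by (simp add: powr_minus inverse_eq_divide)
    have norm_scale: "norm (complex_of_real t * w) powr p = t powr p * norm w powr p" for w
      using t by (simp add: norm_mult powr_mult)
    define y where "y = (complex_of_real t * fst x, complex_of_real t * snd x)"
    have Ny: "N y = t powr p * N x"
      by (simp add: N_def y_def norm_scale distrib_left)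
    have Dy: "D y = t powr p * D x"
      using norm_scale[of "fst x - snd x"] by (simp add: D_def y_def right_diff_distrib)
    have gy: "gap y = t powr p * gap x"
      using norm_scale[of "(fst x + snd x) / 2"]
      by (simp add: gap_def Ny right_diff_distrib) (simp add: y_def distrib_left)
    have "N y = 1" using Ny tp Npos by simp
    from unit[OF this] have "D x / N x \<le> \<eta> + C * (gap x / N x)"
      by (simp add: Dy gy tp)
    then have "D x / N x * N x \<le> (\<eta> + C * (gap x / N x)) * N x"
      using Npos by (intro mult_right_mono) auto
    then show ?thesis using Npos by (simp add: distrib_right)
  qed
  then have "norm (a - b) powr p \<le> \<eta> * (norm a powr p + norm b powr p)
      + C * ((norm a powr p + norm b powr p) / 2 - norm ((a + b) / 2) powr p)" for a b :: complex
    using spec[of "\<lambda>x. D x \<le> \<eta> * N x + C * gap x" "(a, b)"] by (simp add: D_def N_def gap_def)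
  with C0 show thesis by (rule that)
qed

section \<open>Monotonicity of the means in the radius\<close>

lemma circle_mean_rotate:
  assumes "continuous_on (ball 0 1) H" "0 \<le> r" "r < 1" "0 < p" "norm \<eta> = 1"
  shows "(LINT \<zeta>|circle_measure. norm (H (of_real r * \<eta> * \<zeta>)) powr p) = circle_mean p H r"
proof -
  have "continuous_on (sphere 0 1) (\<lambda>\<zeta>. norm (H (complex_of_real r * \<zeta>)) powr p)"
    by (rule continuous_on_norm_powr[OF continuous_on_dilate[OF assms(1-3)] assms(4)])
  from circle_integral_rotate[OF this assms(5)] show ?thesis
    by (simp add: circle_mean_def mult.assoc)
qed

text \<open>Termwise integration multiplies the Taylor coefficients of \<open>H\<close> by the
  moments of \<open>c\<close>, so the result is again a power series on the disc.\<close>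

lemma holomorphic_circle_average:
  assumes "H holomorphic_on ball 0 1" "integrable circle_measure c"
  shows "(\<lambda>z. LINT \<zeta>|circle_measure. H (z * \<zeta>) * c \<zeta>) holomorphic_on ball 0 1"
proof (rule power_series_holomorphic)
  fix z :: complex assume "z \<in> ball 0 1"
  then have z: "norm z < 1" by simp
  define a where "a k = (deriv ^^ k) H 0 / fact k" for k
  have sums: "(\<lambda>k. a k * w ^ k) sums H w" if "norm w < 1" for w
    using holomorphic_power_series[OF assms(1), of w] that by (simp add: a_def)
  have abs: "summable (\<lambda>k. norm (a k * z ^ k))"
  proof (rule powser_insidea)
    have "norm (complex_of_real ((1 + norm z) / 2)) < 1"
      using z norm_ge_zero[of z] by (simp only: norm_of_real) auto
    from sums[OF this] show "summable (\<lambda>k. a k * complex_of_real ((1 + norm z) / 2) ^ k)"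
      by (simp add: sums_iff)
    show "norm z < norm (complex_of_real ((1 + norm z) / 2))"
      using z norm_ge_zero[of z] by (simp only: norm_of_real) auto
  qed
  define F where "F k \<zeta> = a k * z ^ k * (\<zeta> ^ k * c \<zeta>)" for k \<zeta>
  have int: "integrable circle_measure (F k)" for k
    unfolding F_def by (intro integrable_mult_right integrable_circle_cmult[OF assms(2)] continuous_intros)
  have nF: "norm (F k \<zeta>) = norm (a k * z ^ k) * norm (c \<zeta>)" if "norm \<zeta> = 1" for k \<zeta>
    using that by (simp add: F_def norm_mult norm_power)
  have "(\<lambda>k. LINT \<zeta>|circle_measure. F k \<zeta>) sums (LINT \<zeta>|circle_measure. (\<Sum>k. F k \<zeta>))"
  proof (rule sums_integral[OF int])
    show "AE \<zeta> in circle_measure. summable (\<lambda>k. norm (F k \<zeta>))"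
      by (rule AE_circleI) (simp only: nF summable_mult2[OF abs])
    have "(LINT \<zeta>|circle_measure. norm (F k \<zeta>)) = norm (a k * z ^ k) * (LINT \<zeta>|circle_measure. norm (c \<zeta>))" for k
      using circle_integral_cong[of "\<lambda>\<zeta>. norm (F k \<zeta>)" "\<lambda>\<zeta>. norm (a k * z ^ k) * norm (c \<zeta>)"] nF
      by (simp only: integral_mult_right_zero)
    then show "summable (\<lambda>k. LINT \<zeta>|circle_measure. norm (F k \<zeta>))"
      by (simp only: summable_mult2[OF abs])
  qed
  moreover have "(LINT \<zeta>|circle_measure. (\<Sum>k. F k \<zeta>)) = (LINT \<zeta>|circle_measure. H (z * \<zeta>) * c \<zeta>)"
  proof (rule circle_integral_cong)
    fix \<zeta> :: complex assume "norm \<zeta> = 1"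
    then have "norm (z * \<zeta>) < 1" using z by (simp add: norm_mult)
    from sums_mult2[OF sums[OF this], of "c \<zeta>"] have "(\<lambda>k. F k \<zeta>) sums (H (z * \<zeta>) * c \<zeta>)"
      by (simp add: F_def power_mult_distrib mult.assoc)
    then show "(\<Sum>k. F k \<zeta>) = H (z * \<zeta>) * c \<zeta>" by (rule sums_unique[symmetric])
  qed
  moreover have "(LINT \<zeta>|circle_measure. F k \<zeta>) = a k * (LINT \<zeta>|circle_measure. \<zeta> ^ k * c \<zeta>) * (z - 0) ^ k" for k
    by (simp only: F_def integral_mult_right_zero) (simp add: mult_ac)
  ultimately show "(\<lambda>k. a k * (LINT \<zeta>|circle_measure. \<zeta> ^ k * c \<zeta>) * (z - 0) ^ k) sums (LINT \<zeta>|circle_measure. H (z * \<zeta>) * c \<zeta>)"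
    by simp
qed

text \<open>
  The tangent inequality for \<open>|w|\<^sup>p\<close> at \<open>H (t \<zeta>)\<close> bounds the mean at radius \<open>r\<close> from below by the real
  part of a holomorphic function of the rotation parameter, to which the maximum principle applies.
\<close>

lemma circle_mean_mono:
  assumes "1 < p" "H holomorphic_on ball 0 1" "0 \<le> t" "t \<le> r" "r < 1"
  shows "circle_mean p H t \<le> circle_mean p H r"
proof -
  have p0: "0 < p" using assms(1) by simp
  have cont: "continuous_on (ball 0 1) H" using assms(2) by (rule holomorphic_on_imp_continuous_on)
  have t1: "t < 1" using assms by simp
  define A where "A \<zeta> = H (of_real t * \<zeta>)" for \<zeta>
  have contA: "continuous_on (sphere 0 1) A"
    unfolding A_def by (rule continuous_on_dilate[OF cont assms(3) t1])
  \<comment> \<open>Up to the factor \<open>p\<close>, the coefficient of the linear term in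
    \<open>norm_powr_tangent\<close> at the point \<open>A \<zeta>\<close>. It is a fixed weight,
    while the argument of \<open>H\<close> varies holomorphically.\<close>
  define c where "c \<zeta> = cnj (A \<zeta>) * of_real (norm (A \<zeta>) powr (p - 2))" for \<zeta>
  have c_norm: "norm (c \<zeta>) = norm (A \<zeta>) powr (p - 1)" for \<zeta>
    by (cases "A \<zeta> = 0") (auto simp: c_def norm_mult powr_mult_base)
  have c_int: "integrable circle_measure c"
  proof (rule Bochner_Integration.integrable_bound)
    show "integrable circle_measure (\<lambda>\<zeta>. norm (A \<zeta>) powr (p - 1))"
      using assms(1) by (intro integrable_circle_continuous continuous_on_norm_powr contA) simp
    have A: "A \<in> borel_measurable circle_measure" by (rule measurable_circle_continuous[OF contA])
    have "cnj \<in> borel_measurable borel"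
      by (intro borel_measurable_continuous_onI continuous_intros)
    from measurable_compose[OF A this] have "(\<lambda>\<zeta>. cnj (A \<zeta>)) \<in> borel_measurable circle_measure" .
    moreover have "(\<lambda>\<zeta>. complex_of_real (norm (A \<zeta>) powr (p - 2))) \<in> borel_measurable circle_measure"
      using A by measurable
    ultimately show "c \<in> borel_measurable circle_measure"
      unfolding c_def by (rule borel_measurable_times)
  qed (auto simp: c_norm)
  define \<Phi> where "\<Phi> z = (LINT \<zeta>|circle_measure. H (z * \<zeta>) * c \<zeta>)" for z
  have hol: "\<Phi> holomorphic_on ball 0 1"
    unfolding \<Phi>_def by (rule holomorphic_circle_average[OF assms(2) c_int])
  have int: "integrable circle_measure (\<lambda>\<zeta>. H (z * \<zeta>) * c \<zeta>)" if "norm z < 1" for z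
    by (rule integrable_circle_cmult[OF c_int], rule continuous_on_compose2[OF cont])
      (use that in \<open>auto intro!: continuous_intros simp: norm_mult\<close>)
  have key: "circle_mean p H t + p * Re (\<Phi> z - \<Phi> (of_real t)) \<le> circle_mean p H r" if z: "norm z = r" for z
  proof -
    obtain \<eta> where \<eta>: "norm \<eta> = 1" "z = of_real r * \<eta>"
    proof (cases "z = 0")
      case True
      then show thesis using that[of 1] z by simp
    next
      case False
      then show thesis using that[of "z / of_real r"] z by (auto simp: norm_divide)
    qed
    have z1: "norm z < 1" using z assms by simp
    have t1': "norm (complex_of_real t) < 1" using assms t1 by simp
    have iA: "integrable circle_measure (\<lambda>\<zeta>. norm (A \<zeta>) powr p)"
      by (intro integrable_circle_continuous continuous_on_norm_powr contA p0)
    have iD: "integrable circle_measure (\<lambda>\<zeta>. H (z * \<zeta>) * c \<zeta> - H (of_real t * \<zeta>) * c \<zeta>)"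
      by (intro Bochner_Integration.integrable_diff int z1 t1')
    have iR: "integrable circle_measure (\<lambda>\<zeta>. p * Re (H (z * \<zeta>) * c \<zeta> - H (of_real t * \<zeta>) * c \<zeta>))"
      by (intro integrable_mult_right integrable_Re iD)
    have "continuous_on (sphere 0 1) (\<lambda>\<zeta>. H (z * \<zeta>))"
      by (rule continuous_on_compose2[OF cont]) (use z1 in \<open>auto intro!: continuous_intros simp: norm_mult\<close>)
    then have iz: "integrable circle_measure (\<lambda>\<zeta>. norm (H (z * \<zeta>)) powr p)"
      by (intro integrable_circle_continuous continuous_on_norm_powr p0)
    have "Re (\<Phi> z - \<Phi> (of_real t)) = (LINT \<zeta>|circle_measure. Re (H (z * \<zeta>) * c \<zeta> - H (of_real t * \<zeta>) * c \<zeta>))"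
      unfolding \<Phi>_def using int[OF z1] int[OF t1'] integral_Re[OF iD]
      by (simp add: Bochner_Integration.integral_diff)
    then have "circle_mean p H t + p * Re (\<Phi> z - \<Phi> (of_real t)) =
        (LINT \<zeta>|circle_measure. norm (A \<zeta>) powr p + p * Re (H (z * \<zeta>) * c \<zeta> - H (of_real t * \<zeta>) * c \<zeta>))"
      by (subst Bochner_Integration.integral_add[OF iA iR]) (simp add: circle_mean_def A_def)
    also have "\<dots> \<le> (LINT \<zeta>|circle_measure. norm (H (z * \<zeta>)) powr p)"
    proof (rule integral_mono[OF Bochner_Integration.integrable_add[OF iA iR] iz])
      fix \<zeta>
      have "cnj (A \<zeta>) * of_real (norm (A \<zeta>) powr (p - 2)) * (H (z * \<zeta>) - A \<zeta>) = H (z * \<zeta>) * c \<zeta> - H (of_real t * \<zeta>) * c \<zeta>"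
        by (simp add: c_def A_def algebra_simps)
      with norm_powr_tangent[OF assms(1), of "A \<zeta>" "H (z * \<zeta>)"]
      show "norm (A \<zeta>) powr p + p * Re (H (z * \<zeta>) * c \<zeta> - H (of_real t * \<zeta>) * c \<zeta>) \<le> norm (H (z * \<zeta>)) powr p"
        by simp
    qed
    also have "\<dots> = circle_mean p H r"
      using circle_mean_rotate[OF cont _ assms(5) p0 \<eta>(1)] assms by (simp add: \<eta>(2))
    finally show ?thesis .
  qed
  show ?thesis
  proof (cases "r = 0")
    case True
    then show ?thesis using assms by simp
  next
    case False
    then have r: "0 < r" using assms by simp
    \<comment> \<open>The bound that \<open>key\<close> gives on the circle of radius
      \<open>r\<close>. The maximum principle carries it to the point \<open>t\<close>, where the
      value of \<open>\<Phi>\<close> cancels and the difference of the means is seen to be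
      nonnegative.\<close>
    define b where "b = Re (\<Phi> (of_real t)) + (circle_mean p H r - circle_mean p H t) / p"
    have "Re (\<Phi> (of_real t)) \<le> b"
    proof (rule maximum_real_frontier[where S="cball 0 r" and f=\<Phi>])
      have sub: "cball 0 r \<subseteq> ball (0::complex) 1" using assms by auto
      show "\<Phi> holomorphic_on interior (cball 0 r)"
        by (rule holomorphic_on_subset[OF hol]) (use sub interior_subset in blast)
      show "continuous_on (closure (cball 0 r)) \<Phi>"
        using continuous_on_subset[OF holomorphic_on_imp_continuous_on[OF hol] sub] by simp
      fix z :: complex assume "z \<in> frontier (cball 0 r)"
      then have "norm z = r" using r by simp
      from key[OF this] have "(Re (\<Phi> z) - Re (\<Phi> (of_real t))) * p \<le> circle_mean p H r - circle_mean p H t"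
        by (simp add: mult.commute)
      then have "Re (\<Phi> z) - Re (\<Phi> (of_real t)) \<le> (circle_mean p H r - circle_mean p H t) / p"
        by (rule pos_le_divide_eq[OF p0, THEN iffD2])
      then show "Re (\<Phi> z) \<le> b" unfolding b_def by linarith
    next
      show "complex_of_real t \<in> cball 0 r" using assms by simp
    qed simp
    then have "0 \<le> (circle_mean p H r - circle_mean p H t) / p" unfolding b_def by linarith
    then show ?thesis using p0 by (simp add: zero_le_divide_iff)
  qed
qed

text \<open>
  The average of \<open>h\<close> and a dilate has almost the same mean as \<open>h\<close>, so uniform convexity forces the
  dilate to be close to \<open>h\<close>.
\<close>

lemma Hp_dilate_approx:
  assumes "1 < p" "h \<in> Hp p" "0 < \<epsilon>"
  obtains s where "0 < s" "s < 1"
    "\<And>r. 0 \<le> r \<Longrightarrow> r < 1 \<Longrightarrow> circle_mean p (\<lambda>z. h z - h (of_real s * z)) r \<le> \<epsilon>"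
proof -
  have p0: "0 < p" using assms(1) by simp
  note hol = HpD(1)[OF assms(2)]
  note cont = HpD(2)[OF assms(2)]
  define m where "m r = circle_mean p h r" for r
  have bdd: "bdd_above (m ` {0..<1})"
    using circle_mean_le_Hp_norm[OF assms(2) p0] by (auto simp: m_def intro!: bdd_aboveI2[where M="Hp_norm p h powr p"])
  define M where "M = (SUP r\<in>{0..<1}. m r)"
  have m_le: "m r \<le> M" if "0 \<le> r" "r < 1" for r
    unfolding M_def by (rule cSUP_upper[OF _ bdd]) (use that in simp)
  have M0: "0 \<le> M"
    using m_le[of 0] circle_mean_nonneg[of p h 0] by (simp add: m_def)
  \<comment> \<open>Chosen so that \<open>2 * \<eta> * M \<le> \<epsilon> / 2\<close>; the added 1
    guards against \<open>M = 0\<close>. Likewise \<open>\<delta>\<close> below gives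
    \<open>C * \<delta> \<le> \<epsilon> / 4\<close>.\<close>
  define \<eta> where "\<eta> = \<epsilon> / (4 * (M + 1))"
  have \<eta>: "0 < \<eta>" using assms(3) M0 by (simp add: \<eta>_def)
  obtain C where C0: "0 \<le> C" and C: "\<And>a b :: complex. norm (a - b) powr p \<le> \<eta> * (norm a powr p + norm b powr p)
      + C * ((norm a powr p + norm b powr p) / 2 - norm ((a + b) / 2) powr p)"
    using uniform_convexity_pointwise[OF assms(1) \<eta>] by blast
  define \<delta> where "\<delta> = \<epsilon> / (4 * (C + 1))"
  have \<delta>: "0 < \<delta>" using assms(3) C0 by (simp add: \<delta>_def)
  \<comment> \<open>A radius at which the mean is almost the supremum. It is fixed before the
    dilation: on a smaller closed disc \<open>h\<close> is bounded, and its averages with the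
    dilates converge there.\<close>
  obtain r1 where r1: "0 \<le> r1" "r1 < 1" "M - \<delta> < m r1"
    using less_cSUP_iff[OF _ bdd, of "M - \<delta>"] \<delta> by (auto simp: M_def)
  define \<Sigma> where "\<Sigma> s z = (h z + h (of_real s * z)) / 2" for s z
  define \<Delta> where "\<Delta> s z = h z - h (of_real s * z)" for s z
  have hol_dil: "(\<lambda>z. h (of_real s * z)) holomorphic_on ball 0 1" if "0 \<le> s" "s < 1" for s
  proof -
    have "(h \<circ> (\<lambda>z. of_real s * z)) holomorphic_on ball 0 1"
    proof (rule holomorphic_on_compose_gen[OF _ hol])
      show "(\<lambda>z. complex_of_real s * z) ` ball 0 1 \<subseteq> ball 0 1"
      proof clarsimp
        fix z :: complex assume "norm z < 1"
        then have "s * norm z < 1" using that mult_le_one[of s "norm z"]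
          by (smt (verit) mult_left_le_one_le norm_ge_zero)
        then show "norm (complex_of_real s * z) < 1" using that by (simp add: norm_mult)
      qed
    qed (intro holomorphic_intros)
    then show ?thesis by (simp add: o_def)
  qed
  have hol\<Sigma>: "\<Sigma> s holomorphic_on ball 0 1" if "0 \<le> s" "s < 1" for s
    unfolding \<Sigma>_def by (intro holomorphic_intros hol hol_dil that) simp
  have hol\<Delta>: "\<Delta> s holomorphic_on ball 0 1" if "0 \<le> s" "s < 1" for s
    unfolding \<Delta>_def by (intro holomorphic_intros hol hol_dil that)
  have "(\<lambda>n. circle_mean p (\<Sigma> (radius_seq n)) r1) \<longlonglongrightarrow> m r1"
  proof -
    have "compact (h ` cball 0 r1)"
      by (rule compact_continuous_image[OF continuous_on_subset[OF cont]]) (use r1 in auto)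
    then obtain B where "\<forall>y\<in>h ` cball 0 r1. norm y \<le> B"
      using compact_imp_bounded bounded_iff by blast
    then have B: "norm (h z) \<le> B" if "norm z \<le> r1" for z using that by simp
    have lt: "norm (complex_of_real r1 * \<zeta>) \<le> r1" "norm (complex_of_real (radius_seq n) * (complex_of_real r1 * \<zeta>)) \<le> r1"
      if "norm \<zeta> = 1" for \<zeta> n
      using that r1 radius_seq_bounds[of n] by (auto simp: norm_mult mult_left_le_one_le)
    show ?thesis
      unfolding m_def circle_mean_def
    proof (rule integral_dominated_convergence[where w="\<lambda>_. B powr p"])
      show "(\<lambda>\<zeta>. norm (h (of_real r1 * \<zeta>)) powr p) \<in> borel_measurable circle_measure"
        by (rule borel_measurable_integrable[OF integrable_circle_mean[OF cont r1(1,2) p0]])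
      show "(\<lambda>\<zeta>. norm (\<Sigma> (radius_seq n) (of_real r1 * \<zeta>)) powr p) \<in> borel_measurable circle_measure" for n
        by (rule borel_measurable_integrable[OF integrable_circle_mean[OF _ r1(1,2) p0]])
          (use radius_seq_bounds[of n] in \<open>auto intro!: holomorphic_on_imp_continuous_on hol\<Sigma>\<close>)
      show "AE \<zeta> in circle_measure. (\<lambda>n. norm (\<Sigma> (radius_seq n) (of_real r1 * \<zeta>)) powr p) \<longlonglongrightarrow> norm (h (of_real r1 * \<zeta>)) powr p"
      proof (rule AE_circleI)
        fix \<zeta> :: complex assume z: "norm \<zeta> = 1"
        have "isCont h (of_real r1 * \<zeta>)"
          using cont lt(1)[OF z] r1(2) by (simp add: continuous_on_eq_continuous_at)
        then have "(\<lambda>n. h (of_real (radius_seq n) * (of_real r1 * \<zeta>))) \<longlonglongrightarrow> h (of_real r1 * \<zeta>)"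
          by (rule isCont_tendsto_compose) (rule radius_seq_mult_tendsto)
        then have "(\<lambda>n. \<Sigma> (radius_seq n) (of_real r1 * \<zeta>)) \<longlonglongrightarrow> (h (of_real r1 * \<zeta>) + h (of_real r1 * \<zeta>)) / 2"
          unfolding \<Sigma>_def by (intro tendsto_intros) auto
        then have "(\<lambda>n. \<Sigma> (radius_seq n) (of_real r1 * \<zeta>)) \<longlonglongrightarrow> h (of_real r1 * \<zeta>)" by simp
        then show "(\<lambda>n. norm (\<Sigma> (radius_seq n) (of_real r1 * \<zeta>)) powr p) \<longlonglongrightarrow> norm (h (of_real r1 * \<zeta>)) powr p"
          by (intro tendsto_powr' tendsto_norm tendsto_const) (use p0 in auto)
      qed
      show "AE \<zeta> in circle_measure. norm (norm (\<Sigma> (radius_seq n) (of_real r1 * \<zeta>)) powr p) \<le> B powr p" for n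
      proof (rule AE_circleI)
        fix \<zeta> :: complex assume z: "norm \<zeta> = 1"
        have "norm (\<Sigma> (radius_seq n) (of_real r1 * \<zeta>)) \<le> B"
          using norm_triangle_ineq[of "h (of_real r1 * \<zeta>)" "h (of_real (radius_seq n) * (of_real r1 * \<zeta>))"]
            B[OF lt(1)[OF z]] B[OF lt(2)[OF z, of n]] by (simp add: \<Sigma>_def norm_divide)
        then show "norm (norm (\<Sigma> (radius_seq n) (of_real r1 * \<zeta>)) powr p) \<le> B powr p"
          using p0 by (simp add: powr_mono2)
      qed
    qed simp
  qed
  then have "eventually (\<lambda>n. M - \<delta> < circle_mean p (\<Sigma> (radius_seq n)) r1) sequentially"
    using r1(3) by (rule order_tendstoD(1))
  then obtain n where n: "M - \<delta> < circle_mean p (\<Sigma> (radius_seq n)) r1"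
    by (auto simp: eventually_sequentially)
  define s where "s = radius_seq n"
  have s: "0 < s" "s < 1" using radius_seq_bounds by (auto simp: s_def)
  \<comment> \<open>Monotonicity applied to the average carries its lower bound from
    \<open>r1\<close> to all larger radii, so the integrated convexity gap is at most
    \<open>\<delta>\<close>.\<close>
  have large: "circle_mean p (\<Delta> s) r \<le> \<epsilon>" if r: "r1 \<le> r" "r < 1" for r
  proof -
    have r0: "0 \<le> r" using r r1 by simp
    have sr: "0 \<le> s * r" "s * r < 1"
      using s r0 r(2) mult_left_le_one_le[of r s] by auto
    have ih: "integrable circle_measure (\<lambda>\<zeta>. norm (h (of_real r * \<zeta>)) powr p)"
      by (rule integrable_circle_mean[OF cont r0 r(2) p0])
    have ihs: "integrable circle_measure (\<lambda>\<zeta>. norm (h (of_real s * (of_real r * \<zeta>))) powr p)"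
      using integrable_circle_mean[OF cont sr p0] by (simp add: mult.assoc)
    have i\<Sigma>: "integrable circle_measure (\<lambda>\<zeta>. norm (\<Sigma> s (of_real r * \<zeta>)) powr p)"
      using s by (intro integrable_circle_mean r0 r(2) p0 holomorphic_on_imp_continuous_on hol\<Sigma>) auto
    have i\<Delta>: "integrable circle_measure (\<lambda>\<zeta>. norm (\<Delta> s (of_real r * \<zeta>)) powr p)"
      using s by (intro integrable_circle_mean r0 r(2) p0 holomorphic_on_imp_continuous_on hol\<Delta>) auto
    have "circle_mean p (\<Delta> s) r \<le> (LINT \<zeta>|circle_measure.
        \<eta> * (norm (h (of_real r * \<zeta>)) powr p + norm (h (of_real s * (of_real r * \<zeta>))) powr p)
        + C * ((norm (h (of_real r * \<zeta>)) powr p + norm (h (of_real s * (of_real r * \<zeta>))) powr p) / 2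
          - norm (\<Sigma> s (of_real r * \<zeta>)) powr p))"
      unfolding circle_mean_def
    proof (rule integral_mono[OF i\<Delta>])
      fix \<zeta>
      show "norm (\<Delta> s (of_real r * \<zeta>)) powr p \<le>
        \<eta> * (norm (h (of_real r * \<zeta>)) powr p + norm (h (of_real s * (of_real r * \<zeta>))) powr p)
        + C * ((norm (h (of_real r * \<zeta>)) powr p + norm (h (of_real s * (of_real r * \<zeta>))) powr p) / 2
          - norm (\<Sigma> s (of_real r * \<zeta>)) powr p)"
        unfolding \<Delta>_def \<Sigma>_def by (rule C)
    qed (intro Bochner_Integration.integrable_add integrable_mult_right Bochner_Integration.integrable_diff integrable_divide ih ihs i\<Sigma>)
    also have "\<dots> = \<eta> * (m r + m (s * r)) + C * ((m r + m (s * r)) / 2 - circle_mean p (\<Sigma> s) r)"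
      using ih ihs i\<Sigma> by (simp add: circle_mean_def m_def mult.assoc Bochner_Integration.integral_add Bochner_Integration.integral_diff)
    also have "\<dots> \<le> \<eta> * (M + M) + C * ((M + M) / 2 - (M - \<delta>))"
    proof (intro add_mono mult_left_mono diff_mono divide_right_mono m_le r0 r sr)
      have "circle_mean p (\<Sigma> s) r1 \<le> circle_mean p (\<Sigma> s) r"
        using s by (intro circle_mean_mono[OF assms(1)] hol\<Sigma> r1 r) auto
      then show "M - \<delta> \<le> circle_mean p (\<Sigma> s) r" using n by (simp add: s_def)
    qed (use \<eta> C0 in auto)
    also have "\<dots> = 2 * (\<eta> * M) + C * \<delta>" by (simp add: algebra_simps)
    also have "\<dots> \<le> \<epsilon> / 2 + \<epsilon> / 4"
    proof (rule add_mono)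
      have "\<epsilon> / (4 * (y + 1)) * y \<le> \<epsilon> / 4" if "0 \<le> y" for y
        using that assms(3) by (simp add: divide_simps)
      from this[OF M0] this[OF C0] show "2 * (\<eta> * M) \<le> \<epsilon> / 2" "C * \<delta> \<le> \<epsilon> / 4"
        by (simp_all add: \<eta>_def \<delta>_def mult.commute)
    qed
    also have "\<dots> \<le> \<epsilon>" using assms(3) by simp
    finally show ?thesis .
  qed
  \<comment> \<open>Below \<open>r1\<close>, monotonicity is applied to the difference
    itself.\<close>
  have "circle_mean p (\<Delta> s) r \<le> \<epsilon>" if r: "0 \<le> r" "r < 1" for r
  proof -
    have "circle_mean p (\<Delta> s) r \<le> circle_mean p (\<Delta> s) (max r r1)"
      using s r r1 by (intro circle_mean_mono[OF assms(1)] hol\<Delta>) auto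
    also have "\<dots> \<le> \<epsilon>" using r r1 by (intro large) auto
    finally show ?thesis .
  qed
  with s show thesis unfolding \<Delta>_def by (rule that)
qed

text \<open>A dilate close to \<open>h\<close> in mean extends past the closed disc, so its Taylor
  polynomials converge uniformly. Each of the two errors gets \<open>\<epsilon>'\<close>, and the
  quasi-triangle inequality costs \<open>2 powr p\<close>.\<close>

lemma Hp_poly_approx:
  assumes "1 < p" "h \<in> Hp p" "0 < \<epsilon>"
  obtains q where "\<And>r. 0 \<le> r \<Longrightarrow> r < 1 \<Longrightarrow> circle_mean p (\<lambda>z. h z - poly q z) r \<le> \<epsilon>"
proof -
  have p0: "0 < p" using assms(1) by simp
  note cont = HpD(2)[OF assms(2)]
  define \<epsilon>' where "\<epsilon>' = \<epsilon> / (2 * 2 powr p)"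
  have \<epsilon>': "0 < \<epsilon>'" using assms(3) by (simp add: \<epsilon>'_def)
  obtain s where s: "0 < s" "s < 1"
    "\<And>r. 0 \<le> r \<Longrightarrow> r < 1 \<Longrightarrow> circle_mean p (\<lambda>z. h z - h (of_real s * z)) r \<le> \<epsilon>'"
    using Hp_dilate_approx[OF assms(1,2) \<epsilon>'] by blast
  define a where "a k = (deriv ^^ k) h 0 / fact k" for k
  have sums: "(\<lambda>k. a k * w ^ k) sums h w" if "norm w < 1" for w
    using holomorphic_power_series[OF HpD(1)[OF assms(2)], of w] that by (simp add: a_def)
  define c where "c k = a k * of_real s ^ k" for k
  have "summable (\<lambda>k. a k * complex_of_real ((1 + s) / 2) ^ k)"
    using sums[of "of_real ((1 + s) / 2)"] s by (simp only: norm_of_real sums_iff) auto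
  then have c: "summable (\<lambda>k. norm (c k))"
    unfolding c_def by (rule powser_insidea) (use s in \<open>simp only: norm_of_real, simp\<close>)
  obtain N where N: "\<And>n. n \<ge> N \<Longrightarrow> norm (\<Sum>i. norm (c (i + n))) < \<epsilon>' powr (1 / p)"
    using suminf_exist_split[OF _ c, of "\<epsilon>' powr (1 / p)"] \<epsilon>' by auto
  define q where "q = (\<Sum>k<N. monom (c k) k)"
  have close: "norm (h (of_real s * z) - poly q z) \<le> \<epsilon>' powr (1 / p)" if z: "norm z < 1" for z
  proof -
    have "norm (complex_of_real s * z) < 1"
      using s z by (simp add: norm_mult) (smt (verit) mult_left_le_one_le norm_ge_zero)
    from sums[OF this] have 1: "(\<lambda>k. c k * z ^ k) sums h (of_real s * z)"
      by (simp add: c_def power_mult_distrib mult.assoc)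
    then have "(\<lambda>k. c (k + N) * z ^ (k + N)) sums (h (of_real s * z) - (\<Sum>k<N. c k * z ^ k))"
      by (rule sums_split_initial_segment)
    then have tail: "h (of_real s * z) - poly q z = (\<Sum>k. c (k + N) * z ^ (k + N))"
      by (simp add: q_def poly_sum poly_monom sums_iff)
    have le: "norm (c (k + N) * z ^ (k + N)) \<le> norm (c (k + N))" for k
      using z power_le_one[of "norm z" "k + N"] by (simp add: norm_mult norm_power mult_left_le)
    have sc: "summable (\<lambda>k. norm (c (k + N)))" by (rule summable_ignore_initial_segment[OF c])
    have sz: "summable (\<lambda>k. norm (c (k + N) * z ^ (k + N)))"
      by (rule summable_comparison_test'[OF sc]) (use le in simp)
    have "norm (\<Sum>k. c (k + N) * z ^ (k + N)) \<le> (\<Sum>k. norm (c (k + N) * z ^ (k + N)))"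
      by (rule summable_norm[OF sz])
    also have "\<dots> \<le> (\<Sum>k. norm (c (k + N)))"
      by (rule suminf_le[OF le sz sc])
    also have "\<dots> \<le> \<epsilon>' powr (1 / p)" using N[of N] by simp
    finally show ?thesis by (simp add: tail)
  qed
  have cont_s: "continuous_on (ball 0 1) (\<lambda>z. h (of_real s * z))"
  proof (rule continuous_on_compose2[OF cont])
    show "(\<lambda>z. complex_of_real s * z) ` ball 0 1 \<subseteq> ball 0 1"
      using s by (auto simp: norm_mult) (smt (verit) mult_left_le_one_le norm_ge_zero)
  qed (intro continuous_intros)
  have "circle_mean p (\<lambda>z. h z - poly q z) r \<le> \<epsilon>" if r: "0 \<le> r" "r < 1" for r
  proof -
    have "circle_mean p (\<lambda>z. h z - poly q z) r = circle_mean p (\<lambda>z. (h z - h (of_real s * z)) + (h (of_real s * z) - poly q z)) r"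
      by simp
    also have "\<dots> \<le> 2 powr p * (circle_mean p (\<lambda>z. h z - h (of_real s * z)) r + circle_mean p (\<lambda>z. h (of_real s * z) - poly q z) r)"
      by (rule circle_mean_add_le[OF _ _ r p0]) (intro continuous_intros cont cont_s)+
    also have "\<dots> \<le> 2 powr p * (\<epsilon>' + (\<epsilon>' powr (1 / p)) powr p)"
    proof (intro mult_left_mono add_mono s(3) r)
      show "circle_mean p (\<lambda>z. h (of_real s * z) - poly q z) r \<le> (\<epsilon>' powr (1 / p)) powr p"
        by (rule circle_mean_le_bound[OF _ r p0 close]) (intro continuous_intros cont_s)+
    qed simp
    also have "\<dots> = \<epsilon>" using \<epsilon>' p0 by (simp add: powr_powr) (simp add: \<epsilon>'_def)
    finally show ?thesis .
  qed
  then show thesis by (rule that)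
qed

section \<open>Approximation by multiples of a polynomial with roots on the circle\<close>

lemma poly_bounded_disc:
  fixes q :: "complex poly"
  obtains B where "0 < B" "\<And>z. norm z < 1 \<Longrightarrow> norm (poly q z) \<le> B"
proof -
  obtain B where "\<And>z. norm z < 1 \<Longrightarrow> norm (poly q z) \<le> B"
    using poly_quotient_regular(3)[of 1 q] by auto
  then show thesis
    by (intro that[of "max 1 B"]) (auto simp: le_max_iff_disj)
qed

text \<open>Expanding the squared modulus as \<open>w * cnj w\<close>, with
  \<open>cnj \<zeta> = inverse \<zeta>\<close> on the circle, leaves integrals of integer powers, of
  which only the diagonal ones survive.\<close>

lemma circle_parseval_poly:
  fixes \<alpha> :: "nat \<Rightarrow> complex"
  shows "(LINT \<zeta>|circle_measure. (norm (\<Sum>j<N. \<alpha> j * \<zeta> ^ j))\<^sup>2) = (\<Sum>j<N. (norm (\<alpha> j))\<^sup>2)"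
proof -
  have "complex_of_real (LINT \<zeta>|circle_measure. (norm (\<Sum>j<N. \<alpha> j * \<zeta> ^ j))\<^sup>2)
      = (LINT \<zeta>|circle_measure. complex_of_real ((norm (\<Sum>j<N. \<alpha> j * \<zeta> ^ j))\<^sup>2))"
    by (rule integral_complex_of_real[symmetric])
  also have "\<dots> = (LINT \<zeta>|circle_measure. (\<Sum>j<N. \<Sum>k<N. \<alpha> j * cnj (\<alpha> k) * \<zeta> powi (int j - int k)))"
  proof (rule circle_integral_cong)
    fix \<zeta> :: complex assume z: "norm \<zeta> = 1"
    then have "\<zeta> \<noteq> 0" by auto
    have "cnj \<zeta> = inverse \<zeta>"
      using z by (simp add: inverse_complex_def complex_eq_iff cmod_def)
    then have "\<zeta> ^ j * cnj \<zeta> ^ k = \<zeta> powi (int j - int k)" for j k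
      using \<open>\<zeta> \<noteq> 0\<close> by (simp add: power_int_diff power_inverse divide_inverse)
    then have "\<alpha> j * cnj (\<alpha> k) * \<zeta> powi (int j - int k) = (\<alpha> j * \<zeta> ^ j) * cnj (\<alpha> k * \<zeta> ^ k)" for j k
      by (metis (no_types, lifting) complex_cnj_mult complex_cnj_power mult.assoc mult.left_commute)
    then show "complex_of_real ((norm (\<Sum>j<N. \<alpha> j * \<zeta> ^ j))\<^sup>2) = (\<Sum>j<N. \<Sum>k<N. \<alpha> j * cnj (\<alpha> k) * \<zeta> powi (int j - int k))"
      by (simp only: complex_norm_square cnj_sum sum_product)
  qed
  also have "\<dots> = (\<Sum>j<N. \<Sum>k<N. LINT \<zeta>|circle_measure. \<alpha> j * cnj (\<alpha> k) * \<zeta> powi (int j - int k))"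
    by (subst Bochner_Integration.integral_sum; (subst Bochner_Integration.integral_sum)?)
      (auto intro!: integrable_circle_continuous continuous_intros sum.cong)
  also have "\<dots> = (\<Sum>j<N. \<Sum>k<N. if k = j then \<alpha> j * cnj (\<alpha> k) else 0)"
    by (intro sum.cong refl) (simp add: circle_integral_powi)
  also have "\<dots> = (\<Sum>j<N. \<alpha> j * cnj (\<alpha> j))"
    by (intro sum.cong refl) simp
  also have "\<dots> = complex_of_real (\<Sum>j<N. (norm (\<alpha> j))\<^sup>2)"
    by (simp only: of_real_sum complex_norm_square)
  finally show ?thesis by (simp only: of_real_eq_iff)
qed

text \<open>
  Cesaro means of the powers of \<open>z / a\<close> equal \<open>1\<close> at \<open>a\<close> and have small square mean; hence the
  constant \<open>1\<close> is approximated by multiples of \<open>z - a\<close>.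
\<close>

lemma small_poly_with_value_one:
  fixes a :: complex
  assumes "0 < p" "norm a = 1" "0 < \<epsilon>"
  obtains q where "poly q a = 1" "\<And>r. 0 \<le> r \<Longrightarrow> r < 1 \<Longrightarrow> circle_mean p (poly q) r \<le> \<epsilon>"
proof -
  define \<delta> where "\<delta> = (\<epsilon> / 2) powr (1 / p)"
  have \<delta>: "0 < \<delta>" "\<delta> powr p = \<epsilon> / 2" using assms by (auto simp: \<delta>_def powr_powr)
  \<comment> \<open>Makes the contribution \<open>1 / real N / \<delta>\<^sup>2\<close> of the
    square mean at most \<open>\<epsilon> / 2\<close>.\<close>
  obtain N :: nat where N: "N > 2 / (\<epsilon> * \<delta>\<^sup>2)" using reals_Archimedean2 by blast
  have "0 < 2 / (\<epsilon> * \<delta>\<^sup>2)" using assms \<delta> by simp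
  then have N0: "0 < real N" using N by linarith
  define q where "q = smult (1 / of_nat N) (\<Sum>j<N. monom (inverse a ^ j) j)"
  have a0: "a \<noteq> 0" using assms(2) by auto
  have q_eq: "poly q z = (\<Sum>j<N. inverse a ^ j / of_nat N * z ^ j)" for z
    by (simp add: q_def poly_sum poly_monom sum_distrib_left)
  have qa: "poly q a = 1"
    unfolding q_eq using a0 N0 by (simp add: power_inverse)
  have le1: "norm (poly q z) \<le> 1" if z: "norm z < 1" for z
  proof -
    have "norm (poly q z) \<le> (\<Sum>j<N. norm (inverse a ^ j / of_nat N * z ^ j))"
      unfolding q_eq by (rule norm_sum)
    also have "\<dots> \<le> (\<Sum>j<N. 1 / real N)"
      using z assms(2) by (intro sum_mono) (auto simp: norm_mult norm_divide norm_power norm_inverse power_le_one divide_right_mono)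
    finally show ?thesis using N0 by simp
  qed
  have "circle_mean p (poly q) r \<le> \<epsilon>" if r: "0 \<le> r" "r < 1" for r
  proof -
    have cont: "continuous_on (ball 0 1) (poly q)" by (intro continuous_intros)
    have cont': "continuous_on (sphere 0 1) (\<lambda>\<zeta>. (norm (poly q (of_real r * \<zeta>)))\<^sup>2)"
      by (intro continuous_intros)
    \<comment> \<open>A comparison of Chebyshev type that trades the exponent \<open>p\<close> for
      2: up to \<open>\<delta>\<close> the power is at most
      \<open>\<delta> powr p = \<epsilon> / 2\<close>, beyond it
      \<open>x powr p \<le> 1 \<le> x\<^sup>2 / \<delta>\<^sup>2\<close>.\<close>
    have bound: "x powr p \<le> \<delta> powr p + x\<^sup>2 / \<delta>\<^sup>2" if x: "0 \<le> x" "x \<le> 1" for x :: real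
    proof (cases "x \<le> \<delta>")
      case True
      then have "x powr p \<le> \<delta> powr p" using x assms(1) by (intro powr_mono2) auto
      then show ?thesis by (smt (verit) zero_le_divide_iff zero_le_power2)
    next
      case False
      then have "1 \<le> x\<^sup>2 / \<delta>\<^sup>2" using \<delta>(1) by (simp add: power_mono)
      moreover have "x powr p \<le> 1" using powr_mono2[of p x 1] x assms(1) by simp
      ultimately show ?thesis using powr_ge_zero[of \<delta> p] by linarith
    qed
    have "circle_mean p (poly q) r \<le> (LINT \<zeta>|circle_measure. \<delta> powr p + (norm (poly q (of_real r * \<zeta>)))\<^sup>2 / \<delta>\<^sup>2)"
      unfolding circle_mean_def
    proof (rule integral_mono_AE[OF integrable_circle_mean[OF cont r assms(1)]])
      show "integrable circle_measure (\<lambda>\<zeta>. \<delta> powr p + (norm (poly q (of_real r * \<zeta>)))\<^sup>2 / \<delta>\<^sup>2)"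
        using \<delta>(1) by (intro integrable_circle_continuous continuous_intros) auto
      show "AE \<zeta> in circle_measure. norm (poly q (of_real r * \<zeta>)) powr p \<le> \<delta> powr p + (norm (poly q (of_real r * \<zeta>)))\<^sup>2 / \<delta>\<^sup>2"
        by (rule AE_circleI, rule bound) (use r in \<open>auto intro!: le1 of_real_mult_in_ball\<close>)
    qed
    also have "\<dots> = \<delta> powr p + (LINT \<zeta>|circle_measure. (norm (poly q (of_real r * \<zeta>)))\<^sup>2) / \<delta>\<^sup>2"
      using integrable_circle_continuous[OF cont'] by (simp add: Bochner_Integration.integral_add circle.prob_space[simplified])
    also have "(LINT \<zeta>|circle_measure. (norm (poly q (of_real r * \<zeta>)))\<^sup>2) = (\<Sum>j<N. (norm (inverse a ^ j / of_nat N * of_real r ^ j))\<^sup>2)"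
      unfolding q_eq circle_parseval_poly[symmetric] by (simp add: power_mult_distrib mult.assoc)
    also have "\<dots> \<le> (\<Sum>j<N. (1 / real N)\<^sup>2)"
      using r assms(2) by (intro sum_mono power_mono) (auto simp: norm_mult norm_divide norm_power norm_inverse power_le_one divide_right_mono)
    also have "\<dots> = 1 / real N" using N0 by (simp add: power2_eq_square)
    finally have "circle_mean p (poly q) r \<le> \<delta> powr p + 1 / real N / \<delta>\<^sup>2"
      by (simp add: divide_right_mono)
    also have "1 / real N / \<delta>\<^sup>2 \<le> \<epsilon> / 2"
    proof -
      have "2 < real N * (\<epsilon> * \<delta>\<^sup>2)"
        using N assms(3) \<delta>(1) by (simp add: pos_divide_less_eq)
      then show ?thesis using N0 \<delta>(1) by (simp add: divide_simps mult_ac)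
    qed
    finally show ?thesis using \<delta>(2) by simp
  qed
  with qa show thesis by (rule that)
qed

text \<open>Roots are removed one at a time. If \<open>m' * w\<close> is close to \<open>e\<close>
  and \<open>q\<close> is small in mean with value 1 at \<open>a\<close>, then \<open>1 - q\<close>
  is \<open>z - a\<close> times some \<open>v\<close>, and
  \<open>m * (w * v) = m' * w * (1 - q)\<close>. The additional error \<open>m' * w * q\<close> is
  small because \<open>m' * w\<close> is bounded on the disc.\<close>

lemma poly_multiples_dense:
  fixes m e :: "complex poly"
  assumes "0 < p" "m \<noteq> 0" "\<And>a. poly m a = 0 \<Longrightarrow> norm a = 1" "0 < \<epsilon>"
  shows "\<exists>w. \<forall>r. 0 \<le> r \<and> r < 1 \<longrightarrow> circle_mean p (poly (e - m * w)) r \<le> \<epsilon>"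
  using assms(2-4)
proof (induction "degree m" arbitrary: m \<epsilon>)
  case 0
  then have "m dvd e" by (simp add: is_unit_iff_degree unit_imp_dvd)
  then obtain w where "e = m * w" by (auto simp: dvd_def)
  then show ?case using 0 assms(1) by (intro exI[of _ w]) (simp add: circle_mean_def)
next
  case (Suc k)
  have "\<not> constant (poly m)" using Suc.hyps(2) by (simp add: constant_degree)
  then obtain a where a: "poly m a = 0"
    using Fundamental_Theorem_Algebra.fundamental_theorem_of_algebra by auto
  then obtain m' where m': "m = [:- a, 1:] * m'" by (auto simp: poly_eq_0_iff_dvd)
  have m'0: "m' \<noteq> 0" using Suc.prems(1) m' by auto
  have deg: "k = degree m'"
    using Suc.hyps(2) m'0 unfolding m' by (subst (asm) degree_mult_eq) auto
  define \<epsilon>' where "\<epsilon>' = \<epsilon> / (2 * 2 powr p)"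
  have \<epsilon>': "0 < \<epsilon>'" using Suc.prems(3) by (simp add: \<epsilon>'_def)
  have "\<And>b. poly m' b = 0 \<Longrightarrow> norm b = 1" using Suc.prems(2) by (simp add: m')
  from Suc.hyps(1)[OF deg m'0 this \<epsilon>'] obtain w where
    w: "\<And>r. 0 \<le> r \<Longrightarrow> r < 1 \<Longrightarrow> circle_mean p (poly (e - m' * w)) r \<le> \<epsilon>'" by blast
  obtain B where B: "0 < B" "\<And>z. norm z < 1 \<Longrightarrow> norm (poly (m' * w) z) \<le> B"
    using poly_bounded_disc[of "m' * w"] by blast
  have "0 < \<epsilon>' / B powr p" using \<epsilon>' B(1) by simp
  from small_poly_with_value_one[OF assms(1) Suc.prems(2)[OF a] this] obtain q where
    q: "poly q a = 1" "\<And>r. 0 \<le> r \<Longrightarrow> r < 1 \<Longrightarrow> circle_mean p (poly q) r \<le> \<epsilon>' / B powr p" by blast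
  have "poly (1 - q) a = 0" using q(1) by simp
  then have "[:- a, 1:] dvd 1 - q" by (simp only: poly_eq_0_iff_dvd)
  then obtain v where v: "1 - q = [:- a, 1:] * v" by (rule dvdE)
  have eq: "e - m * (w * v) = (e - m' * w) + (m' * w) * q"
  proof -
    have "m * (w * v) = (m' * w) * ([:- a, 1:] * v)" unfolding m' by (simp only: mult_ac)
    also have "\<dots> = (m' * w) * (1 - q)" by (simp only: v)
    finally show ?thesis by (simp add: algebra_simps)
  qed
  have "circle_mean p (poly (e - m * (w * v))) r \<le> \<epsilon>" if r: "0 \<le> r" "r < 1" for r
  proof -
    have "circle_mean p (poly (e - m * (w * v))) r = circle_mean p (\<lambda>z. poly (e - m' * w) z + poly (m' * w) z * poly q z) r"
      unfolding eq by (simp add: circle_mean_def)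
    also have "\<dots> \<le> 2 powr p * (circle_mean p (poly (e - m' * w)) r + circle_mean p (\<lambda>z. poly (m' * w) z * poly q z) r)"
      by (rule circle_mean_add_le[OF _ _ r assms(1)]) (intro continuous_intros)+
    also have "\<dots> \<le> 2 powr p * (\<epsilon>' + B powr p * (\<epsilon>' / B powr p))"
    proof (intro mult_left_mono add_mono w r)
      have "circle_mean p (\<lambda>z. poly (m' * w) z * poly q z) r \<le> B powr p * circle_mean p (poly q) r"
        by (rule circle_mean_mult_le[OF _ _ r assms(1) B(2)]) (intro continuous_intros)+
      also have "\<dots> \<le> B powr p * (\<epsilon>' / B powr p)"
        by (intro mult_left_mono q(2) r) simp
      finally show "circle_mean p (\<lambda>z. poly (m' * w) z * poly q z) r \<le> B powr p * (\<epsilon>' / B powr p)" .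
    qed simp
    also have "\<dots> = \<epsilon>" using B(1) by (simp add: \<epsilon>'_def)
    finally show ?thesis .
  qed
  then show ?case by blast
qed

section \<open>Kernel and range\<close>

text \<open>The leading coefficient goes into the outer factor, which keeps the other two monic;
  their degrees match the sums in \<open>zeroes_count\<close> and
  \<open>poles_count\<close>.\<close>

lemma poly_disc_factorization:
  fixes q :: "complex poly"
  assumes "q \<noteq> 0"
  obtains qin qT qout where "q = qout * (qin * qT)" "lead_coeff qin = 1" "lead_coeff qT = 1"
    "\<And>a. poly qin a = 0 \<Longrightarrow> norm a < 1" "\<And>a. poly qT a = 0 \<Longrightarrow> norm a = 1"
    "\<And>a. poly qout a = 0 \<Longrightarrow> norm a > 1"
    "degree qin = (\<Sum>a\<in>{a\<in>ball 0 1. poly q a = 0}. order a q)"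
    "degree (qin * qT) = (\<Sum>a\<in>{a\<in>cball 0 1. poly q a = 0}. order a q)"
proof (rule that)
  have cb: "cball (0::complex) 1 = ball 0 1 \<union> sphere 0 1" by auto
  have split: "root_part q (cball 0 1) = root_part q (ball 0 1) * root_part q (sphere 0 1)"
    unfolding cb by (rule root_part_Un[OF assms]) auto
  have "q = smult (lead_coeff q) (root_part q (cball 0 1) * root_part q (- cball 0 1))"
    by (rule root_part_decompose[OF assms])
  then show "q = smult (lead_coeff q) (root_part q (- cball 0 1)) * (root_part q (ball 0 1) * root_part q (sphere 0 1))"
    unfolding split[symmetric] mult_smult_left by (simp only: mult.commute)
  show "lead_coeff (root_part q (ball 0 1)) = 1" "lead_coeff (root_part q (sphere 0 1)) = 1"
    by (rule monic_root_part)+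
  show "norm a < 1" if "poly (root_part q (ball 0 1)) a = 0" for a
    using that by (simp add: poly_root_part_eq_0_iff[OF assms])
  show "norm a = 1" if "poly (root_part q (sphere 0 1)) a = 0" for a
    using that by (simp add: poly_root_part_eq_0_iff[OF assms])
  show "norm a > 1" if "poly (smult (lead_coeff q) (root_part q (- cball 0 1))) a = 0" for a
    using that assms by (simp add: poly_root_part_eq_0_iff[OF assms])
  show "degree (root_part q (ball 0 1)) = (\<Sum>a\<in>{a\<in>ball 0 1. poly q a = 0}. order a q)"
    by (rule degree_root_part)
  show "degree (root_part q (ball 0 1) * root_part q (sphere 0 1)) = (\<Sum>a\<in>{a\<in>cball 0 1. poly q a = 0}. order a q)"
    unfolding split[symmetric] by (rule degree_root_part)
qed

text \<open>\<open>G\<close> vanishes away from the finitely many roots of \<open>m\<close>, hence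
  by continuity everywhere on the disc.\<close>

lemma disc_cancel_poly:
  fixes G :: "complex \<Rightarrow> complex"
  assumes "m \<noteq> 0" "continuous_on (ball 0 1) G" "\<And>z. norm z < 1 \<Longrightarrow> poly m z * G z = 0" "norm z < 1"
  shows "G z = 0"
proof -
  have "(G \<longlongrightarrow> G z) (at z)"
    using assms(2,4) by (simp add: continuous_on_eq_continuous_at isCont_def)
  moreover have "eventually (\<lambda>w. G w = 0) (at z)"
    unfolding eventually_at_topological
  proof (intro exI[of _ "ball 0 1 - ({w. poly m w = 0} - {z})"] conjI ballI impI)
    have "finite ({w. poly m w = 0} - {z})"
      using poly_roots_finite[OF assms(1)] by simp
    then show "open (ball 0 1 - ({w. poly m w = 0} - {z}))"
      by (intro open_Diff open_ball finite_imp_closed)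
    show "z \<in> ball 0 1 - ({w. poly m w = 0} - {z})" using assms(4) by simp
    show "G w = 0" if "w \<in> ball 0 1 - ({w. poly m w = 0} - {z})" "w \<noteq> z" for w
      using assms(3)[of w] that by auto
  qed
  then have "(G \<longlongrightarrow> 0) (at z)" by (rule tendsto_eventually)
  ultimately show ?thesis using tendsto_unique[OF trivial_limit_at] by blast
qed

lemma rat_denom_nonzero: "rat_denom \<omega> \<noteq> 0"
  by (simp add: rat_denom_def)

section \<open>The operator for a factored symbol\<close>

locale toeplitz_symbol =
  fixes p :: real and \<omega> :: "complex poly fract"
    and nin nT nout din dT dout :: "complex poly"
  assumes p: "1 < p"
    and num: "rat_num \<omega> = nout * (nin * nT)"
    and denom: "rat_denom \<omega> = dout * (din * dT)"
    and monic: "lead_coeff nin = 1" "lead_coeff nT = 1" "lead_coeff din = 1" "lead_coeff dT = 1"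
    and nin: "\<And>a. poly nin a = 0 \<Longrightarrow> norm a < 1"
    and nT: "\<And>a. poly nT a = 0 \<Longrightarrow> norm a = 1"
    and nout: "\<And>a. poly nout a = 0 \<Longrightarrow> norm a > 1"
    and din: "\<And>a. poly din a = 0 \<Longrightarrow> norm a < 1"
    and dT: "\<And>a. poly dT a = 0 \<Longrightarrow> norm a = 1"
    and dout: "\<And>a. poly dout a = 0 \<Longrightarrow> norm a > 1"
begin

definition nc where "nc = nin * nT"

definition dc where "dc = din * dT"

lemma p0: "0 < p"
  using p by simp

lemma nonzero: "nin \<noteq> 0" "nT \<noteq> 0" "din \<noteq> 0" "dT \<noteq> 0"
  using monic by auto

lemma num_denom: "rat_num \<omega> = nout * nc" "rat_denom \<omega> = dout * dc"
  by (simp_all add: num denom nc_def dc_def)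

lemma nonzero_closed: "nc \<noteq> 0" "dc \<noteq> 0"
  using nonzero by (simp_all add: nc_def dc_def)

lemma nout_nonzero: "norm z \<le> 1 \<Longrightarrow> poly nout z \<noteq> 0"
  using nout[of z] by auto

lemma dout_nonzero: "norm z \<le> 1 \<Longrightarrow> poly dout z \<noteq> 0"
  using dout[of z] by auto

lemma nc_roots: "poly nc a = 0 \<Longrightarrow> norm a \<le> 1"
  using nin[of a] nT[of a] by (auto simp: nc_def)

lemma dc_roots: "poly dc a = 0 \<Longrightarrow> norm a \<le> 1"
  using din[of a] dT[of a] by (auto simp: dc_def)

lemma num_nonzero: "rat_num \<omega> \<noteq> 0"
  using nout[of 0] nonzero_closed num_denom by auto

lemma coprime_dc: "coprime dc nin" "coprime dc nT"
proof -
  have "coprime (rat_num \<omega>) (rat_denom \<omega>)"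
    unfolding rat_num_def rat_denom_def by (rule coprime_quot_of_fract)
  from coprime_poly_0[OF this] have no_common: "poly (rat_num \<omega>) z \<noteq> 0 \<or> poly (rat_denom \<omega>) z \<noteq> 0" for z .
  show "coprime dc nin" "coprime dc nT"
    by (rule coprime_no_common_root[OF nonzero_closed(2)];
        use no_common in \<open>auto simp: num num_denom(2)\<close>)+
qed

lemma toeplitz_decompE:
  assumes "g \<in> Hp p" "toeplitz_decomp p \<omega> g f"
  obtains u where "poly_below (degree dc) u"
    and "\<And>z. norm z < 1 \<Longrightarrow> poly (rat_num \<omega>) z * g z = poly dout z * (poly u z + poly dc z * riesz_projection f z)"
  by (rule toeplitz_decompD[OF p assms num_denom(2)], erule dout, erule dc_roots) (rule that; blast)

text \<open>Uniqueness behind the \<open>THE\<close>: two decompositions of the same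
  \<open>g\<close> give polynomials whose difference is divisible by \<open>dc\<close>, yet lies
  below \<open>degree dc\<close>; hence it vanishes and the projections agree.\<close>

lemma toeplitz_eq:
  assumes "g \<in> Hp p" "toeplitz_decomp p \<omega> g f"
  shows "toeplitz p \<omega> g = riesz_projection f"
  unfolding toeplitz_def
proof (rule the_equality)
  show "\<exists>f'. toeplitz_decomp p \<omega> g f' \<and> riesz_projection f = riesz_projection f'"
    using assms(2) by blast
  fix h assume "\<exists>f'. toeplitz_decomp p \<omega> g f' \<and> h = riesz_projection f'"
  then obtain f' where f': "toeplitz_decomp p \<omega> g f'" "h = riesz_projection f'" by blast
  obtain u where u: "poly_below (degree dc) u"
    "\<And>z. norm z < 1 \<Longrightarrow> poly (rat_num \<omega>) z * g z = poly dout z * (poly u z + poly dc z * riesz_projection f z)"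
    using toeplitz_decompE[OF assms] by blast
  obtain u' where u': "poly_below (degree dc) u'"
    "\<And>z. norm z < 1 \<Longrightarrow> poly (rat_num \<omega>) z * g z = poly dout z * (poly u' z + poly dc z * riesz_projection f' z)"
    using toeplitz_decompE[OF assms(1) f'(1)] by blast
  have int: "integrable circle_measure f" "integrable circle_measure f'"
    using p assms(2) f'(1) by (auto simp: toeplitz_decomp_def intro: Lp_imp_integrable)
  define G where "G z = riesz_projection f z - riesz_projection f' z" for z
  have contG: "continuous_on (ball 0 1) G"
    unfolding G_def by (intro continuous_intros holomorphic_on_imp_continuous_on riesz_projection_holomorphic int)
  have smallG: "radially_small G"
    unfolding G_def by (intro radially_small_diff radially_small_riesz_projection int)
  have eq: "poly (u' - u) z = poly dc z * G z" if "norm z < 1" for z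
  proof -
    have "poly dout z \<noteq> 0" using dout_nonzero that by simp
    then have "poly u z + poly dc z * riesz_projection f z = poly u' z + poly dc z * riesz_projection f' z"
      using u(2)[OF that] u'(2)[OF that] by simp
    then have "poly u' z - poly u z = poly dc z * riesz_projection f z - poly dc z * riesz_projection f' z"
      by algebra
    then show ?thesis by (simp add: G_def right_diff_distrib)
  qed
  have "dc dvd u' - u"
    by (rule poly_dvd_of_disc[OF nonzero_closed(2) dc_roots contG smallG eq])
  then have "u' - u = 0"
    by (rule poly_below_dvd_imp_zero[OF poly_below_diff[OF u'(1) u(1)]]) simp
  then have zero: "poly dc z * G z = 0" if "norm z < 1" for z
    using eq[OF that] by (simp only: poly_0)
  show "h = riesz_projection f"
  proof
    fix z
    show "h z = riesz_projection f z"
      using disc_cancel_poly[OF nonzero_closed(2) contG zero, of z]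
      by (cases "norm z < 1") (auto simp: G_def f'(2) riesz_projection_outside)
  qed
qed

lemma toeplitz_domE:
  assumes "g \<in> toeplitz_dom p \<omega>"
  obtains u where "g \<in> Hp p" "radially_small g" "poly_below (degree dc) u"
    and "\<And>z. norm z < 1 \<Longrightarrow> poly (rat_num \<omega>) z * g z = poly dout z * (poly u z + poly dc z * toeplitz p \<omega> g z)"
proof -
  obtain f where g: "g \<in> Hp p" and f: "toeplitz_decomp p \<omega> g f"
    using assms by (auto simp: toeplitz_dom_def)
  obtain u where u: "poly_below (degree dc) u"
    "\<And>z. norm z < 1 \<Longrightarrow> poly (rat_num \<omega>) z * g z = poly dout z * (poly u z + poly dc z * riesz_projection f z)"
    using toeplitz_decompE[OF g f] by blast
  show thesis
    by (rule that[OF g toeplitz_decomp_radially_small[OF p g f] u(1)])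
      (use u(2) toeplitz_eq[OF g f] in simp)
qed

text \<open>After cancelling \<open>nout\<close>, a polynomial \<open>a\<close> solves the equation
  exactly when \<open>nc\<close> divides \<open>u + dc * k\<close>, as \<open>nc\<close> and
  \<open>dout\<close> share no root. A polynomial \<open>k\<close> is thus put into the range by
  solving a divisibility problem.\<close>

lemma toeplitz_polyI:
  assumes u: "poly_below (degree dc) u"
    and eq: "rat_num \<omega> * a = nout * (dout * (u + dc * k))"
  defines "g \<equiv> restrict_disc (\<lambda>z. poly a z / poly nout z)"
  shows "g \<in> toeplitz_dom p \<omega>" and "toeplitz p \<omega> g = restrict_disc (poly k)"
proof -
  have u': "poly_below (degree din + degree dT) u"
    using u nonzero by (simp add: dc_def degree_mult_eq)
  have eq': "rat_num \<omega> * a = nout * (dout * (u + din * dT * k))"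
    using eq by (simp add: dc_def)
  have g: "g \<in> Hp p"
    unfolding g_def
    by (rule toeplitz_decompI(1)[OF p0 denom])
      (rule monic(3) nonzero(4) u' eq' | erule din dT dout nout)+
  have "\<exists>f. toeplitz_decomp p \<omega> g f \<and> riesz_projection f = restrict_disc (poly k)"
    unfolding g_def
    by (rule toeplitz_decompI(2)[OF p0 denom])
      (rule monic(3) nonzero(4) u' eq' | erule din dT dout nout)+
  then obtain f where f: "toeplitz_decomp p \<omega> g f" "riesz_projection f = restrict_disc (poly k)" by blast
  show "g \<in> toeplitz_dom p \<omega>" using g f(1) by (auto simp: toeplitz_dom_def)
  show "toeplitz p \<omega> g = restrict_disc (poly k)"
    using toeplitz_eq[OF g f(1)] f(2) by simp
qed

lemma toeplitz_injective:
  assumes deg: "degree dc \<le> degree nc"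
  shows "inj_on (toeplitz p \<omega>) (toeplitz_dom p \<omega>)"
proof (rule inj_onI)
  fix g g' assume g: "g \<in> toeplitz_dom p \<omega>" and g': "g' \<in> toeplitz_dom p \<omega>"
    and T: "toeplitz p \<omega> g = toeplitz p \<omega> g'"
  obtain u where u: "g \<in> Hp p" "radially_small g" "poly_below (degree dc) u"
    "\<And>z. norm z < 1 \<Longrightarrow> poly (rat_num \<omega>) z * g z = poly dout z * (poly u z + poly dc z * toeplitz p \<omega> g z)"
    using toeplitz_domE[OF g] by blast
  obtain u' where u': "g' \<in> Hp p" "radially_small g'" "poly_below (degree dc) u'"
    "\<And>z. norm z < 1 \<Longrightarrow> poly (rat_num \<omega>) z * g' z = poly dout z * (poly u' z + poly dc z * toeplitz p \<omega> g' z)"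
    using toeplitz_domE[OF g'] by blast
  have diff: "poly (rat_num \<omega>) z * (g z - g' z) = poly dout z * poly (u - u') z" if "norm z < 1" for z
    unfolding right_diff_distrib u(4)[OF that] u'(4)[OF that] T by (simp add: algebra_simps)
  have contg: "continuous_on (ball 0 1) (\<lambda>z. g z - g' z)"
    by (intro continuous_intros HpD(2)[OF u(1)] HpD(2)[OF u'(1)])
  \<comment> \<open>\<open>dout\<close> has no root in the closed disc, so the outer factors join
    \<open>g - g'\<close> without spoiling continuity or radial smallness.\<close>
  define G where "G z = poly nout z / poly dout z * (g z - g' z)" for z
  have cont_quot: "continuous_on (cball 0 1) (\<lambda>z. poly nout z / poly dout z)"
    using dout_nonzero by (intro continuous_intros) auto
  have contG: "continuous_on (ball 0 1) G"
    unfolding G_def by (rule continuous_on_mult[OF continuous_on_subset[OF cont_quot] contg]) auto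
  have smallG: "radially_small G"
    unfolding G_def by (rule radially_small_mult[OF radially_small_diff[OF u(2) u'(2)] cont_quot])
  have eq: "poly (u - u') z = poly nc z * G z" if z: "norm z < 1" for z
  proof -
    have nz: "poly dout z \<noteq> 0" using dout_nonzero z by simp
    have "poly nc z * G z = (poly (rat_num \<omega>) z * (g z - g' z)) / poly dout z"
      by (simp add: G_def num_denom(1) mult_ac)
    also have "\<dots> = poly (u - u') z" unfolding diff[OF z] using nz by simp
    finally show ?thesis ..
  qed
  have "nc dvd u - u'"
    by (rule poly_dvd_of_disc[OF nonzero_closed(1) nc_roots contG smallG eq])
  then have "u - u' = 0"
    by (rule poly_below_dvd_imp_zero[OF poly_below_diff[OF u(3) u'(3)] _ deg])
  then have zero: "poly (rat_num \<omega>) z * (g z - g' z) = 0" if "norm z < 1" for z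
    using diff[OF that] by (simp only: poly_0 mult_zero_right)
  show "g = g'"
  proof
    fix z
    show "g z = g' z"
      using disc_cancel_poly[OF num_nonzero contg zero, of z] HpD(3)[OF u(1), of z] HpD(3)[OF u'(1), of z]
      by (cases "norm z < 1") auto
  qed
qed

text \<open>The degree assumption makes \<open>nc\<close> an admissible \<open>u\<close>. With
  \<open>u = nc\<close> and \<open>k = 0\<close> the function \<open>dout / nout\<close> is sent to
  0, as is the zero function, but it does not vanish at 0.\<close>

lemma toeplitz_not_injective:
  assumes deg: "degree nc < degree dc"
  shows "\<not> inj_on (toeplitz p \<omega>) (toeplitz_dom p \<omega>)"
proof
  assume inj: "inj_on (toeplitz p \<omega>) (toeplitz_dom p \<omega>)"
  have b1: "poly_below (degree dc) nc" using deg by (simp add: poly_below_iff)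
  have b2: "poly_below (degree dc) 0" by (simp add: poly_below_iff)
  have e1: "rat_num \<omega> * dout = nout * (dout * (nc + dc * 0))" by (simp add: num_denom mult_ac)
  have e2: "rat_num \<omega> * 0 = nout * (dout * (0 + dc * 0))" by simp
  note I1 = toeplitz_polyI[OF b1 e1] and I2 = toeplitz_polyI[OF b2 e2]
  have "restrict_disc (\<lambda>z. poly dout z / poly nout z) = restrict_disc (\<lambda>z. poly 0 z / poly nout z)"
    by (rule inj_onD[OF inj _ I1(1) I2(1)]) (simp only: I1(2) I2(2))
  from fun_cong[OF this, of 0] have "poly dout 0 / poly nout 0 = 0" by (simp add: restrict_disc_def)
  then show False using dout_nonzero[of 0] nout_nonzero[of 0] by simp
qed

lemma toeplitz_dense_range:
  assumes deg: "degree nin \<le> degree dc"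
  shows "dense_in_Hp p (toeplitz p \<omega> ` toeplitz_dom p \<omega>)"
  unfolding dense_in_Hp_def
proof (intro ballI allI impI)
  fix h \<epsilon> assume h: "h \<in> Hp p" and \<epsilon>: "(0::real) < \<epsilon>"
  define \<epsilon>' where "\<epsilon>' = (\<epsilon> / 2) powr p / (2 * 2 powr p)"
  have \<epsilon>': "0 < \<epsilon>'" using \<epsilon> by (simp add: \<epsilon>'_def)
  obtain q where q: "\<And>r. 0 \<le> r \<Longrightarrow> r < 1 \<Longrightarrow> circle_mean p (\<lambda>z. h z - poly q z) r \<le> \<epsilon>'"
    using Hp_poly_approx[OF p h \<epsilon>'] by blast
  \<comment> \<open>The negative remainder makes \<open>u + dc * q\<close> a multiple of
    \<open>nin\<close>. It lies below \<open>degree nin\<close>, hence below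
    \<open>degree dc\<close> by assumption, as an admissible \<open>u\<close> must.\<close>
  define u where "u = - ((dc * q) mod nin)"
  have u: "poly_below (degree dc) u"
    using poly_below_mono[OF poly_below_mod[OF nonzero(1)] deg, of "dc * q"] by (simp add: u_def poly_below_def)
  define v where "v = (dc * q) div nin"
  have v: "u + dc * q = nin * v"
    unfolding u_def v_def by (simp add: minus_mod_eq_mult_div)
  \<comment> \<open>To bring in \<open>nT\<close>, perturb \<open>q\<close> by
    \<open>nin * e\<close>: then \<open>nT\<close> must divide \<open>v - dc * e\<close>. As
    \<open>x\<close> inverts \<open>dc\<close> modulo \<open>nT\<close>, the solutions are
    \<open>e = x * v - nT * w\<close>, and \<open>w\<close> is free to make \<open>e\<close> small
    in mean.\<close>
  obtain x y where xy: "x * dc + y * nT = 1" using bezout_complex_poly[OF coprime_dc(2)] .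
  obtain B where B: "0 < B" "\<And>z. norm z < 1 \<Longrightarrow> norm (poly nin z) \<le> B"
    using poly_bounded_disc[of nin] by blast
  have "0 < \<epsilon>' / B powr p" using \<epsilon>' B(1) by simp
  from poly_multiples_dense[OF p0 nonzero(2) nT this, of "x * v"] obtain w where
    w: "\<And>r. 0 \<le> r \<Longrightarrow> r < 1 \<Longrightarrow> circle_mean p (poly (x * v - nT * w)) r \<le> \<epsilon>' / B powr p" by blast
  define k where "k = q - nin * (x * v - nT * w)"
  have "u + dc * k = nin * (nT * (y * v + dc * w))"
  proof -
    have "u + dc * k = (u + dc * q) - nin * (dc * (x * v - nT * w))"
      by (simp add: k_def algebra_simps)
    also have "\<dots> = nin * (1 * v - (x * dc) * v + dc * (nT * w))"
      unfolding v by (simp add: algebra_simps)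
    also have "\<dots> = nin * (nT * (y * v + dc * w))"
      unfolding xy[symmetric] by (simp add: algebra_simps)
    finally show ?thesis .
  qed
  then have "rat_num \<omega> * (dout * (y * v + dc * w)) = nout * (dout * (u + dc * k))"
    unfolding num by (simp add: mult_ac)
  note I = toeplitz_polyI[OF u this]
  obtain B' where "\<And>z. norm z < 1 \<Longrightarrow> norm (poly k z) \<le> B'" using poly_bounded_disc[of k] by blast
  then have kHp: "restrict_disc (poly k) \<in> Hp p"
    by (intro restrict_disc_Hp[OF p0] holomorphic_on_poly)
  have "Hp_norm p (\<lambda>z. h z - restrict_disc (poly k) z) < \<epsilon>"
  proof (rule Hp_norm_lessI[OF p0 \<epsilon>])
    fix r :: real assume r: "0 \<le> r" "r < 1"
    have "circle_mean p (\<lambda>z. h z - restrict_disc (poly k) z) r =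
        circle_mean p (\<lambda>z. (h z - poly q z) + poly nin z * poly (x * v - nT * w) z) r"
      unfolding circle_mean_def
      by (rule circle_integral_cong) (use of_real_mult_in_ball[OF r] in \<open>simp add: restrict_disc_def k_def algebra_simps\<close>)
    also have "\<dots> \<le> 2 powr p * (circle_mean p (\<lambda>z. h z - poly q z) r + circle_mean p (\<lambda>z. poly nin z * poly (x * v - nT * w) z) r)"
      by (rule circle_mean_add_le[OF _ _ r p0]) (intro continuous_intros HpD(2)[OF h])+
    also have "\<dots> \<le> 2 powr p * (\<epsilon>' + B powr p * (\<epsilon>' / B powr p))"
    proof (intro mult_left_mono add_mono q r)
      have "circle_mean p (\<lambda>z. poly nin z * poly (x * v - nT * w) z) r \<le> B powr p * circle_mean p (poly (x * v - nT * w)) r"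
        by (rule circle_mean_mult_le[OF _ _ r p0 B(2)]) (intro continuous_intros)+
      also have "\<dots> \<le> B powr p * (\<epsilon>' / B powr p)"
        by (intro mult_left_mono w r) simp
      finally show "circle_mean p (\<lambda>z. poly nin z * poly (x * v - nT * w) z) r \<le> B powr p * (\<epsilon>' / B powr p)" .
    qed simp
    also have "\<dots> = (\<epsilon> / 2) powr p" using B(1) by (simp add: \<epsilon>'_def)
    finally show "circle_mean p (\<lambda>z. h z - restrict_disc (poly k) z) r \<le> (\<epsilon> / 2) powr p" .
  qed
  moreover have "restrict_disc (poly k) \<in> toeplitz p \<omega> ` toeplitz_dom p \<omega>"
    using I by (intro image_eqI) auto
  ultimately show "\<exists>k\<in>toeplitz p \<omega> ` toeplitz_dom p \<omega> \<inter> Hp p. Hp_norm p (\<lambda>z. h z - k z) < \<epsilon>"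
    using kHp by blast
qed

text \<open>
  On a circle of radius \<open>R < 1\<close> around all zeroes of \<open>nin\<close>, the Fourier coefficient of index \<open>-1\<close>
  of \<open>dc * h / nin\<close> vanishes for every \<open>h\<close> in the range, since \<open>dc * h + u\<close> is divisible by \<open>nin\<close>
  for a polynomial \<open>u\<close> of degree less than \<open>degree nin - 1\<close>.
\<close>

lemma toeplitz_not_dense_range:
  assumes deg: "degree dc < degree nin"
  shows "\<not> dense_in_Hp p (toeplitz p \<omega> ` toeplitz_dom p \<omega>)"
proof
  assume dense: "dense_in_Hp p (toeplitz p \<omega> ` toeplitz_dom p \<omega>)"
  define N where "N = degree nin"
  have N: "0 < N" using deg by (simp add: N_def)
  \<comment> \<open>Halfway between the largest modulus of a root of \<open>nin\<close> and
    1.\<close>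
  obtain R where R: "0 < R" "R < 1" "\<And>a. poly nin a = 0 \<Longrightarrow> norm a < R"
  proof -
    have "finite (norm ` {a. poly nin a = 0})"
      using poly_roots_finite[OF nonzero(1)] by simp
    then have fin: "finite (insert 0 (norm ` {a. poly nin a = 0}))" by simp
    define R0 where "R0 = Max (insert 0 (norm ` {a. poly nin a = 0}))"
    have "R0 \<in> insert 0 (norm ` {a. poly nin a = 0})"
      unfolding R0_def by (rule Max_in[OF fin]) simp
    then have R0: "0 \<le> R0" "R0 < 1" using nin by auto
    have "norm a \<le> R0" if "poly nin a = 0" for a
      unfolding R0_def by (rule Max_ge[OF fin]) (use that in simp)
    then show thesis using R0 that[of "(1 + R0) / 2"] by fastforce
  qed
  have nin_nz: "poly nin (of_real R * \<zeta>) \<noteq> 0" if "norm \<zeta> = 1" for \<zeta>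
    using R(3)[of "of_real R * \<zeta>"] that R(1) by (auto simp: norm_mult)
  have Rball: "norm (complex_of_real R * \<zeta>) < 1" if "norm \<zeta> = 1" for \<zeta>
    by (rule of_real_mult_in_ball[OF less_imp_le[OF R(1)] R(2) that])
  obtain x y where xy: "x * dc + y * nin = 1" using bezout_complex_poly[OF coprime_dc(1)] .
  \<comment> \<open>\<open>h0\<close> is chosen so that \<open>dc * h0\<close> equals
    \<open>z ^ (N - 1)\<close> up to a multiple of \<open>nin\<close>. Divided by \<open>nin\<close>
    on the circle of radius \<open>R\<close>, it has the coefficient \<open>1 / R\<close> at index
    -1, whereas range elements give 0 there.\<close>
  define mon where "mon = (monom 1 (N - 1) :: complex poly)"
  define h0 where "h0 = x * mon"
  obtain B0 where "\<And>z. norm z < 1 \<Longrightarrow> norm (poly h0 z) \<le> B0" using poly_bounded_disc[of h0] by blast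
  then have h0_Hp: "restrict_disc (poly h0) \<in> Hp p"
    by (intro restrict_disc_Hp[OF p0] holomorphic_on_poly)
  have cont_c: "continuous_on (sphere 0 1) (\<lambda>\<zeta>. poly dc (of_real R * \<zeta>) / poly nin (of_real R * \<zeta>))"
    using nin_nz by (intro continuous_intros) auto
  have "compact ((\<lambda>\<zeta>. poly dc (of_real R * \<zeta>) / poly nin (of_real R * \<zeta>)) ` sphere 0 1)"
    by (rule compact_continuous_image[OF cont_c]) simp
  then obtain K0 where "\<forall>y\<in>(\<lambda>\<zeta>. poly dc (of_real R * \<zeta>) / poly nin (of_real R * \<zeta>)) ` sphere 0 1. norm y \<le> K0"
    using compact_imp_bounded bounded_iff by blast
  then have K0: "norm (poly dc (of_real R * \<zeta>) / poly nin (of_real R * \<zeta>)) \<le> K0" if "norm \<zeta> = 1" for \<zeta>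
    using that by simp
  define K where "K = max K0 1"
  have K: "0 < K" by (simp add: K_def)
  \<comment> \<open>Gives \<open>K * (2 * \<epsilon>) = 1 / 2\<close>, below the value
    \<open>1 / R > 1\<close> that the coefficient must have; the 2 is lost in
    \<open>circle_mean_1_le\<close>.\<close>
  define \<epsilon> where "\<epsilon> = 1 / (4 * K)"
  have \<epsilon>: "0 < \<epsilon>" using K by (simp add: \<epsilon>_def)
  obtain k where k: "k \<in> toeplitz p \<omega> ` toeplitz_dom p \<omega>" "k \<in> Hp p"
    "Hp_norm p (\<lambda>z. restrict_disc (poly h0) z - k z) < \<epsilon>"
    using dense[unfolded dense_in_Hp_def] h0_Hp \<epsilon> by blast
  define F where "F z = restrict_disc (poly h0) z - k z" for z
  have F_Hp: "F \<in> Hp p" unfolding F_def by (rule Hp_diff[OF h0_Hp k(2) p0])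
  have norm_nonneg: "0 \<le> Hp_norm p F"
  proof -
    have "0 \<le> integral_mean p F 0" by (simp add: integral_mean_def)
    also have "\<dots> \<le> Hp_norm p F"
      unfolding Hp_norm_def using F_Hp by (intro cSUP_upper) (auto simp: Hp_def)
    finally show ?thesis .
  qed
  have "circle_mean p F R \<le> Hp_norm p F powr p"
    using circle_mean_le_Hp_norm[OF F_Hp p0 _ R(2)] R(1) by simp
  also have "\<dots> \<le> \<epsilon> powr p"
    using k(3) norm_nonneg p0 by (intro powr_mono2) (auto simp: F_def[abs_def])
  finally have F_le: "(LINT \<zeta>|circle_measure. norm (F (of_real R * \<zeta>))) \<le> 2 * \<epsilon>"
    using circle_mean_1_le[OF HpD(2)[OF F_Hp] _ R(2) _ \<epsilon>, of p] R(1) p by simp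
  obtain g where g: "g \<in> toeplitz_dom p \<omega>" "k = toeplitz p \<omega> g" using k(1) by blast
  obtain u where u: "g \<in> Hp p" "radially_small g" "poly_below (degree dc) u"
    "\<And>z. norm z < 1 \<Longrightarrow> poly (rat_num \<omega>) z * g z = poly dout z * (poly u z + poly dc z * toeplitz p \<omega> g z)"
    using toeplitz_domE[OF g(1)] by blast
  \<comment> \<open>Collects the terms that are holomorphic in the disc once \<open>nin\<close> is
    divided out, so it adds nothing at index -1.\<close>
  define W where "W z = poly (y * mon) z + poly (nT * nout) z / poly dout z * g z" for z
  have holW: "W holomorphic_on ball 0 1"
    unfolding W_def using dout_nonzero
    by (intro holomorphic_on_add holomorphic_on_mult holomorphic_on_divide holomorphic_on_poly HpD(1)[OF u(1)]) auto
  define \<phi> where "\<phi> \<zeta> = poly dc (of_real R * \<zeta>) / poly nin (of_real R * \<zeta>) * F (of_real R * \<zeta>)" for \<zeta>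
  define \<psi> where "\<psi> \<zeta> = poly (mon + u) (of_real R * \<zeta>) / poly nin (of_real R * \<zeta>)" for \<zeta>
  have contFR: "continuous_on (sphere 0 1) (\<lambda>\<zeta>. F (of_real R * \<zeta>))"
    using R by (intro continuous_on_dilate HpD(2)[OF F_Hp]) auto
  have int_\<phi>: "integrable circle_measure \<phi>"
    unfolding \<phi>_def by (intro integrable_circle_continuous continuous_on_mult cont_c contFR)
  have int_\<psi>: "integrable circle_measure \<psi>"
    unfolding \<psi>_def using nin_nz by (intro integrable_circle_continuous continuous_intros) auto
  have int_W: "integrable circle_measure (\<lambda>\<zeta>. W (of_real R * \<zeta>))"
    using R by (intro integrable_circle_continuous continuous_on_dilate holomorphic_on_imp_continuous_on holW) auto
  have \<phi>_eq: "\<phi> \<zeta> = \<psi> \<zeta> - W (of_real R * \<zeta>)" if \<zeta>: "norm \<zeta> = 1" for \<zeta>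
  proof -
    define z where "z = of_real R * \<zeta>"
    have z: "norm z < 1" "poly nin z \<noteq> 0" "poly dout z \<noteq> 0"
      using Rball[OF \<zeta>] nin_nz[OF \<zeta>] dout_nonzero[of z] by (auto simp: z_def)
    have "dc * h0 = mon - (y * mon) * nin"
      using arg_cong[OF xy, of "\<lambda>q. q * mon"] by (simp add: h0_def algebra_simps)
    from arg_cong[OF this, of "\<lambda>q. poly q z"]
    have 1: "poly dc z * poly h0 z = poly mon z - poly (y * mon) z * poly nin z"
      by simp
    have "poly dout z * (poly u z + poly dc z * k z) = poly nin z * (poly (nT * nout) z * g z)"
      using u(4)[OF z(1)] by (simp add: g(2) num mult_ac)
    then have "poly u z + poly dc z * k z = poly nin z * (poly (nT * nout) z * g z) / poly dout z"
      using nonzero_eq_divide_eq[OF z(3)] by (simp only: mult.commute)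
    then have 2: "poly dc z * k z = poly nin z * (poly (nT * nout) z / poly dout z * g z) - poly u z"
      by (simp add: eq_diff_eq add.commute)
    have "poly dc z * F z = poly (mon + u) z - poly nin z * W z"
      unfolding F_def W_def right_diff_distrib 2 using z(1) 1
      by (simp add: restrict_disc_def algebra_simps)
    then have "poly dc z / poly nin z * F z = (poly (mon + u) z - poly nin z * W z) / poly nin z"
      by simp
    also have "\<dots> = poly (mon + u) z / poly nin z - W z"
      using z(2) by (simp add: diff_divide_distrib)
    finally show ?thesis by (simp add: \<phi>_def \<psi>_def z_def)
  qed
  have below: "poly_below (degree nin) (mon + u)"
  proof (rule poly_below_add)
    show "poly_below (degree nin) mon"
      using N by (simp add: poly_below_def mon_def N_def)
    show "poly_below (degree nin) u"
      by (rule poly_below_mono[OF u(3)]) (use deg in simp)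
  qed
  \<comment> \<open>\<open>degree dc \<le> N - 1\<close>, so \<open>u\<close> does not reach the
    coefficient of index \<open>N - 1\<close> and the 1 of \<open>mon\<close> survives.\<close>
  have "coeff (mon + u) (degree nin - 1) = 1"
    using u(3) deg by (simp add: mon_def N_def poly_below_def)
  then have "fourier_coeff \<psi> (-1) = 1 / of_real R"
    using fourier_coeff_proper_fraction[OF R(1) monic(1) R(3) below] N by (simp add: \<psi>_def[abs_def] N_def)
  moreover have "fourier_coeff (\<lambda>\<zeta>. W (of_real R * \<zeta>)) (-1) = 0"
    using fourier_coeff_dilate[OF holW _ R(2), of "-1"] R(1) by simp
  moreover have "fourier_coeff \<phi> (-1) = fourier_coeff (\<lambda>\<zeta>. \<psi> \<zeta> - W (of_real R * \<zeta>)) (-1)"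
    by (rule fourier_coeff_cong[OF \<phi>_eq])
  ultimately have "fourier_coeff \<phi> (-1) = 1 / of_real R"
    by (simp add: fourier_coeff_diff[OF int_\<psi> int_W])
  then have "1 / R = norm (fourier_coeff \<phi> (-1))"
    using R(1) by (simp add: norm_divide)
  also have "\<dots> \<le> (LINT \<zeta>|circle_measure. norm (\<phi> \<zeta>))"
    by (rule norm_fourier_coeff_le[OF int_\<phi>])
  also have "\<dots> \<le> (LINT \<zeta>|circle_measure. K * norm (F (of_real R * \<zeta>)))"
  proof (rule integral_mono_AE)
    show "integrable circle_measure (\<lambda>\<zeta>. K * norm (F (of_real R * \<zeta>)))"
      by (intro integrable_mult_right integrable_norm integrable_circle_continuous contFR)
    show "AE \<zeta> in circle_measure. norm (\<phi> \<zeta>) \<le> K * norm (F (of_real R * \<zeta>))"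
    proof (rule AE_circleI)
      fix \<zeta> :: complex assume "norm \<zeta> = 1"
      from K0[OF this] show "norm (\<phi> \<zeta>) \<le> K * norm (F (of_real R * \<zeta>))"
        unfolding \<phi>_def norm_mult[of "poly dc _ / _"] by (intro mult_right_mono) (auto simp: K_def)
    qed
  qed (intro integrable_norm int_\<phi>)
  also have "\<dots> = K * (LINT \<zeta>|circle_measure. norm (F (of_real R * \<zeta>)))"
    by (rule integral_mult_right_zero)
  also have "\<dots> \<le> K * (2 * \<epsilon>)" using K by (intro mult_left_mono F_le) simp
  also have "\<dots> = 1 / 2" using K by (simp add: \<epsilon>_def)
  finally have "1 / R \<le> 1 / 2" .
  moreover have "1 < 1 / R" using R by simp
  ultimately show False by simp
qed

end

theorem proposition2p4:
  fixes p :: real and \<omega> :: "complex poly fract"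
  assumes "1 < p" and "\<omega> \<noteq> 0"
  shows "(inj_on (toeplitz p \<omega>) (toeplitz_dom p \<omega>) \<longleftrightarrow>
            poles_count \<omega> (cball 0 1) \<le> zeroes_count \<omega> (cball 0 1)) \<and>
         (dense_in_Hp p (toeplitz p \<omega> ` toeplitz_dom p \<omega>) \<longleftrightarrow>
            poles_count \<omega> (cball 0 1) \<ge> zeroes_count \<omega> (ball 0 1)) \<and>
         (inj_on (toeplitz p \<omega>) (toeplitz_dom p \<omega>) \<or>
            dense_in_Hp p (toeplitz p \<omega> ` toeplitz_dom p \<omega>))"
proof -
  have n0: "rat_num \<omega> \<noteq> 0" using assms(2) by (simp add: rat_num_def)
  obtain nin nT nout where n: "rat_num \<omega> = nout * (nin * nT)" "lead_coeff nin = 1" "lead_coeff nT = 1"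
    "\<And>a. poly nin a = 0 \<Longrightarrow> norm a < 1" "\<And>a. poly nT a = 0 \<Longrightarrow> norm a = 1"
    "\<And>a. poly nout a = 0 \<Longrightarrow> norm a > 1"
    "degree nin = (\<Sum>a\<in>{a\<in>ball 0 1. poly (rat_num \<omega>) a = 0}. order a (rat_num \<omega>))"
    "degree (nin * nT) = (\<Sum>a\<in>{a\<in>cball 0 1. poly (rat_num \<omega>) a = 0}. order a (rat_num \<omega>))"
    by (rule poly_disc_factorization[OF n0]) (rule that; (assumption | blast))
  obtain din dT dout where d: "rat_denom \<omega> = dout * (din * dT)" "lead_coeff din = 1" "lead_coeff dT = 1"
    "\<And>a. poly din a = 0 \<Longrightarrow> norm a < 1" "\<And>a. poly dT a = 0 \<Longrightarrow> norm a = 1"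
    "\<And>a. poly dout a = 0 \<Longrightarrow> norm a > 1"
    "degree din = (\<Sum>a\<in>{a\<in>ball 0 1. poly (rat_denom \<omega>) a = 0}. order a (rat_denom \<omega>))"
    "degree (din * dT) = (\<Sum>a\<in>{a\<in>cball 0 1. poly (rat_denom \<omega>) a = 0}. order a (rat_denom \<omega>))"
    by (rule poly_disc_factorization[OF rat_denom_nonzero]) (rule that; (assumption | blast))
  interpret T: toeplitz_symbol p \<omega> nin nT nout din dT dout
    by unfold_locales (fact assms(1) n d)+
  have counts: "zeroes_count \<omega> (ball 0 1) = degree nin" "zeroes_count \<omega> (cball 0 1) = degree T.nc"
    "poles_count \<omega> (cball 0 1) = degree T.dc"
    using n(7,8) d(8) by (simp_all add: zeroes_count_def poles_count_def T.nc_def T.dc_def)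
  \<comment> \<open>This links the two criteria: if injectivity fails, then
    \<open>degree nin \<le> degree T.nc < degree T.dc\<close>, so the range is dense.\<close>
  have "degree nin \<le> degree T.nc"
    using T.nonzero by (simp add: T.nc_def degree_mult_eq)
  then show ?thesis
    unfolding counts
    using T.toeplitz_injective T.toeplitz_not_injective T.toeplitz_dense_range T.toeplitz_not_dense_range
    by (meson le_trans linorder_not_le nat_le_linear)
qed

end
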